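(* Let $\mathcal H=(\mathcal H_L,\mathcal H_R,S)$ be a Hopf algebroid. If $B\subseteq A$ is an $\mathcal H$-cleft extension, then there exist a measuring of $B$ by $\mathcal H_L$ and an invertible $B$-valued 2-cocycle $\sigma$ on $\mathcal H_L$ for which $B$ is a $\sigma$-twisted left $\mathcal H_L$-module, and a left $B$-module right $\mathcal H$-comodule algebra isomorphism $A\to B\#_\sigma\mathcal H_L$.
   Context: $k$ is a commutative unital ring; algebras are associative unital $k$-algebras; for an algebra $R$, an $R$-ring is an algebra $A$ with an algebra map $R\to A$ (the unit map). Summations are suppressed in Sweedler notation. Left bialgebroid $\mathcal H_L=(H,L,s_L,t_L,\gamma_L,\pi_L)$: algebras $H,L$; algebra maps $s_L:L\to H$, $t_L:L^{op}\to H$ with commuting images; $H$ is an $L$-bimodule via $l h l'=s_L(l)t_L(l')h$; $L$-bimodule maps $\gamma_L:H\to H\otimes_L H$, $h\mapsto h_{(1)}\otimes_L h_{(2)}$, and $\pi_L:H\to L$ form a coassociative counital $L$-coring; $h_{(1)}t_L(l)\otimes_L h_{(2)}=h_{(1)}\otimes_L h_{(2)}s_L(l)$; $\gamma_L(1)=1\otimes_L 1$; $\gamma_L(hh')=\gamma_L(h)\gamma_L(h')$; $\pi_L(1)=1$; $\pi_L(hs_L(\pi_L(h')))=\pi_L(hh')=\pi_L(ht_L(\pi_L(h')))$. Right bialgebroid $\mathcal H_R=(H,R,s_R,t_R,\gamma_R,\pi_R)$: algebra maps $s_R:R\to H$, $t_R:R^{op}\to H$ with commuting images; $R$-bimodule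 $rhr'=h s_R(r')t_R(r)$; $R$-coring $\gamma_R:H\to H\otimes_RH$, $h\mapsto h^{(1)}\otimes_R h^{(2)}$, $\pi_R:H\to R$; $s_R(r)h^{(1)}\otimes_R h^{(2)}=h^{(1)}\otimes_R t_R(r)h^{(2)}$; $\gamma_R$ unital and multiplicative; $\pi_R(1)=1$; $\pi_R(s_R(\pi_R(h))h')=\pi_R(hh')=\pi_R(t_R(\pi_R(h))h')$. Hopf algebroid $\mathcal H=(\mathcal H_L,\mathcal H_R,S)$: a left bialgebroid $\mathcal H_L=(H,L,s_L,t_L,\gamma_L,\pi_L)$ and a right bialgebroid $\mathcal H_R=(H,R,s_R,t_R,\gamma_R,\pi_R)$ on the same algebra $H$ with $s_L\pi_Lt_R=t_R$, $t_L\pi_Ls_R=s_R$, $s_R\pi_Rt_L=t_L$, $t_R\pi_Rs_L=s_L$; $(\gamma_L\otimes_R H)\gamma_R=(H\otimes_L\gamma_R)\gamma_L$, $(\gamma_R\otimes_L H)\gamma_L=(H\otimes_R\gamma_L)\gamma_R$; and a $k$-linear antipode $S:H\to H$ with $S(t_L(l)ht_R(r))=s_R(r)S(h)s_L(l)$, $S(t_R(r)ht_L(l))=s_L(l)S(h)s_R(r)$, $S(h_{(1)})h_{(2)}=s_R(\pi_R(h))$, $h^{(1)}S(h^{(2)})=s_L(\pi_L(h))$. A right $\mathcal H_R$-comodule is a right comodule $m\mapsto m^{[0]}\otimes_R m^{[1]}$ of the $R$-coring $H$; it is an $R$-bimodule with left action $rm=m^{[0]}\pi_R(s_R(r)m^{[1]})$.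 A right $\mathcal H_L$-comodule is a right comodule $m\mapsto m_{[0]}\otimes_Lm_{[1]}$ of the $L$-coring $H$. A right $\mathcal H$-comodule is a right $R$- and right $L$-module $M$ with an $\mathcal H_R$-coaction $\varrho_R$ and an $\mathcal H_L$-coaction $\varrho_L$ such that $\varrho_R$ is right $L$-linear, $\varrho_L$ is right $R$-linear, $(M\otimes_R\gamma_L)\varrho_R=(\varrho_R\otimes_LH)\varrho_L$ and $(M\otimes_L\gamma_R)\varrho_L=(\varrho_L\otimes_RH)\varrho_R$ (here $(m\otimes_R h)l=m\otimes_R t_L(l)h$, $(m\otimes_L h)r=m\otimes_L hs_R(r)$). Morphisms are maps colinear for both coactions. $H$ itself is a right $\mathcal H$-comodule via $\gamma_R,\gamma_L$. A right $\mathcal H$-comodule algebra is an $R$-ring $A$ with unit map $\eta_R:R\to A$ that is a right $\mathcal H$-comodule, the $R$-bimodule structure being given by multiplication with $\eta_R$ (and the right $L$-action then being $al=\eta_R(\pi_R(t_L(l)))a$), such that both coactions are unital and multiplicative. A right $\mathcal H$-extension $B\subseteq A$ is a right $\mathcal H$-comodule algebra $A$ with $B=\{b\in A: b^{[0]}\otimes_R b^{[1]}=b\otimes_R 1_H\}$. The extension is $\mathcal H$-cleft if (a) $A$ is an $L$-ring with unit map $\eta_L:L\to A$, and $B$ is an $L$-subring (so $\eta_L(L)\subseteq B$); and (b) there is a left $L$-linear ($j(s_L(l)h)=\eta_L(l)j(h)$) right $\mathcal H$-comodule map $j:H\to A$ (a cleaving map) that is convolution invertible: there is a $k$-linear $j^{c}:H\to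 A$ with $j^{c}(t_L(l)ht_R(r))=\eta_R(r)j^{c}(h)\eta_L(l)$, $j(h^{(1)})j^{c}(h^{(2)})=\eta_L(\pi_L(h))$, $j^{c}(h_{(1)})j(h_{(2)})=\eta_R(\pi_R(h))$. $B$ is regarded as an $L$-ring via $\iota=\eta_L:L\to B$. Crossed products. $\mathcal H_L$ measures $B$ if there is a $k$-linear map $H\otimes_kB\to B$, $h\otimes b\mapsto h\cdot b$, with $h\cdot1_B=\iota(\pi_L(h))$; $(t_L(l)h)\cdot b=(h\cdot b)\iota(l)$, $(s_L(l)h)\cdot b=\iota(l)(h\cdot b)$; $h\cdot(bb')=(h_{(1)}\cdot b)(h_{(2)}\cdot b')$. A 2-cocycle is a $k$-linear map $\sigma:H\otimes_{L^{op}}H\to B$ (so $\sigma(ht_L(l),k)=\sigma(h,t_L(l)k)$) with (a) $\sigma(s_L(l)h,k)=\iota(l)\sigma(h,k)$, $\sigma(t_L(l)h,k)=\sigma(h,k)\iota(l)$; (b) $(h_{(1)}\cdot\iota(l))\sigma(h_{(2)},k)=\sigma(h,s_L(l)k)$; (c) $\sigma(1,h)=\iota(\pi_L(h))=\sigma(h,1)$; (d) $[h_{(1)}\cdot\sigma(k_{(1)},m_{(1)})]\sigma(h_{(2)},k_{(2)}m_{(2)})=\sigma(h_{(1)},k_{(1)})\sigma(h_{(2)}k_{(2)},m)$. $B$ is $\sigma$-twisted if moreover $1_H\cdot b=b$ and $[h_{(1)}\cdot(k_{(1)}\cdot b)]\sigma(h_{(2)},k_{(2)})=\sigma(h_{(1)},k_{(1)})(h_{(2)}k_{(2)}\cdot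 b)$. The crossed product $B\#_\sigma\mathcal H_L$ is then $B\otimes_LH$ (left $L$-action on $H$ by left multiplication by $s_L(l)$; elements written $b\#h$) with unit $1_B\#1_H$ and product $(b\#h)(b'\#h')=b(h_{(1)}\cdot b')\sigma(h_{(2)},h'_{(1)})\#h_{(3)}h'_{(2)}$. It is an $R$-ring via $r\mapsto1_B\#s_R(r)$, a left $B$-module via $B$ and a right $\mathcal H$-comodule algebra with coactions $B\otimes_L\gamma_R$, $B\otimes_L\gamma_L$. $\sigma$ is invertible if there is a $k$-linear map $\tilde\sigma:H\otimes_LH\to B$ (so $\tilde\sigma(hs_L(l),k)=\tilde\sigma(h,s_L(l)k)$) with (a) $\tilde\sigma(s_L(l)h,k)=\iota(l)\tilde\sigma(h,k)$, $\tilde\sigma(t_L(l)h,k)=\tilde\sigma(h,k)\iota(l)$; (b) $\tilde\sigma(h_{(1)},k)(h_{(2)}\cdot\iota(l))=\tilde\sigma(h,t_L(l)k)$; (c) $\sigma(h_{(1)},k_{(1)})\tilde\sigma(h_{(2)},k_{(2)})=h\cdot(k\cdot1_B)$ and $\tilde\sigma(h_{(1)},k_{(1)})\sigma(h_{(2)},k_{(2)})=hk\cdot1_B$. *)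

theory Defs
  imports Main
begin

text \<open>
  Algebras are types of sort \<open>{ring, monoid_mult}\<close> (unital associative rings; unlike \<open>ring_1\<close> this
  sort does not exclude the zero ring) together with an explicit scalar multiplication by the
  commutative unital ring \<open>'k\<close>.
\<close>

section \<open>Modules and algebras\<close>

locale left_module =
  fixes act :: "'c::{ring,monoid_mult} \<Rightarrow> 'm::ab_group_add \<Rightarrow> 'm"
  assumes act_add_left: "act (c + d) m = act c m + act d m"
    and act_add_right: "act c (m + n) = act c m + act c n"
    and act_mult: "act (c * d) m = act c (act d m)"
    and act_one: "act 1 m = m"

locale right_module =
  fixes act :: "'m::ab_group_add \<Rightarrow> 'c::{ring,monoid_mult} \<Rightarrow> 'm"
  assumes act_add_left: "act (m + n) c = act m c + act n c"
    and act_add_right: "act m (c + d) = act m c + act m d"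
    and act_mult: "act m (c * d) = act (act m c) d"
    and act_one: "act m 1 = m"

locale k_algebra = left_module scale
  for scale :: "'k::{comm_ring,comm_monoid_mult} \<Rightarrow> 'a::{ring,monoid_mult} \<Rightarrow> 'a" +
  assumes scale_mult_left: "scale c (x * y) = scale c x * y"
    and scale_mult_right: "scale c (x * y) = x * scale c y"

definition k_linear :: "('k \<Rightarrow> 'm::ab_group_add \<Rightarrow> 'm) \<Rightarrow> ('k \<Rightarrow> 'n::ab_group_add \<Rightarrow> 'n) \<Rightarrow> ('m \<Rightarrow> 'n) \<Rightarrow> bool"
  where "k_linear scM scN f \<longleftrightarrow>
    (\<forall>x y. f (x + y) = f x + f y) \<and> (\<forall>c x. f (scM c x) = scN c (f x))"

definition algebra_map ::
    "('k \<Rightarrow> 'a::{ring,monoid_mult} \<Rightarrow> 'a) \<Rightarrow> ('k \<Rightarrow> 'b::{ring,monoid_mult} \<Rightarrow> 'b) \<Rightarrow> ('a \<Rightarrow> 'b) \<Rightarrow> bool"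
  where "algebra_map scA scB f \<longleftrightarrow>
    k_linear scA scB f \<and> (\<forall>x y. f (x * y) = f x * f y) \<and> f 1 = 1"

definition anti_algebra_map ::
    "('k \<Rightarrow> 'a::{ring,monoid_mult} \<Rightarrow> 'a) \<Rightarrow> ('k \<Rightarrow> 'b::{ring,monoid_mult} \<Rightarrow> 'b) \<Rightarrow> ('a \<Rightarrow> 'b) \<Rightarrow> bool"
  where "anti_algebra_map scA scB f \<longleftrightarrow>
    k_linear scA scB f \<and> (\<forall>x y. f (x * y) = f y * f x) \<and> f 1 = 1"

section \<open>Tensor products over a non-commutative base\<close>

text \<open>
  A formal sum \<open>m\<^sub>1 \<otimes> n\<^sub>1 + \<dots> + m\<^sub>p \<otimes> n\<^sub>p\<close> is the list \<open>[(m\<^sub>1, n\<^sub>1), \<dots>, (m\<^sub>p, n\<^sub>p)]\<close>, and a tensor product is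
  the set of formal sums modulo the least congruence for (commutative) concatenation containing
  the defining relations.  No formal negatives are needed: \<open>(- m) \<otimes> n\<close> is the negative of \<open>m \<otimes> n\<close>,
  because \<open>m \<otimes> n + (- m) \<otimes> n = 0 \<otimes> n = 0\<close>.
  All base rings are \<open>k\<close>-algebras, so tensor products over them are automatically \<open>k\<close>-balanced.
\<close>

inductive_set formal_sum_cong :: "'x set \<Rightarrow> ('x list \<times> 'x list) set \<Rightarrow> ('x list \<times> 'x list) set"
  for X :: "'x set" and E :: "('x list \<times> 'x list) set"
  where
    base: "(xs, ys) \<in> E \<Longrightarrow> xs \<in> lists X \<Longrightarrow> ys \<in> lists X \<Longrightarrow> (xs, ys) \<in> formal_sum_cong X E"
  | refl: "xs \<in> lists X \<Longrightarrow> (xs, xs) \<in> formal_sum_cong X E"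
  | sym: "(xs, ys) \<in> formal_sum_cong X E \<Longrightarrow> (ys, xs) \<in> formal_sum_cong X E"
  | trans: "(xs, ys) \<in> formal_sum_cong X E \<Longrightarrow> (ys, zs) \<in> formal_sum_cong X E \<Longrightarrow>
      (xs, zs) \<in> formal_sum_cong X E"
  | append: "(xs, ys) \<in> formal_sum_cong X E \<Longrightarrow> (us, vs) \<in> formal_sum_cong X E \<Longrightarrow>
      (xs @ us, ys @ vs) \<in> formal_sum_cong X E"
  | comm: "xs \<in> lists X \<Longrightarrow> ys \<in> lists X \<Longrightarrow> (xs @ ys, ys @ xs) \<in> formal_sum_cong X E"

text \<open>
  \<open>M \<otimes>\<^sub>C N\<close> for a right \<open>C\<close>-module with carrier \<open>M\<close> (a subset of a type, as needed for the
  coinvariants \<open>B \<subseteq> A\<close>) and a left \<open>C\<close>-module which is a whole type.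
\<close>

definition tensor_rel ::
    "'m::ab_group_add set \<Rightarrow> ('m \<Rightarrow> 'c \<Rightarrow> 'm) \<Rightarrow> ('c \<Rightarrow> 'n::ab_group_add \<Rightarrow> 'n) \<Rightarrow>
     (('m \<times> 'n) list \<times> ('m \<times> 'n) list) set"
  where "tensor_rel M ract lact = formal_sum_cong (M \<times> UNIV)
    ({([(m + m', n)], [(m, n), (m', n)]) | m m' n. m \<in> M \<and> m' \<in> M} \<union>
     {([(m, n + n')], [(m, n), (m, n')]) | m n n'. m \<in> M} \<union>
     {([(0, n)], []) | n. True} \<union>
     {([(m, 0)], []) | m. m \<in> M} \<union>
     {([(ract m c, n)], [(m, lact c n)]) | m c n. m \<in> M})"

definition tensor ::
    "'m::ab_group_add set \<Rightarrow> ('m \<Rightarrow> 'c \<Rightarrow> 'm) \<Rightarrow> ('c \<Rightarrow> 'n::ab_group_add \<Rightarrow> 'n) \<Rightarrow> ('m \<times> 'n) list set set"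
  where "tensor M ract lact = lists (M \<times> UNIV) // tensor_rel M ract lact"

definition tcls ::
    "'m::ab_group_add set \<Rightarrow> ('m \<Rightarrow> 'c \<Rightarrow> 'm) \<Rightarrow> ('c \<Rightarrow> 'n::ab_group_add \<Rightarrow> 'n) \<Rightarrow>
     ('m \<times> 'n) list \<Rightarrow> ('m \<times> 'n) list set"
  where "tcls M ract lact xs = tensor_rel M ract lact `` {xs}"

text \<open>
  \<open>M \<otimes>\<^sub>C N \<otimes>\<^sub>D P\<close>, the common value of the two iterated tensor products, where \<open>N\<close> is a
  \<open>C\<close>-\<open>D\<close>-bimodule.
\<close>

definition tensor3_rel ::
    "'m::ab_group_add set \<Rightarrow> ('m \<Rightarrow> 'c \<Rightarrow> 'm) \<Rightarrow> ('c \<Rightarrow> 'n::ab_group_add \<Rightarrow> 'n) \<Rightarrow>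
     ('n \<Rightarrow> 'd \<Rightarrow> 'n) \<Rightarrow> ('d \<Rightarrow> 'p::ab_group_add \<Rightarrow> 'p) \<Rightarrow>
     (('m \<times> 'n \<times> 'p) list \<times> ('m \<times> 'n \<times> 'p) list) set"
  where "tensor3_rel M ractC lactC ractD lactD = formal_sum_cong (M \<times> UNIV \<times> UNIV)
    ({([(m + m', n, p)], [(m, n, p), (m', n, p)]) | m m' n p. m \<in> M \<and> m' \<in> M} \<union>
     {([(m, n + n', p)], [(m, n, p), (m, n', p)]) | m n n' p. m \<in> M} \<union>
     {([(m, n, p + p')], [(m, n, p), (m, n, p')]) | m n p p'. m \<in> M} \<union>
     {([(0, n, p)], []) | n p. True} \<union>
     {([(m, 0, p)], []) | m p. m \<in> M} \<union>
     {([(m, n, 0)], []) | m n. m \<in> M} \<union>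
     {([(ractC m c, n, p)], [(m, lactC c n, p)]) | m c n p. m \<in> M} \<union>
     {([(m, ractD n d, p)], [(m, n, lactD d p)]) | m n d p. m \<in> M})"

definition tcls3 ::
    "'m::ab_group_add set \<Rightarrow> ('m \<Rightarrow> 'c \<Rightarrow> 'm) \<Rightarrow> ('c \<Rightarrow> 'n::ab_group_add \<Rightarrow> 'n) \<Rightarrow>
     ('n \<Rightarrow> 'd \<Rightarrow> 'n) \<Rightarrow> ('d \<Rightarrow> 'p::ab_group_add \<Rightarrow> 'p) \<Rightarrow>
     ('m \<times> 'n \<times> 'p) list \<Rightarrow> ('m \<times> 'n \<times> 'p) list set"
  where "tcls3 M ractC lactC ractD lactD xs = tensor3_rel M ractC lactC ractD lactD `` {xs}"

text \<open>
  Sweedler notation: \<open>h\<^sub>(\<^sub>1\<^sub>) \<otimes> h\<^sub>(\<^sub>2\<^sub>)\<close> is read as a representing formal sum \<open>rep (\<Delta> h)\<close> over which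
  one sums.  The expressions below are balanced in the sense that makes the usual notation
  meaningful, so they do not depend on the chosen representative (nor, since the same
  representative is used throughout, on the order of nested sums).
\<close>

definition rep :: "'x list set \<Rightarrow> 'x list"
  where "rep T = (SOME xs. xs \<in> T)"

section \<open>Corings and comodules\<close>

locale coring =
  fixes lact :: "'c::{ring,monoid_mult} \<Rightarrow> 'h::ab_group_add \<Rightarrow> 'h"
    and ract :: "'h \<Rightarrow> 'c \<Rightarrow> 'h"
    and \<Delta> :: "'h \<Rightarrow> ('h \<times> 'h) list set"
    and \<epsilon> :: "'h \<Rightarrow> 'c"
  assumes left: "left_module lact"
    and right: "right_module ract"
    and bimodule: "lact c (ract h d) = ract (lact c h) d"
    and comult_in: "\<Delta> h \<in> tensor UNIV ract lact"
    and comult_add: "\<Delta> (h + h') = tcls UNIV ract lact (rep (\<Delta> h) @ rep (\<Delta> h'))"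
    and comult_bilinear: "\<Delta> (lact c (ract h d)) =
      tcls UNIV ract lact [(lact c x, ract y d). (x, y) \<leftarrow> rep (\<Delta> h)]"
    and counit_add: "\<epsilon> (h + h') = \<epsilon> h + \<epsilon> h'"
    and counit_bilinear: "\<epsilon> (lact c (ract h d)) = c * \<epsilon> h * d"
    and coassoc:
      "tcls3 UNIV ract lact ract lact [(x1, x2, y). (x, y) \<leftarrow> rep (\<Delta> h), (x1, x2) \<leftarrow> rep (\<Delta> x)] =
       tcls3 UNIV ract lact ract lact [(x, y1, y2). (x, y) \<leftarrow> rep (\<Delta> h), (y1, y2) \<leftarrow> rep (\<Delta> y)]"
    and counit_left: "(\<Sum>(x, y)\<leftarrow>rep (\<Delta> h). lact (\<epsilon> x) y) = h"
    and counit_right: "(\<Sum>(x, y)\<leftarrow>rep (\<Delta> h). ract x (\<epsilon> y)) = h"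

locale coring_comodule = coring lact ract \<Delta> \<epsilon>
  for lact :: "'c::{ring,monoid_mult} \<Rightarrow> 'h::ab_group_add \<Rightarrow> 'h"
    and ract :: "'h \<Rightarrow> 'c \<Rightarrow> 'h"
    and \<Delta> :: "'h \<Rightarrow> ('h \<times> 'h) list set"
    and \<epsilon> :: "'h \<Rightarrow> 'c" +
  fixes mact :: "'m::ab_group_add \<Rightarrow> 'c \<Rightarrow> 'm"
    and \<rho> :: "'m \<Rightarrow> ('m \<times> 'h) list set"
  assumes module: "right_module mact"
    and coact_in: "\<rho> m \<in> tensor UNIV mact lact"
    and coact_add: "\<rho> (m + m') = tcls UNIV mact lact (rep (\<rho> m) @ rep (\<rho> m'))"
    and coact_linear: "\<rho> (mact m c) = tcls UNIV mact lact [(x, ract y c). (x, y) \<leftarrow> rep (\<rho> m)]"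
    and coact_coassoc:
      "tcls3 UNIV mact lact ract lact [(x1, x2, y). (x, y) \<leftarrow> rep (\<rho> m), (x1, x2) \<leftarrow> rep (\<rho> x)] =
       tcls3 UNIV mact lact ract lact [(x, y1, y2). (x, y) \<leftarrow> rep (\<rho> m), (y1, y2) \<leftarrow> rep (\<Delta> y)]"
    and coact_counit: "(\<Sum>(x, y)\<leftarrow>rep (\<rho> m). mact x (\<epsilon> y)) = m"

section \<open>Bialgebroids and Hopf algebroids\<close>

record ('c, 'h) bialgebroid_data =
  src :: "'c \<Rightarrow> 'h"
  tgt :: "'c \<Rightarrow> 'h"
  comult :: "'h \<Rightarrow> ('h \<times> 'h) list set"
  counit :: "'h \<Rightarrow> 'c"

text \<open>The \<open>L\<close>-bimodule structure \<open>l h l' = s(l) t(l') h\<close> of a left bialgebroid.\<close>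

definition lactL :: "('l, 'h::times) bialgebroid_data \<Rightarrow> 'l \<Rightarrow> 'h \<Rightarrow> 'h"
  where "lactL H l h = src H l * h"

definition ractL :: "('l, 'h::times) bialgebroid_data \<Rightarrow> 'h \<Rightarrow> 'l \<Rightarrow> 'h"
  where "ractL H h l = tgt H l * h"

text \<open>The \<open>R\<close>-bimodule structure \<open>r h r' = h s(r') t(r)\<close> of a right bialgebroid.\<close>

definition lactR :: "('r, 'h::times) bialgebroid_data \<Rightarrow> 'r \<Rightarrow> 'h \<Rightarrow> 'h"
  where "lactR H r h = h * tgt H r"

definition ractR :: "('r, 'h::times) bialgebroid_data \<Rightarrow> 'h \<Rightarrow> 'r \<Rightarrow> 'h"
  where "ractR H h r = h * src H r"

locale left_bialgebroid =
  fixes scH :: "'k::{comm_ring,comm_monoid_mult} \<Rightarrow> 'h::{ring,monoid_mult} \<Rightarrow> 'h"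
    and scL :: "'k \<Rightarrow> 'l::{ring,monoid_mult} \<Rightarrow> 'l"
    and HL :: "('l, 'h) bialgebroid_data"
  assumes algebra_H: "k_algebra scH"
    and algebra_L: "k_algebra scL"
    and src_map: "algebra_map scL scH (src HL)"
    and tgt_map: "anti_algebra_map scL scH (tgt HL)"
    and src_tgt_commute: "src HL l * tgt HL l' = tgt HL l' * src HL l"
    and is_coring: "coring (lactL HL) (ractL HL) (comult HL) (counit HL)"
    and takeuchi:
      "tcls UNIV (ractL HL) (lactL HL) [(x * tgt HL l, y). (x, y) \<leftarrow> rep (comult HL h)] =
       tcls UNIV (ractL HL) (lactL HL) [(x, y * src HL l). (x, y) \<leftarrow> rep (comult HL h)]"
    and comult_one: "comult HL 1 = tcls UNIV (ractL HL) (lactL HL) [(1, 1)]"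
    and comult_mult: "comult HL (h * h') = tcls UNIV (ractL HL) (lactL HL)
      [(x * x', y * y'). (x, y) \<leftarrow> rep (comult HL h), (x', y') \<leftarrow> rep (comult HL h')]"
    and counit_one: "counit HL 1 = 1"
    and counit_mult_src: "counit HL (h * src HL (counit HL h')) = counit HL (h * h')"
    and counit_mult_tgt: "counit HL (h * tgt HL (counit HL h')) = counit HL (h * h')"

locale right_bialgebroid =
  fixes scH :: "'k::{comm_ring,comm_monoid_mult} \<Rightarrow> 'h::{ring,monoid_mult} \<Rightarrow> 'h"
    and scR :: "'k \<Rightarrow> 'r::{ring,monoid_mult} \<Rightarrow> 'r"
    and HR :: "('r, 'h) bialgebroid_data"
  assumes algebra_H: "k_algebra scH"
    and algebra_R: "k_algebra scR"
    and src_map: "algebra_map scR scH (src HR)"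
    and tgt_map: "anti_algebra_map scR scH (tgt HR)"
    and src_tgt_commute: "src HR r * tgt HR r' = tgt HR r' * src HR r"
    and is_coring: "coring (lactR HR) (ractR HR) (comult HR) (counit HR)"
    and takeuchi:
      "tcls UNIV (ractR HR) (lactR HR) [(src HR r * x, y). (x, y) \<leftarrow> rep (comult HR h)] =
       tcls UNIV (ractR HR) (lactR HR) [(x, tgt HR r * y). (x, y) \<leftarrow> rep (comult HR h)]"
    and comult_one: "comult HR 1 = tcls UNIV (ractR HR) (lactR HR) [(1, 1)]"
    and comult_mult: "comult HR (h * h') = tcls UNIV (ractR HR) (lactR HR)
      [(x * x', y * y'). (x, y) \<leftarrow> rep (comult HR h), (x', y') \<leftarrow> rep (comult HR h')]"
    and counit_one: "counit HR 1 = 1"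
    and counit_src_mult: "counit HR (src HR (counit HR h) * h') = counit HR (h * h')"
    and counit_tgt_mult: "counit HR (tgt HR (counit HR h) * h') = counit HR (h * h')"

locale hopf_algebroid =
  fixes scH :: "'k::{comm_ring,comm_monoid_mult} \<Rightarrow> 'h::{ring,monoid_mult} \<Rightarrow> 'h"
    and scL :: "'k \<Rightarrow> 'l::{ring,monoid_mult} \<Rightarrow> 'l"
    and scR :: "'k \<Rightarrow> 'r::{ring,monoid_mult} \<Rightarrow> 'r"
    and HL :: "('l, 'h) bialgebroid_data"
    and HR :: "('r, 'h) bialgebroid_data"
    and S :: "'h \<Rightarrow> 'h"
  assumes left_bialgebroid: "left_bialgebroid scH scL HL"
    and right_bialgebroid: "right_bialgebroid scH scR HR"
    and srcL_counitL_tgtR: "src HL (counit HL (tgt HR r)) = tgt HR r"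
    and tgtL_counitL_srcR: "tgt HL (counit HL (src HR r)) = src HR r"
    and srcR_counitR_tgtL: "src HR (counit HR (tgt HL l)) = tgt HL l"
    and tgtR_counitR_srcL: "tgt HR (counit HR (src HL l)) = src HL l"
    and coassoc_LR:
      "tcls3 UNIV (ractL HL) (lactL HL) (ractR HR) (lactR HR)
         [(x1, x2, y). (x, y) \<leftarrow> rep (comult HR h), (x1, x2) \<leftarrow> rep (comult HL x)] =
       tcls3 UNIV (ractL HL) (lactL HL) (ractR HR) (lactR HR)
         [(x, y1, y2). (x, y) \<leftarrow> rep (comult HL h), (y1, y2) \<leftarrow> rep (comult HR y)]"
    and coassoc_RL:
      "tcls3 UNIV (ractR HR) (lactR HR) (ractL HL) (lactL HL)
         [(x1, x2, y). (x, y) \<leftarrow> rep (comult HL h), (x1, x2) \<leftarrow> rep (comult HR x)] =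
       tcls3 UNIV (ractR HR) (lactR HR) (ractL HL) (lactL HL)
         [(x, y1, y2). (x, y) \<leftarrow> rep (comult HR h), (y1, y2) \<leftarrow> rep (comult HL y)]"
    and antipode_linear: "k_linear scH scH S"
    and antipode_tgtL_tgtR: "S (tgt HL l * h * tgt HR r) = src HR r * S h * src HL l"
    and antipode_tgtR_tgtL: "S (tgt HR r * h * tgt HL l) = src HL l * S h * src HR r"
    and antipode_left: "(\<Sum>(x, y)\<leftarrow>rep (comult HL h). S x * y) = src HR (counit HR h)"
    and antipode_right: "(\<Sum>(x, y)\<leftarrow>rep (comult HR h). x * S y) = src HL (counit HL h)"

section \<open>Comodules and comodule algebras of a Hopf algebroid\<close>

locale hopf_comodule =
  fixes HL :: "('l::{ring,monoid_mult}, 'h::{ring,monoid_mult}) bialgebroid_data"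
    and HR :: "('r::{ring,monoid_mult}, 'h) bialgebroid_data"
    and mR :: "'m::ab_group_add \<Rightarrow> 'r \<Rightarrow> 'm"
    and mL :: "'m \<Rightarrow> 'l \<Rightarrow> 'm"
    and \<rho>R :: "'m \<Rightarrow> ('m \<times> 'h) list set"
    and \<rho>L :: "'m \<Rightarrow> ('m \<times> 'h) list set"
  assumes comodule_R: "coring_comodule (lactR HR) (ractR HR) (comult HR) (counit HR) mR \<rho>R"
    and comodule_L: "coring_comodule (lactL HL) (ractL HL) (comult HL) (counit HL) mL \<rho>L"
    and coactR_L_linear: "\<rho>R (mL m l) =
      tcls UNIV mR (lactR HR) [(x, ractL HL y l). (x, y) \<leftarrow> rep (\<rho>R m)]"
    and coactL_R_linear: "\<rho>L (mR m r) =
      tcls UNIV mL (lactL HL) [(x, ractR HR y r). (x, y) \<leftarrow> rep (\<rho>L m)]"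
    and compatible_RL:
      "tcls3 UNIV mR (lactR HR) (ractL HL) (lactL HL)
         [(x, y1, y2). (x, y) \<leftarrow> rep (\<rho>R m), (y1, y2) \<leftarrow> rep (comult HL y)] =
       tcls3 UNIV mR (lactR HR) (ractL HL) (lactL HL)
         [(x1, x2, y). (x, y) \<leftarrow> rep (\<rho>L m), (x1, x2) \<leftarrow> rep (\<rho>R x)]"
    and compatible_LR:
      "tcls3 UNIV mL (lactL HL) (ractR HR) (lactR HR)
         [(x, y1, y2). (x, y) \<leftarrow> rep (\<rho>L m), (y1, y2) \<leftarrow> rep (comult HR y)] =
       tcls3 UNIV mL (lactL HL) (ractR HR) (lactR HR)
         [(x1, x2, y). (x, y) \<leftarrow> rep (\<rho>R m), (x1, x2) \<leftarrow> rep (\<rho>L x)]"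

text \<open>The right \<open>R\<close>- and \<open>L\<close>-actions on a comodule algebra with unit map \<open>\<eta>R\<close>.\<close>

definition algR :: "('r \<Rightarrow> 'a::times) \<Rightarrow> 'a \<Rightarrow> 'r \<Rightarrow> 'a"
  where "algR \<eta>R a r = a * \<eta>R r"

definition algL ::
    "('l, 'h) bialgebroid_data \<Rightarrow> ('r, 'h) bialgebroid_data \<Rightarrow> ('r \<Rightarrow> 'a::times) \<Rightarrow> 'a \<Rightarrow> 'l \<Rightarrow> 'a"
  where "algL HL HR \<eta>R a l = \<eta>R (counit HR (tgt HL l)) * a"

locale hopf_comodule_algebra = hopf_algebroid scH scL scR HL HR S
  for scH :: "'k::{comm_ring,comm_monoid_mult} \<Rightarrow> 'h::{ring,monoid_mult} \<Rightarrow> 'h"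
    and scL :: "'k \<Rightarrow> 'l::{ring,monoid_mult} \<Rightarrow> 'l"
    and scR :: "'k \<Rightarrow> 'r::{ring,monoid_mult} \<Rightarrow> 'r"
    and HL :: "('l, 'h) bialgebroid_data"
    and HR :: "('r, 'h) bialgebroid_data"
    and S :: "'h \<Rightarrow> 'h" +
  fixes scA :: "'k \<Rightarrow> 'a::{ring,monoid_mult} \<Rightarrow> 'a"
    and \<eta>R :: "'r \<Rightarrow> 'a"
    and \<rho>R :: "'a \<Rightarrow> ('a \<times> 'h) list set"
    and \<rho>L :: "'a \<Rightarrow> ('a \<times> 'h) list set"
  assumes algebra_A: "k_algebra scA"
    and unit_map_R: "algebra_map scR scA \<eta>R"
    and comodule: "hopf_comodule HL HR (algR \<eta>R) (algL HL HR \<eta>R) \<rho>R \<rho>L"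
    and left_action_R: "\<eta>R r * a = (\<Sum>(x, y)\<leftarrow>rep (\<rho>R a). algR \<eta>R x (counit HR (src HR r * y)))"
    and coactR_one: "\<rho>R 1 = tcls UNIV (algR \<eta>R) (lactR HR) [(1, 1)]"
    and coactR_mult: "\<rho>R (a * a') = tcls UNIV (algR \<eta>R) (lactR HR)
      [(x * x', y * y'). (x, y) \<leftarrow> rep (\<rho>R a), (x', y') \<leftarrow> rep (\<rho>R a')]"
    and coactL_one: "\<rho>L 1 = tcls UNIV (algL HL HR \<eta>R) (lactL HL) [(1, 1)]"
    and coactL_mult: "\<rho>L (a * a') = tcls UNIV (algL HL HR \<eta>R) (lactL HL)
      [(x * x', y * y'). (x, y) \<leftarrow> rep (\<rho>L a), (x', y') \<leftarrow> rep (\<rho>L a')]"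

definition coinvariants ::
    "('r, 'h::{ring,monoid_mult}) bialgebroid_data \<Rightarrow> ('r \<Rightarrow> 'a::{ring,monoid_mult}) \<Rightarrow>
     ('a \<Rightarrow> ('a \<times> 'h) list set) \<Rightarrow> 'a set"
  where "coinvariants HR \<eta>R \<rho>R = {b. \<rho>R b = tcls UNIV (algR \<eta>R) (lactR HR) [(b, 1)]}"

section \<open>Cleft extensions\<close>

text \<open>
  \<open>j\<close> is a morphism of right comodules \<open>H \<rightarrow> A\<close>; as for comodules of any coring, morphisms are
  module maps, so that \<open>j \<otimes> H\<close> is defined.
\<close>

locale cleaving_map =
  fixes scH :: "'k::{comm_ring,comm_monoid_mult} \<Rightarrow> 'h::{ring,monoid_mult} \<Rightarrow> 'h"
    and HL :: "('l::{ring,monoid_mult}, 'h) bialgebroid_data"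
    and HR :: "('r::{ring,monoid_mult}, 'h) bialgebroid_data"
    and scA :: "'k \<Rightarrow> 'a::{ring,monoid_mult} \<Rightarrow> 'a"
    and \<eta>R :: "'r \<Rightarrow> 'a"
    and \<rho>R :: "'a \<Rightarrow> ('a \<times> 'h) list set"
    and \<rho>L :: "'a \<Rightarrow> ('a \<times> 'h) list set"
    and \<eta>L :: "'l \<Rightarrow> 'a"
    and j :: "'h \<Rightarrow> 'a"
  assumes j_linear: "k_linear scH scA j"
    and j_left_L_linear: "j (src HL l * h) = \<eta>L l * j h"
    and j_right_R_linear: "j (ractR HR h r) = algR \<eta>R (j h) r"
    and j_right_L_linear: "j (ractL HL h l) = algL HL HR \<eta>R (j h) l"
    and j_colinear_R: "\<rho>R (j h) =
      tcls UNIV (algR \<eta>R) (lactR HR) [(j x, y). (x, y) \<leftarrow> rep (comult HR h)]"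
    and j_colinear_L: "\<rho>L (j h) =
      tcls UNIV (algL HL HR \<eta>R) (lactL HL) [(j x, y). (x, y) \<leftarrow> rep (comult HL h)]"
    and convolution_invertible:
      "\<exists>jc. k_linear scH scA jc \<and>
        (\<forall>l h r. jc (tgt HL l * h * tgt HR r) = \<eta>R r * jc h * \<eta>L l) \<and>
        (\<forall>h. (\<Sum>(x, y)\<leftarrow>rep (comult HR h). j x * jc y) = \<eta>L (counit HL h)) \<and>
        (\<forall>h. (\<Sum>(x, y)\<leftarrow>rep (comult HL h). jc x * j y) = \<eta>R (counit HR h))"

text \<open>
  \<open>\<eta>L\<close> is the \<open>L\<close>-ring structure that is part of the data of a cleft extension; it is also the
  unit map \<open>L \<rightarrow> B\<close> used for crossed products.
\<close>

locale cleft_extension = hopf_comodule_algebra scH scL scR HL HR S scA \<eta>R \<rho>R \<rho>L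
  for scH :: "'k::{comm_ring,comm_monoid_mult} \<Rightarrow> 'h::{ring,monoid_mult} \<Rightarrow> 'h"
    and scL :: "'k \<Rightarrow> 'l::{ring,monoid_mult} \<Rightarrow> 'l"
    and scR :: "'k \<Rightarrow> 'r::{ring,monoid_mult} \<Rightarrow> 'r"
    and HL :: "('l, 'h) bialgebroid_data"
    and HR :: "('r, 'h) bialgebroid_data"
    and S :: "'h \<Rightarrow> 'h"
    and scA :: "'k \<Rightarrow> 'a::{ring,monoid_mult} \<Rightarrow> 'a"
    and \<eta>R :: "'r \<Rightarrow> 'a"
    and \<rho>R :: "'a \<Rightarrow> ('a \<times> 'h) list set"
    and \<rho>L :: "'a \<Rightarrow> ('a \<times> 'h) list set" +
  fixes B :: "'a set"
    and \<eta>L :: "'l \<Rightarrow> 'a"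
  assumes B_coinvariants: "B = coinvariants HR \<eta>R \<rho>R"
    and unit_map_L: "algebra_map scL scA \<eta>L"
    and unit_map_L_in: "range \<eta>L \<subseteq> B"
    and cleft: "\<exists>j. cleaving_map scH HL HR scA \<eta>R \<rho>R \<rho>L \<eta>L j"

section \<open>Crossed products\<close>

text \<open>
  In this section \<open>B\<close> is a \<open>k\<close>-subalgebra of \<open>A\<close> containing the image of \<open>\<iota>\<close>.  Linear maps
  out of tensor products are curried balanced \<open>k\<close>-bilinear maps; the values of \<open>act\<close> are only
  relevant on \<open>H \<times> B\<close>.
\<close>

definition k_bilinear ::
    "('k \<Rightarrow> 'm::ab_group_add \<Rightarrow> 'm) \<Rightarrow> ('k \<Rightarrow> 'n::ab_group_add \<Rightarrow> 'n) \<Rightarrow> ('k \<Rightarrow> 'p::ab_group_add \<Rightarrow> 'p) \<Rightarrow>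
     'n set \<Rightarrow> 'p set \<Rightarrow> ('m \<Rightarrow> 'n \<Rightarrow> 'p) \<Rightarrow> bool"
  where "k_bilinear scM scN scP N P f \<longleftrightarrow>
    (\<forall>m. \<forall>n\<in>N. f m n \<in> P) \<and>
    (\<forall>m m'. \<forall>n\<in>N. f (m + m') n = f m n + f m' n) \<and>
    (\<forall>m. \<forall>n\<in>N. \<forall>n'\<in>N. f m (n + n') = f m n + f m n') \<and>
    (\<forall>c m. \<forall>n\<in>N. f (scM c m) n = scP c (f m n) \<and> f m (scN c n) = scP c (f m n))"

locale measuring =
  fixes scH :: "'k \<Rightarrow> 'h::{ring,monoid_mult} \<Rightarrow> 'h"
    and scA :: "'k \<Rightarrow> 'a::{ring,monoid_mult} \<Rightarrow> 'a"
    and HL :: "('l, 'h) bialgebroid_data"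
    and B :: "'a set"
    and \<iota> :: "'l \<Rightarrow> 'a"
    and act :: "'h \<Rightarrow> 'a \<Rightarrow> 'a"
  assumes act_bilinear: "k_bilinear scH scA scA B B act"
    and act_one: "act h 1 = \<iota> (counit HL h)"
    and act_tgt: "b \<in> B \<Longrightarrow> act (tgt HL l * h) b = act h b * \<iota> l"
    and act_src: "b \<in> B \<Longrightarrow> act (src HL l * h) b = \<iota> l * act h b"
    and act_mult: "b \<in> B \<Longrightarrow> b' \<in> B \<Longrightarrow>
      act h (b * b') = (\<Sum>(h1, h2)\<leftarrow>rep (comult HL h). act h1 b * act h2 b')"

locale two_cocycle =
  fixes scH :: "'k \<Rightarrow> 'h::{ring,monoid_mult} \<Rightarrow> 'h"
    and scA :: "'k \<Rightarrow> 'a::{ring,monoid_mult} \<Rightarrow> 'a"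
    and HL :: "('l, 'h) bialgebroid_data"
    and B :: "'a set"
    and \<iota> :: "'l \<Rightarrow> 'a"
    and act :: "'h \<Rightarrow> 'a \<Rightarrow> 'a"
    and \<sigma> :: "'h \<Rightarrow> 'h \<Rightarrow> 'a"
  assumes bilinear: "k_bilinear scH scH scA UNIV B \<sigma>"
    and balanced: "\<sigma> (h * tgt HL l) k = \<sigma> h (tgt HL l * k)"
    and src_left: "\<sigma> (src HL l * h) k = \<iota> l * \<sigma> h k"
    and tgt_left: "\<sigma> (tgt HL l * h) k = \<sigma> h k * \<iota> l"
    and src_right: "(\<Sum>(h1, h2)\<leftarrow>rep (comult HL h). act h1 (\<iota> l) * \<sigma> h2 k) = \<sigma> h (src HL l * k)"
    and normal_left: "\<sigma> 1 h = \<iota> (counit HL h)"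
    and normal_right: "\<sigma> h 1 = \<iota> (counit HL h)"
    and cocycle:
      "(\<Sum>(h1, h2)\<leftarrow>rep (comult HL h). \<Sum>(k1, k2)\<leftarrow>rep (comult HL k). \<Sum>(m1, m2)\<leftarrow>rep (comult HL m).
          act h1 (\<sigma> k1 m1) * \<sigma> h2 (k2 * m2)) =
       (\<Sum>(h1, h2)\<leftarrow>rep (comult HL h). \<Sum>(k1, k2)\<leftarrow>rep (comult HL k).
          \<sigma> h1 k1 * \<sigma> (h2 * k2) m)"

locale twisted_module = measuring scH scA HL B \<iota> act + two_cocycle scH scA HL B \<iota> act \<sigma>
  for scH :: "'k \<Rightarrow> 'h::{ring,monoid_mult} \<Rightarrow> 'h"
    and scA :: "'k \<Rightarrow> 'a::{ring,monoid_mult} \<Rightarrow> 'a"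
    and HL :: "('l, 'h) bialgebroid_data"
    and B :: "'a set"
    and \<iota> :: "'l \<Rightarrow> 'a"
    and act :: "'h \<Rightarrow> 'a \<Rightarrow> 'a"
    and \<sigma> :: "'h \<Rightarrow> 'h \<Rightarrow> 'a" +
  assumes unital: "b \<in> B \<Longrightarrow> act 1 b = b"
    and twisted: "b \<in> B \<Longrightarrow>
      (\<Sum>(h1, h2)\<leftarrow>rep (comult HL h). \<Sum>(k1, k2)\<leftarrow>rep (comult HL k). act h1 (act k1 b) * \<sigma> h2 k2) =
      (\<Sum>(h1, h2)\<leftarrow>rep (comult HL h). \<Sum>(k1, k2)\<leftarrow>rep (comult HL k). \<sigma> h1 k1 * act (h2 * k2) b)"

locale cocycle_inverse =
  fixes scH :: "'k \<Rightarrow> 'h::{ring,monoid_mult} \<Rightarrow> 'h"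
    and scA :: "'k \<Rightarrow> 'a::{ring,monoid_mult} \<Rightarrow> 'a"
    and HL :: "('l, 'h) bialgebroid_data"
    and B :: "'a set"
    and \<iota> :: "'l \<Rightarrow> 'a"
    and act :: "'h \<Rightarrow> 'a \<Rightarrow> 'a"
    and \<sigma> :: "'h \<Rightarrow> 'h \<Rightarrow> 'a"
    and \<tau> :: "'h \<Rightarrow> 'h \<Rightarrow> 'a"
  assumes bilinear: "k_bilinear scH scH scA UNIV B \<tau>"
    and balanced: "\<tau> (h * src HL l) k = \<tau> h (src HL l * k)"
    and src_left: "\<tau> (src HL l * h) k = \<iota> l * \<tau> h k"
    and tgt_left: "\<tau> (tgt HL l * h) k = \<tau> h k * \<iota> l"
    and tgt_right: "(\<Sum>(h1, h2)\<leftarrow>rep (comult HL h). \<tau> h1 k * act h2 (\<iota> l)) = \<tau> h (tgt HL l * k)"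
    and right_inverse:
      "(\<Sum>(h1, h2)\<leftarrow>rep (comult HL h). \<Sum>(k1, k2)\<leftarrow>rep (comult HL k). \<sigma> h1 k1 * \<tau> h2 k2) =
       act h (act k 1)"
    and left_inverse:
      "(\<Sum>(h1, h2)\<leftarrow>rep (comult HL h). \<Sum>(k1, k2)\<leftarrow>rep (comult HL k). \<tau> h1 k1 * \<sigma> h2 k2) =
       act (h * k) 1"

definition cocycle_invertible ::
    "('k \<Rightarrow> 'h::{ring,monoid_mult} \<Rightarrow> 'h) \<Rightarrow> ('k \<Rightarrow> 'a::{ring,monoid_mult} \<Rightarrow> 'a) \<Rightarrow>
     ('l, 'h) bialgebroid_data \<Rightarrow> 'a set \<Rightarrow> ('l \<Rightarrow> 'a) \<Rightarrow> ('h \<Rightarrow> 'a \<Rightarrow> 'a) \<Rightarrow> ('h \<Rightarrow> 'h \<Rightarrow> 'a) \<Rightarrow> bool"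
  where "cocycle_invertible scH scA HL B \<iota> act \<sigma> \<longleftrightarrow> (\<exists>\<tau>. cocycle_inverse scH scA HL B \<iota> act \<sigma> \<tau>)"

text \<open>
  The underlying module \<open>B \<otimes>\<^sub>L H\<close> of the crossed product, formed with the right \<open>L\<close>-action
  \<open>b l = b \<iota>(l)\<close> and the left \<open>L\<close>-action \<open>l h = s(l) h\<close>; \<open>csum B \<iota> HL [(b, h), \<dots>]\<close> is \<open>b # h + \<dots>\<close>.
\<close>

definition crossed_carrier ::
    "'a::{ring,monoid_mult} set \<Rightarrow> ('l \<Rightarrow> 'a) \<Rightarrow> ('l, 'h::{ring,monoid_mult}) bialgebroid_data \<Rightarrow>
     ('a \<times> 'h) list set set"
  where "crossed_carrier B \<iota> HL = tensor B (\<lambda>b l. b * \<iota> l) (lactL HL)"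

definition csum ::
    "'a::{ring,monoid_mult} set \<Rightarrow> ('l \<Rightarrow> 'a) \<Rightarrow> ('l, 'h::{ring,monoid_mult}) bialgebroid_data \<Rightarrow>
     ('a \<times> 'h) list \<Rightarrow> ('a \<times> 'h) list set"
  where "csum B \<iota> HL = tcls B (\<lambda>b l. b * \<iota> l) (lactL HL)"

definition crossed_mult ::
    "'a::{ring,monoid_mult} set \<Rightarrow> ('l \<Rightarrow> 'a) \<Rightarrow> ('l, 'h::{ring,monoid_mult}) bialgebroid_data \<Rightarrow>
     ('h \<Rightarrow> 'a \<Rightarrow> 'a) \<Rightarrow> ('h \<Rightarrow> 'h \<Rightarrow> 'a) \<Rightarrow>
     ('a \<times> 'h) list set \<Rightarrow> ('a \<times> 'h) list set \<Rightarrow> ('a \<times> 'h) list set"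
  where "crossed_mult B \<iota> HL act \<sigma> X Y = csum B \<iota> HL
    [(b * act h1 b' * \<sigma> h2 h1', h3 * h2').
       (b, h) \<leftarrow> rep X, (b', h') \<leftarrow> rep Y,
       (h1, h23) \<leftarrow> rep (comult HL h), (h2, h3) \<leftarrow> rep (comult HL h23),
       (h1', h2') \<leftarrow> rep (comult HL h')]"

text \<open>
  Isomorphisms \<open>A \<rightarrow> B #\<^sub>\<sigma> H\<close> of left \<open>B\<close>-modules and right comodule algebras, the \<open>R\<close>-ring
  structure of the target being \<open>r \<mapsto> 1 # s\<^sub>R(r)\<close> and its coactions \<open>B \<otimes>\<^sub>L \<gamma>\<^sub>R\<close> and
  \<open>B \<otimes>\<^sub>L \<gamma>\<^sub>L\<close>.  Colinearity is an identity in \<open>B \<otimes>\<^sub>L H \<otimes>\<^sub>R H\<close> resp. \<open>B \<otimes>\<^sub>L H \<otimes>\<^sub>L H\<close>.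
\<close>

locale crossed_product_iso =
  fixes HL :: "('l, 'h::{ring,monoid_mult}) bialgebroid_data"
    and HR :: "('r, 'h) bialgebroid_data"
    and scA :: "'k \<Rightarrow> 'a::{ring,monoid_mult} \<Rightarrow> 'a"
    and \<eta>R :: "'r \<Rightarrow> 'a"
    and \<rho>R :: "'a \<Rightarrow> ('a \<times> 'h) list set"
    and \<rho>L :: "'a \<Rightarrow> ('a \<times> 'h) list set"
    and B :: "'a set"
    and \<iota> :: "'l \<Rightarrow> 'a"
    and act :: "'h \<Rightarrow> 'a \<Rightarrow> 'a"
    and \<sigma> :: "'h \<Rightarrow> 'h \<Rightarrow> 'a"
    and \<phi> :: "'a \<Rightarrow> ('a \<times> 'h) list set"
  assumes bijective: "bij_betw \<phi> UNIV (crossed_carrier B \<iota> HL)"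
    and additive: "\<phi> (a + a') = csum B \<iota> HL (rep (\<phi> a) @ rep (\<phi> a'))"
    and scalar: "\<phi> (scA c a) = csum B \<iota> HL [(scA c b, h). (b, h) \<leftarrow> rep (\<phi> a)]"
    and multiplicative: "\<phi> (a * a') = crossed_mult B \<iota> HL act \<sigma> (\<phi> a) (\<phi> a')"
    and unital: "\<phi> 1 = csum B \<iota> HL [(1, 1)]"
    and R_ring_map: "\<phi> (\<eta>R r) = csum B \<iota> HL [(1, src HR r)]"
    and left_B_linear: "b \<in> B \<Longrightarrow> \<phi> (b * a) = csum B \<iota> HL [(b * b', h). (b', h) \<leftarrow> rep (\<phi> a)]"
    and right_R_linear: "\<phi> (algR \<eta>R a r) = csum B \<iota> HL [(b, ractR HR h r). (b, h) \<leftarrow> rep (\<phi> a)]"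
    and right_L_linear: "\<phi> (algL HL HR \<eta>R a l) = csum B \<iota> HL [(b, ractL HL h l). (b, h) \<leftarrow> rep (\<phi> a)]"
    and colinear_R:
      "tcls3 B (\<lambda>b l. b * \<iota> l) (lactL HL) (ractR HR) (lactR HR)
         [(b, x, y). (a', y) \<leftarrow> rep (\<rho>R a), (b, x) \<leftarrow> rep (\<phi> a')] =
       tcls3 B (\<lambda>b l. b * \<iota> l) (lactL HL) (ractR HR) (lactR HR)
         [(b, x, y). (b, h) \<leftarrow> rep (\<phi> a), (x, y) \<leftarrow> rep (comult HR h)]"
    and colinear_L:
      "tcls3 B (\<lambda>b l. b * \<iota> l) (lactL HL) (ractL HL) (lactL HL)
         [(b, x, y). (a', y) \<leftarrow> rep (\<rho>L a), (b, x) \<leftarrow> rep (\<phi> a')] =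
       tcls3 B (\<lambda>b l. b * \<iota> l) (lactL HL) (ractL HL) (lactL HL)
         [(b, x, y). (b, h) \<leftarrow> rep (\<phi> a), (x, y) \<leftarrow> rep (comult HL h)]"

end

theory Submission
  imports Defs Complex_Main "HOL-Library.Function_Algebras" "HOL-Library.Multiset"
begin

text \<open>
  After replacing \<open>j\<close> by \<open>j(-) j\<^sup>c(1)\<close> one may assume \<open>j(1) = 1\<close>.  The map \<open>E(a) = a\<^bsup>[0]\<^esup> j\<^sup>c(a\<^bsup>[1]\<^esup>)\<close> is a
  left \<open>B\<close>-linear projection of \<open>A\<close> onto \<open>B\<close>, and \<open>a = E(a\<^bsub>[0]\<^esub>) j(a\<^bsub>[1]\<^esub>)\<close>, so that \<open>a \<mapsto> E(a\<^bsub>[0]\<^esub>) # a\<^bsub>[1]\<^esub>\<close> and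
  \<open>b # h \<mapsto> b j(h)\<close> are inverse bijections between \<open>A\<close> and \<open>B \<otimes>\<^sub>L H\<close>.  With \<open>h \<cdot> b = E(j(h) b)\<close> and
  \<open>\<sigma>(h, k) = E(j(h) j(k))\<close>, the measuring, cocycle and twisted module axioms are read off by
  decomposing products of three factors in the two possible ways, and the inverse of \<open>\<sigma>\<close> is
  \<open>j(h\<^sup>(\<^sup>1\<^sup>) k\<^sup>(\<^sup>1\<^sup>)) j\<^sup>c(k\<^sup>(\<^sup>2\<^sup>)) j\<^sup>c(h\<^sup>(\<^sup>2\<^sup>))\<close>.

  Identities in tensor products are proved by evaluating balanced maps with values in \<open>\<rat>/\<int>\<close>, which
  separate the elements of a tensor product.
\<close>

section \<open>Formal sums and their characters\<close>

\<comment> \<open>A tensor product is a bare set of classes of lists and \<open>rep\<close> picks an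
  arbitrary list from a class, so a Sweedler sum has a meaning only if its summand is balanced. This
  is why regroupings come with balancedness checks, and why equalities of classes are tested by maps
  into \<rat>/\<int> instead of being derived by rewriting lists. Some summands become balanced only
  after an inner sum is carried out; the Takeuchi properties, assumed for H and derived for A,
  supply this. A second obstacle is that both coactions occur at once: B and \<open>E\<close> are
  defined by \<open>\<rho>R\<close>, while the decomposition of A uses \<open>\<rho>L\<close>. The
  antipode is the bridge, as it makes the elements of B coinvariant for \<open>\<rho>L\<close> too.
  The remaining input is \<open>CR_jc\<close>, which controls the coaction of \<open>jc\<close>: it
  puts \<open>E a\<close> into B and later makes the inverse cocycle computable.\<close>
quotient_type rat_mod_int = rat / "\<lambda>a b. a - b \<in> \<int>"
proof (rule equivpI)
  show "reflp (\<lambda>a b :: rat. a - b \<in> \<int>)"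
    by (simp add: reflp_def)
  show "symp (\<lambda>a b :: rat. a - b \<in> \<int>)"
    by (rule sympI) (metis Ints_minus minus_diff_eq)
  show "transp (\<lambda>a b :: rat. a - b \<in> \<int>)"
  proof (rule transpI)
    fix a b c :: rat
    assume "a - b \<in> \<int>" "b - c \<in> \<int>"
    then have "(a - b) + (b - c) \<in> \<int>" by (rule Ints_add)
    then show "a - c \<in> \<int>" by simp
  qed
qed

instantiation rat_mod_int :: ab_group_add
begin

lift_definition zero_rat_mod_int :: rat_mod_int is 0 .

lift_definition plus_rat_mod_int :: "rat_mod_int \<Rightarrow> rat_mod_int \<Rightarrow> rat_mod_int" is "(+)"
  by (metis Ints_add add_diff_add)

lift_definition uminus_rat_mod_int :: "rat_mod_int \<Rightarrow> rat_mod_int" is uminus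
  by (metis Ints_minus minus_diff_minus)

definition minus_rat_mod_int :: "rat_mod_int \<Rightarrow> rat_mod_int \<Rightarrow> rat_mod_int"
  where "minus_rat_mod_int a b = a + - b"

instance
  by standard (transfer; simp add: algebra_simps; fail | simp add: minus_rat_mod_int_def)+

end

text \<open>
  The graph of a partial homomorphism to \<open>\<rat>/\<int>\<close>, as a subgroup of pairs with \<open>\<int>\<close> added in the
  second component.
\<close>

definition partial_character :: "('g::ring_1 \<times> rat) set \<Rightarrow> bool"
  where "partial_character \<Gamma> \<longleftrightarrow> (0, 1) \<in> \<Gamma> \<and>
    (\<forall>g p g' p'. (g, p) \<in> \<Gamma> \<longrightarrow> (g', p') \<in> \<Gamma> \<longrightarrow> (g - g', p - p') \<in> \<Gamma>) \<and>
    (\<forall>p. (0, p) \<in> \<Gamma> \<longrightarrow> p \<in> \<int>)"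

context
  fixes \<Gamma> :: "('g::ring_1 \<times> rat) set"
  assumes pc: "partial_character \<Gamma>"
begin

lemma partial_character_diff: "(g, p) \<in> \<Gamma> \<Longrightarrow> (g', p') \<in> \<Gamma> \<Longrightarrow> (g - g', p - p') \<in> \<Gamma>"
  using pc unfolding partial_character_def by blast

lemma partial_character_zero: "(0, 0) \<in> \<Gamma>"
  using partial_character_diff[of 0 1 0 1] pc unfolding partial_character_def by simp

lemma partial_character_minus: "(g, p) \<in> \<Gamma> \<Longrightarrow> (- g, - p) \<in> \<Gamma>"
  using partial_character_diff[OF partial_character_zero] by fastforce

lemma partial_character_add: "(g, p) \<in> \<Gamma> \<Longrightarrow> (g', p') \<in> \<Gamma> \<Longrightarrow> (g + g', p + p') \<in> \<Gamma>"
  using partial_character_diff[of g p "- g'" "- p'"] partial_character_minus by simp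

lemma partial_character_Ints: "(g, p) \<in> \<Gamma> \<Longrightarrow> (g, q) \<in> \<Gamma> \<Longrightarrow> p - q \<in> \<int>"
  using partial_character_diff[of g p g q] pc unfolding partial_character_def by simp

text \<open>Integer multiples are written \<open>of_int m * g\<close>, which is why the ambient
  group is taken of sort \<open>ring_1\<close>.\<close>

lemma partial_character_scale: "(g, p) \<in> \<Gamma> \<Longrightarrow> (of_int m * g, of_int m * p) \<in> \<Gamma>"
proof (induction m rule: int_induct[where k = 0])
  case base
  then show ?case using partial_character_zero by simp
next
  case (step1 i)
  then show ?case
    using partial_character_add[of "of_int i * g" "of_int i * p" g p] by (simp add: algebra_simps)
next
  case (step2 i)
  then show ?case
    using partial_character_diff[of "of_int i * g" "of_int i * p" g p] by (simp add: algebra_simps)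
qed

text \<open>The multiples of x in the domain of \<open>\<Gamma>\<close> decide which values q are
  admissible. If only the zero multiple lies there, every q is. Otherwise let n be the least
  positive multiplier and p0 a value at n x: the admissible q satisfy n q = p0 modulo \<int>. As x
  itself is outside the domain, n is at least 2, which leaves room for a non-integral q.\<close>

lemma partial_character_extend:
  assumes x: "x \<notin> fst ` \<Gamma>"
  obtains \<Gamma>' q where "partial_character \<Gamma>'" "\<Gamma> \<subseteq> \<Gamma>'" "(x, q) \<in> \<Gamma>'" "q \<notin> \<int>"
proof -
  have "\<exists>q::rat. q \<notin> \<int> \<and> (\<forall>m p. (of_int m * x, p) \<in> \<Gamma> \<longrightarrow> p - of_int m * q \<in> \<int>)"
  proof (cases "\<exists>n::nat. n > 0 \<and> of_int (int n) * x \<in> fst ` \<Gamma>")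
    case False
    then have none: "of_int (int n) * x \<in> fst ` \<Gamma> \<Longrightarrow> n = 0" for n by auto
    have "p - of_int m * (1 / 2) \<in> \<int>" if "(of_int m * x, p) \<in> \<Gamma>" for m p
    proof -
      have "(of_int (int (nat \<bar>m\<bar>)) * x) \<in> fst ` \<Gamma>"
        using imageI[OF that, of fst] imageI[OF partial_character_minus[OF that], of fst]
        by (cases "m < 0") simp_all
      then have "m = 0" using none by fastforce
      then show ?thesis using partial_character_Ints[OF that, of 0] partial_character_zero by simp
    qed
    moreover have "(1 / 2 :: rat) \<notin> \<int>"
      using fraction_not_in_Ints[of 2 1] by simp
    ultimately show ?thesis by blast
  next
    case True
    define n where "n = (LEAST n::nat. n > 0 \<and> of_int (int n) * x \<in> fst ` \<Gamma>)"
    have n: "n > 0" "of_int (int n) * x \<in> fst ` \<Gamma>"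
      using LeastI_ex[OF True] unfolding n_def by auto
    have least: "\<not> (r > 0 \<and> of_int (int r) * x \<in> fst ` \<Gamma>)" if "r < n" for r
      using that not_less_Least unfolding n_def by blast
    obtain p0 where p0: "(of_int (int n) * x, p0) \<in> \<Gamma>" using n(2) by force
    have "n \<noteq> 1"
    proof
      assume "n = 1"
      then show False using n(2) x by simp
    qed
    then have n2: "n \<ge> 2" using n(1) by simp
    \<comment> \<open>The admissible values (p0 + 1)/n and p0/n differ by 1/n, so they are not both
      integers; e is 0 or 1 accordingly.\<close>
    have frac: "(p0 + 1) / of_nat n - p0 / of_nat n \<notin> \<int>"
    proof -
      have "(p0 + 1) / of_nat n - p0 / of_nat n = 1 / of_int (int n)"
        by (simp add: add_divide_distrib)
      moreover have "(1 / of_int (int n) :: rat) \<notin> \<int>"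
        using fraction_not_in_Ints[of "int n" 1] n2 by simp
      ultimately show ?thesis by simp
    qed
    obtain e :: int where e: "(p0 + of_int e) / of_nat n \<notin> \<int>"
    proof (cases "p0 / of_nat n \<in> \<int>")
      case True
      then have "(p0 + 1) / of_nat n \<notin> \<int>" using frac by auto
      then show ?thesis using that[of 1] by simp
    next
      case False
      then show ?thesis using that[of 0] by simp
    qed
    have "p - of_int m * ((p0 + of_int e) / of_nat n) \<in> \<int>" if mp: "(of_int m * x, p) \<in> \<Gamma>" for m p
    proof -
      \<comment> \<open>Division with remainder: minimality of n forces r = 0, and then p agrees
        with k p0 up to an integer.\<close>
      define k where "k = m div int n"
      define r where "r = m mod int n"
      have m: "m = k * int n + r" unfolding k_def r_def by simp
      then have m_of_int: "(of_int m :: 'g) = of_int k * of_int (int n) + of_int r"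
        by (metis of_int_add of_int_mult)
      have r: "0 \<le> r" "r < int n" using n(1) unfolding r_def by auto
      have "(of_int m * x - of_int k * (of_int (int n) * x), p - of_int k * p0) \<in> \<Gamma>"
        using partial_character_diff[OF mp partial_character_scale[OF p0]] .
      moreover have "of_int m * x - of_int k * (of_int (int n) * x) = of_int r * x"
        using m_of_int by (simp add: distrib_right mult.assoc)
      ultimately have rx: "(of_int r * x, p - of_int k * p0) \<in> \<Gamma>" by simp
      have "\<not> (nat r > 0 \<and> of_int (int (nat r)) * x \<in> fst ` \<Gamma>)"
        using r by (intro least) auto
      moreover have "of_int (int (nat r)) * x \<in> fst ` \<Gamma>"
        using imageI[OF rx, of fst] r(1) by simp
      ultimately have r0: "r = 0" using r(1) by linarith
      then have "p - of_int k * p0 \<in> \<int>"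
        using partial_character_Ints[OF _ partial_character_zero] rx by fastforce
      moreover have "p - of_int m * ((p0 + of_int e) / of_nat n)
          = (p - of_int k * p0) - of_int (k * e)"
        using n(1) by (simp add: m r0 distrib_left add_divide_distrib)
      ultimately show ?thesis by (metis Ints_diff Ints_of_int)
    qed
    with e show ?thesis by blast
  qed
  then obtain q :: rat where q: "q \<notin> \<int>"
    and compat: "\<And>m p. (of_int m * x, p) \<in> \<Gamma> \<Longrightarrow> p - of_int m * q \<in> \<int>" by blast
  let ?\<Gamma> = "{(g + of_int m * x, p + of_int m * q) | g p m. (g, p) \<in> \<Gamma>}"
  have in_ext: "(g + of_int m * x, p + of_int m * q) \<in> ?\<Gamma>" if "(g, p) \<in> \<Gamma>" for g p m
    using that by blast
  have sub: "\<Gamma> \<subseteq> ?\<Gamma>" using in_ext[where m = 0] by auto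
  have "partial_character ?\<Gamma>"
    unfolding partial_character_def
  proof (intro conjI allI impI)
    show "(0, 1) \<in> ?\<Gamma>" using sub pc unfolding partial_character_def by blast
  next
    fix g p g' p'
    assume "(g, p) \<in> ?\<Gamma>" "(g', p') \<in> ?\<Gamma>"
    then obtain a b m a' b' m' where
      "(a, b) \<in> \<Gamma>" "g = a + of_int m * x" "p = b + of_int m * q"
      "(a', b') \<in> \<Gamma>" "g' = a' + of_int m' * x" "p' = b' + of_int m' * q" by blast
    then have "(a - a', b - b') \<in> \<Gamma>" "g - g' = (a - a') + of_int (m - m') * x"
      "p - p' = (b - b') + of_int (m - m') * q"
      using partial_character_diff by (simp_all add: left_diff_distrib)
    then show "(g - g', p - p') \<in> ?\<Gamma>" using in_ext by (simp only:)
  next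
    fix p assume "(0, p) \<in> ?\<Gamma>"
    then obtain a b m where ab: "(a, b) \<in> \<Gamma>" "0 = a + of_int m * x" "p = b + of_int m * q" by blast
    \<comment> \<open>The two parts cancel, so m x already lies in the domain and
      \<open>compat\<close> compares the values.\<close>
    then have "of_int m * x = - a" by (simp add: eq_neg_iff_add_eq_0 add.commute)
    then have "(of_int m * x, - b) \<in> \<Gamma>" using partial_character_minus[OF ab(1)] by simp
    then have "- b - of_int m * q \<in> \<int>" by (rule compat)
    then have "- (- b - of_int m * q) \<in> \<int>" by (rule Ints_minus)
    then show "p \<in> \<int>" using ab(3) by (simp add: add.commute)
  qed
  moreover have "(x, q) \<in> ?\<Gamma>"
    using in_ext[OF partial_character_zero, of 1] by simp
  ultimately show ?thesis using that sub q by blast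
qed

end

text \<open>\<open>\<rat>/\<int>\<close> is an injective cogenerator of abelian groups.\<close>

lemma separating_character:
  fixes N :: "'g::ring_1 set"
  assumes N: "0 \<in> N" "\<And>g h. g \<in> N \<Longrightarrow> h \<in> N \<Longrightarrow> g - h \<in> N" and x: "x \<notin> N"
  obtains f :: "'g \<Rightarrow> rat_mod_int" where
    "\<And>g h. f (g + h) = f g + f h" "\<And>g. g \<in> N \<Longrightarrow> f g = 0" "f x \<noteq> 0"
proof -
  \<comment> \<open>The zero map on N is extended to x with a non-integral value before Zorn's lemma
    is applied, so every larger partial character still separates x from N.\<close>
  have "partial_character (N \<times> \<int>)"
    unfolding partial_character_def using N by (auto intro: Ints_diff)
  moreover have "x \<notin> fst ` (N \<times> (\<int> :: rat set))" using x by auto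
  ultimately obtain \<Gamma>0 q where \<Gamma>0: "partial_character \<Gamma>0" "N \<times> \<int> \<subseteq> \<Gamma>0" "(x, q) \<in> \<Gamma>0" "q \<notin> \<int>"
    by (rule partial_character_extend)
  have "\<exists>M\<in>{\<Gamma>. partial_character \<Gamma> \<and> \<Gamma>0 \<subseteq> \<Gamma>}. \<forall>X\<in>{\<Gamma>. partial_character \<Gamma> \<and> \<Gamma>0 \<subseteq> \<Gamma>}. M \<subseteq> X \<longrightarrow> X = M"
  proof (rule subset_Zorn_nonempty)
    show "{\<Gamma>. partial_character \<Gamma> \<and> \<Gamma>0 \<subseteq> \<Gamma>} \<noteq> {}" using \<Gamma>0(1) by blast
  next
    fix C assume C: "C \<noteq> {}" "subset.chain {\<Gamma>. partial_character \<Gamma> \<and> \<Gamma>0 \<subseteq> \<Gamma>} C"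
    have mem: "partial_character \<Gamma>" "\<Gamma>0 \<subseteq> \<Gamma>" if "\<Gamma> \<in> C" for \<Gamma>
      using C(2) that unfolding subset_chain_def by auto
    have "partial_character (\<Union>C)"
      unfolding partial_character_def
    proof (intro conjI allI impI)
      show "(0, 1) \<in> \<Union>C" using C(1) mem(1) unfolding partial_character_def by blast
    next
      fix g p g' p' assume "(g, p) \<in> \<Union>C" "(g', p') \<in> \<Union>C"
      then obtain U V where UV: "U \<in> C" "V \<in> C" "(g, p) \<in> U" "(g', p') \<in> V" by blast
      then have "U \<subseteq> V \<or> V \<subseteq> U" using C(2) unfolding subset_chain_def by auto
      then show "(g - g', p - p') \<in> \<Union>C"
        using UV(3,4) partial_character_diff[OF mem(1)[OF UV(1)], of g p g' p']
          partial_character_diff[OF mem(1)[OF UV(2)], of g p g' p'] UV(1,2) by blast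
    next
      fix p assume "(0, p) \<in> \<Union>C"
      then show "p \<in> \<int>" using mem(1) unfolding partial_character_def by blast
    qed
    then show "\<Union>C \<in> {\<Gamma>. partial_character \<Gamma> \<and> \<Gamma>0 \<subseteq> \<Gamma>}" using C(1) mem(2) by blast
  qed
  then obtain \<Gamma> where pc: "partial_character \<Gamma>" and sup: "\<Gamma>0 \<subseteq> \<Gamma>"
    and maximal: "\<And>X. partial_character X \<Longrightarrow> \<Gamma> \<subseteq> X \<Longrightarrow> X = \<Gamma>"
    by (auto intro: order_trans)
  have total: "\<exists>p. (g, p) \<in> \<Gamma>" for g
  proof (rule ccontr)
    assume "\<nexists>p. (g, p) \<in> \<Gamma>"
    then have g: "g \<notin> fst ` \<Gamma>" by force
    obtain \<Gamma>' p where "partial_character \<Gamma>'" "\<Gamma> \<subseteq> \<Gamma>'" "(g, p) \<in> \<Gamma>'"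
      by (rule partial_character_extend[OF pc g]) blast
    with maximal g show False by force
  qed
  \<comment> \<open>All values at g agree modulo \<int>, so the choice disappears in the
    quotient.\<close>
  define f where "f g = abs_rat_mod_int (SOME p. (g, p) \<in> \<Gamma>)" for g
  have f_eq: "f g = abs_rat_mod_int p" if "(g, p) \<in> \<Gamma>" for g p
  proof -
    have "(g, SOME p. (g, p) \<in> \<Gamma>) \<in> \<Gamma>" using that by (rule someI)
    then show ?thesis
      unfolding f_def rat_mod_int.abs_eq_iff using partial_character_Ints[OF pc] that by blast
  qed
  show ?thesis
  proof
    fix g h
    obtain p q where "(g, p) \<in> \<Gamma>" "(h, q) \<in> \<Gamma>" using total by blast
    then show "f (g + h) = f g + f h"
      using partial_character_add[OF pc] by (simp add: f_eq plus_rat_mod_int.abs_eq)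
  next
    fix g assume "g \<in> N"
    then have "(g, 0) \<in> N \<times> \<int>" by simp
    then have "(g, 0) \<in> \<Gamma>" using \<Gamma>0(2) sup by blast
    then show "f g = 0" by (simp add: f_eq zero_rat_mod_int_def)
  next
    have "f x = abs_rat_mod_int q" using \<Gamma>0(3) sup by (intro f_eq) auto
    then show "f x \<noteq> 0"
      using \<Gamma>0(4) by (simp add: zero_rat_mod_int_def rat_mod_int.abs_eq_iff)
  qed
qed

section \<open>Characters detect the congruence of formal sums\<close>

lemma formal_sum_cong_lists:
  assumes "(xs, ys) \<in> formal_sum_cong X E"
  shows "xs \<in> lists X" "ys \<in> lists X"
  using assms by (induction rule: formal_sum_cong.induct) auto

lemma formal_sum_cong_sum:
  fixes F :: "'x \<Rightarrow> 'g::comm_monoid_add"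
  assumes "(xs, ys) \<in> formal_sum_cong X E"
    and "\<And>xs ys. (xs, ys) \<in> E \<Longrightarrow> xs \<in> lists X \<Longrightarrow> ys \<in> lists X \<Longrightarrow> sum_list (map F xs) = sum_list (map F ys)"
  shows "sum_list (map F xs) = sum_list (map F ys)"
  using assms(1) by (induction rule: formal_sum_cong.induct) (auto simp: assms(2) add.commute)

text \<open>The head of \<open>xs\<close> is moved by \<open>comm\<close> to its position in
  \<open>ys\<close>. This lets multisets, and hence integer-valued functions, stand for formal
  sums.\<close>

lemma formal_sum_cong_mset:
  assumes "mset xs = mset ys" "xs \<in> lists X"
  shows "(xs, ys) \<in> formal_sum_cong X E"
  using assms
proof (induction xs arbitrary: ys)
  case Nil
  then show ?case by (auto intro: formal_sum_cong.refl)
next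
  case (Cons x xs)
  have "x \<in> set ys" using Cons.prems(1) by (metis list.set_intros(1) set_mset_mset)
  then obtain us vs where ys: "ys = us @ x # vs" by (meson split_list)
  have "mset xs = mset (us @ vs)" using Cons.prems(1) ys by simp
  moreover have xs: "x \<in> X" "xs \<in> lists X" using Cons.prems(2) by auto
  ultimately have IH: "(xs, us @ vs) \<in> formal_sum_cong X E" using Cons.IH by blast
  then have uv: "us \<in> lists X" "vs \<in> lists X" using formal_sum_cong_lists(2) by fastforce+
  have "([x] @ xs, [x] @ (us @ vs)) \<in> formal_sum_cong X E"
    using xs by (intro formal_sum_cong.append[OF formal_sum_cong.refl IH]) simp
  moreover have "(([x] @ us) @ vs, (us @ [x]) @ vs) \<in> formal_sum_cong X E"
    using xs uv by (intro formal_sum_cong.append[OF formal_sum_cong.comm formal_sum_cong.refl]) auto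
  ultimately have "([x] @ xs, (us @ [x]) @ vs) \<in> formal_sum_cong X E"
    by (metis append.assoc formal_sum_cong.trans)
  then show ?case unfolding ys by simp
qed

text \<open>Each common summand u is removed by appending an inverse of u on both sides. Inverses of
  generators thus suffice to make the quotient monoid cancellative.\<close>

lemma formal_sum_cong_cancel:
  assumes inv: "\<And>x. x \<in> X \<Longrightarrow> \<exists>y. ([x, y], []) \<in> formal_sum_cong X E"
    and "(xs @ us, ys @ us) \<in> formal_sum_cong X E"
  shows "(xs, ys) \<in> formal_sum_cong X E"
  using assms(2)
proof (induction us arbitrary: xs ys)
  case Nil
  then show ?case by simp
next
  case (Cons u us)
  have "((xs @ [u]) @ us, (ys @ [u]) @ us) \<in> formal_sum_cong X E" using Cons.prems by simp
  then have *: "(xs @ [u], ys @ [u]) \<in> formal_sum_cong X E" by (rule Cons.IH)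
  have mem: "xs \<in> lists X" "ys \<in> lists X" "u \<in> X"
    using formal_sum_cong_lists[OF *] by auto
  obtain v where v: "([u, v], []) \<in> formal_sum_cong X E" using inv mem(3) by blast
  then have "v \<in> X" using formal_sum_cong_lists(1) by fastforce
  then have "(xs @ [u, v], ys @ [u, v]) \<in> formal_sum_cong X E"
    using formal_sum_cong.append[OF * formal_sum_cong.refl[of "[v]"]] by simp
  moreover have "(zs @ [u, v], zs) \<in> formal_sum_cong X E" if "zs \<in> lists X" for zs
    using formal_sum_cong.append[OF formal_sum_cong.refl[OF that] v] by simp
  ultimately show ?case using mem by (meson formal_sum_cong.sym formal_sum_cong.trans)
qed

text \<open>Maps formal sums into the group of all integer-valued functions, where differences exist
  and \<open>separating_character\<close> applies.\<close>

definition multiplicity_fun :: "'x list \<Rightarrow> 'x \<Rightarrow> int"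
  where "multiplicity_fun xs x = int (count (mset xs) x)"

lemma multiplicity_fun_append: "multiplicity_fun (xs @ ys) = multiplicity_fun xs + multiplicity_fun ys"
  by (auto simp: multiplicity_fun_def)

text \<open>If xs and ys are not congruent, cancellation shows that the difference of their
  multiplicity functions lies outside the subgroup of differences of congruent pairs. A character
  that kills this subgroup but not the difference, restricted to single generators, is a test
  function on which xs and ys disagree.\<close>

lemma formal_sum_congI:
  assumes inv: "\<And>x. x \<in> X \<Longrightarrow> \<exists>y. ([x, y], []) \<in> formal_sum_cong X E"
    and mem: "xs \<in> lists X" "ys \<in> lists X"
    and test: "\<And>F :: 'x \<Rightarrow> rat_mod_int.
      (\<And>us vs. (us, vs) \<in> E \<Longrightarrow> us \<in> lists X \<Longrightarrow> vs \<in> lists X \<Longrightarrow> sum_list (map F us) = sum_list (map F vs)) \<Longrightarrow>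
      sum_list (map F xs) = sum_list (map F ys)"
  shows "(xs, ys) \<in> formal_sum_cong X E"
proof (rule ccontr)
  assume neg: "(xs, ys) \<notin> formal_sum_cong X E"
  let ?m = "multiplicity_fun :: 'x list \<Rightarrow> 'x \<Rightarrow> int"
  let ?N = "{?m us - ?m vs | us vs. (us, vs) \<in> formal_sum_cong X E}"
  have outside: "?m xs - ?m ys \<notin> ?N"
  proof
    assume "?m xs - ?m ys \<in> ?N"
    then obtain us vs where uv: "(us, vs) \<in> formal_sum_cong X E" "?m xs - ?m ys = ?m us - ?m vs"
      by blast
    \<comment> \<open>Subtraction is cleared, so that the identity becomes one between
      multisets.\<close>
    have "?m xs x + ?m vs x = ?m ys x + ?m us x" for x
      using fun_cong[OF uv(2), of x] by simp
    then have "mset (xs @ vs) = mset (ys @ us)"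
      unfolding multiplicity_fun_def
      by (intro multiset_eqI) (metis count_union mset_append of_nat_add of_nat_eq_iff)
    then have "(xs @ vs, ys @ us) \<in> formal_sum_cong X E"
      using mem formal_sum_cong_lists[OF uv(1)] by (intro formal_sum_cong_mset) auto
    moreover have "(ys @ us, ys @ vs) \<in> formal_sum_cong X E"
      using formal_sum_cong.append[OF formal_sum_cong.refl[OF mem(2)] uv(1)] .
    ultimately have "(xs @ vs, ys @ vs) \<in> formal_sum_cong X E" by (rule formal_sum_cong.trans)
    then have "(xs, ys) \<in> formal_sum_cong X E" using inv by (rule formal_sum_cong_cancel[rotated])
    with neg show False by simp
  qed
  have "([], []) \<in> formal_sum_cong X E" by (rule formal_sum_cong.refl) simp
  moreover have "0 = ?m [] - ?m []" by simp
  ultimately have zero: "0 \<in> ?N" by blast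
  have diff: "g - h \<in> ?N" if gh: "g \<in> ?N" "h \<in> ?N" for g h
  proof -
    obtain us vs us' vs' where gh: "g = ?m us - ?m vs" "h = ?m us' - ?m vs'"
      "(us, vs) \<in> formal_sum_cong X E" "(us', vs') \<in> formal_sum_cong X E"
      using gh by blast
    have "(us @ vs', vs @ us') \<in> formal_sum_cong X E"
      using gh(3) formal_sum_cong.sym[OF gh(4)] by (rule formal_sum_cong.append)
    moreover have "g - h = ?m (us @ vs') - ?m (vs @ us')"
      unfolding gh(1,2) multiplicity_fun_append by simp
    ultimately show ?thesis by blast
  qed
  obtain f :: "('x \<Rightarrow> int) \<Rightarrow> rat_mod_int" where
    f: "\<And>g h. f (g + h) = f g + f h" "\<And>g. g \<in> ?N \<Longrightarrow> f g = 0" "f (?m xs - ?m ys) \<noteq> 0"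
    by (rule separating_character[where N = ?N, OF zero _ outside]) (rule diff that; assumption)+
  have f_diff: "f (g - h) = f g - f h" for g h
    using f(1)[of "g - h" h] by (simp add: algebra_simps)
  have sum: "sum_list (map (\<lambda>x. f (?m [x])) us) = f (?m us)" for us
  proof (induction us)
    case Nil
    have "?m [] = 0" by (auto simp: multiplicity_fun_def)
    moreover have "f 0 = 0" using f(1)[of 0 0] by simp
    ultimately show ?case by (simp only: list.map sum_list.Nil)
  next
    case (Cons u us)
    have "?m (u # us) = ?m [u] + ?m us" using multiplicity_fun_append[of "[u]" us] by simp
    then have "f (?m (u # us)) = f (?m [u]) + f (?m us)" using f(1) by (simp only:)
    with Cons show ?case by simp
  qed
  have "f (?m us) = f (?m vs)" if "(us, vs) \<in> E" "us \<in> lists X" "vs \<in> lists X" for us vs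
    using f(2)[of "?m us - ?m vs"] that by (auto simp: f_diff intro: formal_sum_cong.base)
  then have "f (?m xs) = f (?m ys)" using test[of "\<lambda>x. f (?m [x])"] unfolding sum by blast
  then show False using f(3) by (simp add: f_diff)
qed

section \<open>Balanced maps\<close>

text \<open>Closure under negation is included because \<open>formal_sum_congI\<close> asks for an
  inverse of each generator, here (- m, n) for (m, n).\<close>

definition tensor_carrier :: "'m::ab_group_add set \<Rightarrow> ('m \<Rightarrow> 'c \<Rightarrow> 'm) \<Rightarrow> bool"
  where "tensor_carrier M ract \<longleftrightarrow> 0 \<in> M \<and> (\<forall>m\<in>M. \<forall>m'\<in>M. m + m' \<in> M) \<and> (\<forall>m\<in>M. - m \<in> M) \<and>
    (\<forall>m\<in>M. \<forall>c. ract m c \<in> M)"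

lemma tensor_carrier_UNIV [simp]: "tensor_carrier UNIV ract"
  by (simp add: tensor_carrier_def)

definition balanced_map ::
    "'m::ab_group_add set \<Rightarrow> ('m \<Rightarrow> 'c \<Rightarrow> 'm) \<Rightarrow> ('c \<Rightarrow> 'n::ab_group_add \<Rightarrow> 'n) \<Rightarrow>
     ('m \<Rightarrow> 'n \<Rightarrow> 'g::ab_group_add) \<Rightarrow> bool"
  where "balanced_map M ract lact F \<longleftrightarrow>
    (\<forall>m\<in>M. \<forall>m'\<in>M. \<forall>n. F (m + m') n = F m n + F m' n) \<and>
    (\<forall>m\<in>M. \<forall>n n'. F m (n + n') = F m n + F m n') \<and>
    (\<forall>m\<in>M. \<forall>c n. F (ract m c) n = F m (lact c n))"

lemma balanced_map_zero:
  assumes "balanced_map M ract lact F"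
  shows "0 \<in> M \<Longrightarrow> F 0 n = 0" "m \<in> M \<Longrightarrow> F m 0 = 0"
  using assms unfolding balanced_map_def by (metis add_cancel_right_right)+

lemma tensor_rel_sum:
  assumes "(xs, ys) \<in> tensor_rel M ract lact" "balanced_map M ract lact F"
  shows "(\<Sum>(x, y)\<leftarrow>xs. F x y) = (\<Sum>(x, y)\<leftarrow>ys. F x y)"
  using assms(1) unfolding tensor_rel_def
proof (rule formal_sum_cong_sum, goal_cases)
  case (1 us vs)
  then show ?case
    using assms(2) balanced_map_zero[OF assms(2)] unfolding balanced_map_def by auto
qed

lemma tensor_relI:
  assumes M: "tensor_carrier M ract"
    and mem: "xs \<in> lists (M \<times> UNIV)" "ys \<in> lists (M \<times> UNIV)"
    and test: "\<And>F :: 'm::ab_group_add \<Rightarrow> 'n::ab_group_add \<Rightarrow> rat_mod_int. balanced_map M ract lact F \<Longrightarrow>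
      (\<Sum>(x, y)\<leftarrow>xs. F x y) = (\<Sum>(x, y)\<leftarrow>ys. F x y)"
  shows "(xs, ys) \<in> tensor_rel M ract lact"
  unfolding tensor_rel_def
proof (rule formal_sum_congI[OF _ mem], goal_cases)
  case (1 x)
  obtain m n where x: "x = (m, n)" "m \<in> M" using 1 by auto
  have mems: "0 \<in> M" "- m \<in> M" using M x unfolding tensor_carrier_def by auto
  have "([(m + - m, n)], [(m, n), (- m, n)]) \<in> tensor_rel M ract lact"
    unfolding tensor_rel_def using x mems by (intro formal_sum_cong.base) auto
  moreover have "([(m + - m, n)], []) \<in> tensor_rel M ract lact"
    unfolding tensor_rel_def using x mems by (intro formal_sum_cong.base) auto
  ultimately have "([(m, n), (- m, n)], []) \<in> tensor_rel M ract lact"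
    unfolding tensor_rel_def by (rule formal_sum_cong.trans[OF formal_sum_cong.sym])
  then show ?case unfolding x tensor_rel_def by blast
next
  case (2 F)
  have "balanced_map M ract lact (\<lambda>m n. F (m, n))"
    unfolding balanced_map_def
  proof (intro conjI ballI allI)
    fix m m' n assume "m \<in> M" "m' \<in> M"
    then have "sum_list (map F [(m + m', n)]) = sum_list (map F [(m, n), (m', n)])"
      using M by (intro 2) (auto simp: tensor_carrier_def)
    then show "F (m + m', n) = F (m, n) + F (m', n)" by simp
  next
    fix m n n' assume "m \<in> M"
    then have "sum_list (map F [(m, n + n')]) = sum_list (map F [(m, n), (m, n')])"
      using M by (intro 2) (auto simp: tensor_carrier_def)
    then show "F (m, n + n') = F (m, n) + F (m, n')" by simp
  next
    fix m c n assume "m \<in> M"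
    then have "sum_list (map F [(ract m c, n)]) = sum_list (map F [(m, lact c n)])"
      using M by (intro 2) (auto simp: tensor_carrier_def)
    then show "F (ract m c, n) = F (m, lact c n)" by simp
  qed
  from test[OF this] show ?case by simp
qed

section \<open>Representatives of tensor classes and Sweedler sums\<close>

lemma tensor_rel_equiv: "equiv (lists (M \<times> UNIV)) (tensor_rel M ract lact)"
proof (rule equivI)
  show "tensor_rel M ract lact \<subseteq> lists (M \<times> UNIV) \<times> lists (M \<times> UNIV)"
    unfolding tensor_rel_def by (auto dest: formal_sum_cong_lists)
  show "refl_on (lists (M \<times> UNIV)) (tensor_rel M ract lact)"
    unfolding tensor_rel_def refl_on_def by (blast intro: formal_sum_cong.refl)
  show "sym (tensor_rel M ract lact)"
    unfolding tensor_rel_def by (blast intro: symI formal_sum_cong.sym)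
  show "trans (tensor_rel M ract lact)"
    unfolding tensor_rel_def by (blast intro: transI formal_sum_cong.trans)
qed

lemma tcls_in_tensor: "xs \<in> lists (M \<times> UNIV) \<Longrightarrow> tcls M ract lact xs \<in> tensor M ract lact"
  unfolding tensor_def tcls_def by (rule quotientI)

lemma rep_tensor:
  assumes "T \<in> tensor M ract lact"
  shows "rep T \<in> lists (M \<times> UNIV)" "tcls M ract lact (rep T) = T"
proof -
  have "rep T \<in> T"
    unfolding rep_def using in_quotient_imp_non_empty[OF tensor_rel_equiv] assms
    unfolding tensor_def by (metis ex_in_conv someI_ex)
  moreover obtain xs where T: "T = tensor_rel M ract lact `` {xs}"
    using assms unfolding tensor_def by (rule quotientE)
  ultimately have rel: "(xs, rep T) \<in> tensor_rel M ract lact" by simp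
  then show "tcls M ract lact (rep T) = T"
    unfolding T tcls_def using equiv_class_eq[OF tensor_rel_equiv] by metis
  show "rep T \<in> lists (M \<times> UNIV)"
    using rel unfolding tensor_rel_def by (rule formal_sum_cong_lists)
qed

lemma tcls_rep_rel:
  assumes "xs \<in> lists (M \<times> UNIV)"
  shows "(xs, rep (tcls M ract lact xs)) \<in> tensor_rel M ract lact"
  using rep_tensor[OF tcls_in_tensor[OF assms]] assms tensor_rel_equiv
  unfolding tcls_def by (metis eq_equiv_class)

text \<open>\<open>swd (\<Delta> h) F\<close> is the Sweedler expression \<open>F h\<^sub>(\<^sub>1\<^sub>) h\<^sub>(\<^sub>2\<^sub>)\<close>.\<close>

definition swd :: "('m \<times> 'n) list set \<Rightarrow> ('m \<Rightarrow> 'n \<Rightarrow> 'g::comm_monoid_add) \<Rightarrow> 'g"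
  where "swd T F = (\<Sum>(x, y)\<leftarrow>rep T. F x y)"

text \<open>The arbitrary choice made by \<open>rep\<close> is invisible to a balanced map. Axioms
  that equate a coproduct or a coaction with an explicit class enter the Sweedler calculus through
  this rule.\<close>

lemma swd_tcls:
  assumes "xs \<in> lists (M \<times> UNIV)" "balanced_map M ract lact F"
  shows "swd (tcls M ract lact xs) F = (\<Sum>(x, y)\<leftarrow>xs. F x y)"
  unfolding swd_def using tensor_rel_sum[OF tcls_rep_rel[OF assms(1)] assms(2)] by simp

lemma tcls_eqI:
  fixes xs :: "('m::ab_group_add \<times> 'n::ab_group_add) list"
  assumes "tensor_carrier M ract" "xs \<in> lists (M \<times> UNIV)" "ys \<in> lists (M \<times> UNIV)"
    and "\<And>F :: 'm \<Rightarrow> 'n \<Rightarrow> rat_mod_int. balanced_map M ract lact F \<Longrightarrow>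
      (\<Sum>(x, y)\<leftarrow>xs. F x y) = (\<Sum>(x, y)\<leftarrow>ys. F x y)"
  shows "tcls M ract lact xs = tcls M ract lact ys"
  unfolding tcls_def by (rule equiv_class_eq[OF tensor_rel_equiv tensor_relI[OF assms]])

lemma tcls_eqD:
  assumes "tcls M ract lact xs = tcls M ract lact ys"
    and "xs \<in> lists (M \<times> UNIV)" "ys \<in> lists (M \<times> UNIV)" "balanced_map M ract lact F"
  shows "(\<Sum>(x, y)\<leftarrow>xs. F x y) = (\<Sum>(x, y)\<leftarrow>ys. F x y)"
  using swd_tcls[OF assms(2,4)] swd_tcls[OF assms(3,4)] assms(1) by simp

lemma swd_cong: "(\<And>x y. F x y = G x y) \<Longrightarrow> swd T F = swd T G"
  by (rule arg_cong[where f = "swd T"]) (intro ext)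

text \<open>For summands that agree only when the first leg lies in a subset such as B.\<close>

lemma swd_cong_set:
  assumes "rep T \<in> lists (M \<times> UNIV)" "\<And>x y. x \<in> M \<Longrightarrow> F x y = G x y"
  shows "swd T F = swd T G"
proof -
  have "map (\<lambda>(x, y). F x y) xs = map (\<lambda>(x, y). G x y) xs" if "xs \<in> lists (M \<times> UNIV)" for xs
    using that by (induction xs) (auto simp: assms(2))
  then show ?thesis unfolding swd_def using assms(1) by metis
qed

lemma hom_sum_list:
  fixes f :: "'m::ab_group_add \<Rightarrow> 'n::ab_group_add"
  assumes "\<And>x y. f (x + y) = f x + f y"
  shows "f (\<Sum>x\<leftarrow>xs. g x) = (\<Sum>x\<leftarrow>xs. f (g x))"
proof -
  have "f 0 = 0" using assms[of 0 0] by simp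
  then show ?thesis by (induction xs) (auto simp: assms)
qed

lemma swd_hom:
  fixes f :: "'m::ab_group_add \<Rightarrow> 'n::ab_group_add"
  assumes "\<And>x y. f (x + y) = f x + f y"
  shows "f (swd T F) = swd T (\<lambda>x y. f (F x y))"
  unfolding swd_def using hom_sum_list[OF assms, of "\<lambda>(x, y). F x y"] by (simp add: split_def)

lemma swd_add: "swd T (\<lambda>x y. F x y + G x y) = swd T F + swd T G"
  unfolding swd_def by (simp add: split_def sum_list_addf)

lemma swd_mult_left: "swd T (\<lambda>x y. c * F x y) = c * swd T F" for c :: "'a::ring"
  by (rule swd_hom[symmetric]) (simp add: distrib_left)

lemma swd_mult_right: "swd T (\<lambda>x y. F x y * c) = swd T F * c" for c :: "'a::ring"
  by (rule swd_hom[symmetric, where f = "\<lambda>z. z * c"]) (simp add: distrib_right)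

lemma swd_swap:
  "swd T (\<lambda>x y. swd U (\<lambda>u v. F x y u v)) = swd U (\<lambda>u v. swd T (\<lambda>x y. F x y u v))"
  for F :: "_ \<Rightarrow> _ \<Rightarrow> _ \<Rightarrow> _ \<Rightarrow> 'g::comm_monoid_add"
proof -
  have "(\<Sum>x\<leftarrow>xs. \<Sum>y\<leftarrow>ys. f x y) = (\<Sum>y\<leftarrow>ys. \<Sum>x\<leftarrow>xs. f x y)"
    for f :: "'c \<Rightarrow> 'd \<Rightarrow> 'g" and xs ys
    by (induction xs) (simp_all add: sum_list_addf)
  from this[of "\<lambda>(x, y) (u, v). F x y u v"] show ?thesis unfolding swd_def by (simp add: split_def)
qed

lemma sum_list_bind: "(\<Sum>z\<leftarrow>concat (map g xs). f z) = (\<Sum>x\<leftarrow>xs. \<Sum>z\<leftarrow>g x. f z)"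
  for f :: "_ \<Rightarrow> 'g::comm_monoid_add"
  by (induction xs) auto

section \<open>Threefold tensor products\<close>

definition balanced_map3 ::
    "'m::ab_group_add set \<Rightarrow> ('m \<Rightarrow> 'c \<Rightarrow> 'm) \<Rightarrow> ('c \<Rightarrow> 'n::ab_group_add \<Rightarrow> 'n) \<Rightarrow>
     ('n \<Rightarrow> 'd \<Rightarrow> 'n) \<Rightarrow> ('d \<Rightarrow> 'p::ab_group_add \<Rightarrow> 'p) \<Rightarrow> ('m \<Rightarrow> 'n \<Rightarrow> 'p \<Rightarrow> 'g::ab_group_add) \<Rightarrow> bool"
  where "balanced_map3 M ractC lactC ractD lactD F \<longleftrightarrow>
    (\<forall>p. balanced_map M ractC lactC (\<lambda>m n. F m n p)) \<and>
    (\<forall>m\<in>M. balanced_map UNIV ractD lactD (F m))"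

lemma tensor3_rel_sum:
  assumes "(xs, ys) \<in> tensor3_rel M ractC lactC ractD lactD"
    and F: "balanced_map3 M ractC lactC ractD lactD F"
  shows "(\<Sum>(x, y, z)\<leftarrow>xs. F x y z) = (\<Sum>(x, y, z)\<leftarrow>ys. F x y z)"
  using assms(1) unfolding tensor3_rel_def
proof (rule formal_sum_cong_sum, goal_cases)
  case (1 us vs)
  have zero: "F 0 n p = 0" if "0 \<in> M" for n p
    using balanced_map_zero(1)[where F = "\<lambda>m n. F m n p" and M = M and n = n] F that
    unfolding balanced_map3_def by blast
  have zero': "F m 0 p = 0" "F m n 0 = 0" if "m \<in> M" for m n p
    using balanced_map_zero[where F = "F m" and M = UNIV] F that
    unfolding balanced_map3_def by blast+
  from 1 show ?case
    using F zero zero' unfolding balanced_map3_def balanced_map_def by auto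
qed

lemma tensor3_relI:
  assumes M: "tensor_carrier M ractC"
    and mem: "xs \<in> lists (M \<times> UNIV \<times> UNIV)" "ys \<in> lists (M \<times> UNIV \<times> UNIV)"
    and test: "\<And>F :: 'm::ab_group_add \<Rightarrow> 'n::ab_group_add \<Rightarrow> 'p::ab_group_add \<Rightarrow> rat_mod_int.
      balanced_map3 M ractC lactC ractD lactD F \<Longrightarrow>
      (\<Sum>(x, y, z)\<leftarrow>xs. F x y z) = (\<Sum>(x, y, z)\<leftarrow>ys. F x y z)"
  shows "(xs, ys) \<in> tensor3_rel M ractC lactC ractD lactD"
  unfolding tensor3_rel_def
proof (rule formal_sum_congI[OF _ mem], goal_cases)
  case (1 x)
  let ?R = "tensor3_rel M ractC lactC ractD lactD"
  obtain m n p where x: "x = (m, n, p)" "m \<in> M" using 1 by auto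
  have mems: "0 \<in> M" "- m \<in> M" using M x unfolding tensor_carrier_def by auto
  have "([(m + - m, n, p)], [(m, n, p), (- m, n, p)]) \<in> ?R"
    unfolding tensor3_rel_def using x mems by (intro formal_sum_cong.base) auto
  moreover have "([(m + - m, n, p)], []) \<in> ?R"
    unfolding tensor3_rel_def using x mems by (intro formal_sum_cong.base) auto
  ultimately have "([(m, n, p), (- m, n, p)], []) \<in> ?R"
    unfolding tensor3_rel_def by (rule formal_sum_cong.trans[OF formal_sum_cong.sym])
  then show ?case unfolding x tensor3_rel_def by blast
next
  case (2 F)
  have "balanced_map3 M ractC lactC ractD lactD (\<lambda>m n p. F (m, n, p))"
    unfolding balanced_map3_def balanced_map_def
  proof (intro conjI ballI allI)
    fix m m' n p assume "m \<in> M" "m' \<in> M"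
    then have "sum_list (map F [(m + m', n, p)]) = sum_list (map F [(m, n, p), (m', n, p)])"
      using M by (intro 2) (auto simp: tensor_carrier_def)
    then show "F (m + m', n, p) = F (m, n, p) + F (m', n, p)" by simp
  next
    fix m n n' p assume "m \<in> M"
    then have "sum_list (map F [(m, n + n', p)]) = sum_list (map F [(m, n, p), (m, n', p)])"
      using M by (intro 2) (auto simp: tensor_carrier_def)
    then show "F (m, n + n', p) = F (m, n, p) + F (m, n', p)" by simp
    then show "F (m, n + n', p) = F (m, n, p) + F (m, n', p)" by simp
  next
    fix m n p p' assume "m \<in> M"
    then have "sum_list (map F [(m, n, p + p')]) = sum_list (map F [(m, n, p), (m, n, p')])"
      using M by (intro 2) (auto simp: tensor_carrier_def)
    then show "F (m, n, p + p') = F (m, n, p) + F (m, n, p')" by simp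
  next
    fix m c n p assume "m \<in> M"
    then have "sum_list (map F [(ractC m c, n, p)]) = sum_list (map F [(m, lactC c n, p)])"
      using M by (intro 2) (auto simp: tensor_carrier_def)
    then show "F (ractC m c, n, p) = F (m, lactC c n, p)" by simp
  next
    fix m n d p assume "m \<in> M"
    then have "sum_list (map F [(m, ractD n d, p)]) = sum_list (map F [(m, n, lactD d p)])"
      using M by (intro 2) (auto simp: tensor_carrier_def)
    then show "F (m, ractD n d, p) = F (m, n, lactD d p)" by simp
  qed
  from test[OF this] show ?case by simp
qed

lemma tensor3_rel_equiv:
  "equiv (lists (M \<times> UNIV \<times> UNIV)) (tensor3_rel M ractC lactC ractD lactD)"
proof (rule equivI)
  let ?R = "tensor3_rel M ractC lactC ractD lactD" and ?X = "M \<times> UNIV \<times> UNIV"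
  show "?R \<subseteq> lists ?X \<times> lists ?X"
    unfolding tensor3_rel_def by (auto dest: formal_sum_cong_lists)
  show "refl_on (lists ?X) ?R"
    unfolding tensor3_rel_def refl_on_def by (blast intro: formal_sum_cong.refl)
  show "sym ?R"
    unfolding tensor3_rel_def by (blast intro: symI formal_sum_cong.sym)
  show "trans ?R"
    unfolding tensor3_rel_def by (blast intro: transI formal_sum_cong.trans)
qed

lemma tcls3_eqI:
  fixes xs :: "('m::ab_group_add \<times> 'n::ab_group_add \<times> 'p::ab_group_add) list"
  assumes "tensor_carrier M ractC"
    and "xs \<in> lists (M \<times> UNIV \<times> UNIV)" "ys \<in> lists (M \<times> UNIV \<times> UNIV)"
    and "\<And>F :: 'm \<Rightarrow> 'n \<Rightarrow> 'p \<Rightarrow> rat_mod_int. balanced_map3 M ractC lactC ractD lactD F \<Longrightarrow>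
      (\<Sum>(x, y, z)\<leftarrow>xs. F x y z) = (\<Sum>(x, y, z)\<leftarrow>ys. F x y z)"
  shows "tcls3 M ractC lactC ractD lactD xs = tcls3 M ractC lactC ractD lactD ys"
  unfolding tcls3_def by (rule equiv_class_eq[OF tensor3_rel_equiv tensor3_relI[OF assms]])

lemma tcls3_eqD:
  assumes "tcls3 M ractC lactC ractD lactD xs = tcls3 M ractC lactC ractD lactD ys"
    and "ys \<in> lists (M \<times> UNIV \<times> UNIV)" "balanced_map3 M ractC lactC ractD lactD F"
  shows "(\<Sum>(x, y, z)\<leftarrow>xs. F x y z) = (\<Sum>(x, y, z)\<leftarrow>ys. F x y z)"
  using eq_equiv_class[OF assms(1)[unfolded tcls3_def] tensor3_rel_equiv assms(2)] assms(3)
  by (rule tensor3_rel_sum)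

text \<open>The inner and outer coproducts are left arbitrary, so the same rule serves
  coassociativity of corings and comodules, the mixed axioms of a Hopf algebroid and the
  compatibility of two coactions.\<close>

lemma sweedler3_eq:
  assumes "tcls3 UNIV ractC lactC ractD lactD
      [(x1, x2, y). (x, y) \<leftarrow> rep T, (x1, x2) \<leftarrow> rep (U x)] =
    tcls3 UNIV ractC lactC ractD lactD [(x, y1, y2). (x, y) \<leftarrow> rep T', (y1, y2) \<leftarrow> rep (U' y)]"
    and "\<And>p. balanced_map UNIV ractC lactC (\<lambda>m n. F m n p)"
    and "\<And>m. balanced_map UNIV ractD lactD (F m)"
  shows "swd T (\<lambda>x y. swd (U x) (\<lambda>x1 x2. F x1 x2 y)) = swd T' (\<lambda>x y. swd (U' y) (F x))"
proof -
  have "balanced_map3 UNIV ractC lactC ractD lactD F"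
    unfolding balanced_map3_def using assms(2,3) by blast
  from tcls3_eqD[OF assms(1) _ this] show ?thesis
    unfolding swd_def by (simp add: split_def sum_list_bind comp_def)
qed

section \<open>Sweedler calculus for corings and comodules\<close>

context coring
begin

lemma swd_comult_add:
  "balanced_map UNIV ract lact F \<Longrightarrow> swd (\<Delta> (h + h')) F = swd (\<Delta> h) F + swd (\<Delta> h') F"
  unfolding comult_add by (subst swd_tcls) (auto simp: swd_def)

lemma swd_comult_bilinear:
  assumes "balanced_map UNIV ract lact F"
  shows "swd (\<Delta> (lact c (ract h d))) F = swd (\<Delta> h) (\<lambda>x y. F (lact c x) (ract y d))"
  unfolding comult_bilinear
  by (subst swd_tcls[OF _ assms]) (auto simp: swd_def split_def sum_list_bind comp_def)

lemma swd_comult_lact: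
  "balanced_map UNIV ract lact F \<Longrightarrow> swd (\<Delta> (lact c h)) F = swd (\<Delta> h) (\<lambda>x y. F (lact c x) y)"
  using swd_comult_bilinear[of F c h 1] by (simp add: right_module.act_one[OF right])

lemma swd_comult_ract:
  "balanced_map UNIV ract lact F \<Longrightarrow> swd (\<Delta> (ract h d)) F = swd (\<Delta> h) (\<lambda>x y. F x (ract y d))"
  using swd_comult_bilinear[of F 1 h d] by (simp add: left_module.act_one[OF left])

lemma counit_lact: "\<epsilon> (lact c h) = c * \<epsilon> h"
  using counit_bilinear[of c h 1] by (simp add: right_module.act_one[OF right])

lemma counit_ract: "\<epsilon> (ract h d) = \<epsilon> h * d"
  using counit_bilinear[of 1 h d] by (simp add: left_module.act_one[OF left])

lemma swd_coassoc:
  assumes "\<And>p. balanced_map UNIV ract lact (\<lambda>m n. F m n p)" "\<And>m. balanced_map UNIV ract lact (F m)"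
  shows "swd (\<Delta> h) (\<lambda>x y. swd (\<Delta> x) (\<lambda>x1 x2. F x1 x2 y)) = swd (\<Delta> h) (\<lambda>x y. swd (\<Delta> y) (F x))"
  using coassoc assms by (rule sweedler3_eq)

lemma swd_counit_left:
  "(\<And>x y. f (x + y) = f x + f y) \<Longrightarrow> swd (\<Delta> h) (\<lambda>x y. f (lact (\<epsilon> x) y)) = f h"
  for f :: "'h \<Rightarrow> 'g::ab_group_add"
  using swd_hom[of f "\<Delta> h" "\<lambda>x y. lact (\<epsilon> x) y"] counit_left[of h] by (simp add: swd_def)

lemma swd_counit_right:
  "(\<And>x y. f (x + y) = f x + f y) \<Longrightarrow> swd (\<Delta> h) (\<lambda>x y. f (ract x (\<epsilon> y))) = f h"
  for f :: "'h \<Rightarrow> 'g::ab_group_add"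
  using swd_hom[of f "\<Delta> h" "\<lambda>x y. ract x (\<epsilon> y)"] counit_right[of h] by (simp add: swd_def)

end

context coring_comodule
begin

lemma swd_coact_add:
  "balanced_map UNIV mact lact F \<Longrightarrow> swd (\<rho> (m + m')) F = swd (\<rho> m) F + swd (\<rho> m') F"
  unfolding coact_add by (subst swd_tcls) (auto simp: swd_def)

lemma swd_coact_linear:
  assumes "balanced_map UNIV mact lact F"
  shows "swd (\<rho> (mact m c)) F = swd (\<rho> m) (\<lambda>x y. F x (ract y c))"
  unfolding coact_linear
  by (subst swd_tcls[OF _ assms]) (auto simp: swd_def split_def sum_list_bind comp_def)

lemma swd_coact_coassoc:
  assumes "\<And>p. balanced_map UNIV mact lact (\<lambda>m n. F m n p)" "\<And>m. balanced_map UNIV ract lact (F m)"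
  shows "swd (\<rho> m) (\<lambda>x y. swd (\<rho> x) (\<lambda>x1 x2. F x1 x2 y)) = swd (\<rho> m) (\<lambda>x y. swd (\<Delta> y) (F x))"
  using coact_coassoc assms by (rule sweedler3_eq)

lemma swd_coact_counit:
  "(\<And>x y. f (x + y) = f x + f y) \<Longrightarrow> swd (\<rho> m) (\<lambda>x y. f (mact x (\<epsilon> y))) = f m"
  for f :: "'m \<Rightarrow> 'g::ab_group_add"
  using swd_hom[of f "\<rho> m" "\<lambda>x y. mact x (\<epsilon> y)"] coact_counit[of m] by (simp add: swd_def)

end

section \<open>Sweedler calculus for Hopf algebroids\<close>

context hopf_algebroid
begin

abbreviation "sL \<equiv> src HL"
abbreviation "tL \<equiv> tgt HL"
abbreviation "sR \<equiv> src HR"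
abbreviation "tR \<equiv> tgt HR"
abbreviation "piL \<equiv> counit HL"
abbreviation "piR \<equiv> counit HR"
abbreviation "DL h F \<equiv> swd (comult HL h) F"
abbreviation "DR h F \<equiv> swd (comult HR h) F"
abbreviation "balL F \<equiv> balanced_map UNIV (ractL HL) (lactL HL) F"
abbreviation "balR F \<equiv> balanced_map UNIV (ractR HR) (lactR HR) F"

lemma balL_iff: "balL F \<longleftrightarrow> (\<forall>m m' n. F (m + m') n = F m n + F m' n) \<and>
    (\<forall>m n n'. F m (n + n') = F m n + F m n') \<and> (\<forall>m l n. F (tL l * m) n = F m (sL l * n))"
  unfolding balanced_map_def ractL_def lactL_def by simp

lemma balR_iff: "balR F \<longleftrightarrow> (\<forall>m m' n. F (m + m') n = F m n + F m' n) \<and>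
    (\<forall>m n n'. F m (n + n') = F m n + F m n') \<and> (\<forall>m r n. F (m * sR r) n = F m (n * tR r))"
  unfolding balanced_map_def ractR_def lactR_def by simp

lemma balLI:
  "(\<And>m m' n. F (m + m') n = F m n + F m' n) \<Longrightarrow> (\<And>m n n'. F m (n + n') = F m n + F m n') \<Longrightarrow>
    (\<And>m l n. F (tL l * m) n = F m (sL l * n)) \<Longrightarrow> balL F"
  unfolding balL_iff by blast

lemma balRI:
  "(\<And>m m' n. F (m + m') n = F m n + F m' n) \<Longrightarrow> (\<And>m n n'. F m (n + n') = F m n + F m n') \<Longrightarrow>
    (\<And>m r n. F (m * sR r) n = F m (n * tR r)) \<Longrightarrow> balR F"
  unfolding balR_iff by blast

lemma balL_D:
  assumes "balL F"
  shows "F (m + m') n = F m n + F m' n" "F m (n + n') = F m n + F m n'"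
    "F (tL l * m) n = F m (sL l * n)"
  using assms unfolding balL_iff by blast+

lemma balR_D:
  assumes "balR F"
  shows "F (m + m') n = F m n + F m' n" "F m (n + n') = F m n + F m n'"
    "F (m * sR r) n = F m (n * tR r)"
  using assms unfolding balR_iff by blast+

lemma coring_L: "coring (lactL HL) (ractL HL) (comult HL) (counit HL)"
  using left_bialgebroid by (rule left_bialgebroid.is_coring)

lemma coring_R: "coring (lactR HR) (ractR HR) (comult HR) (counit HR)"
  using right_bialgebroid by (rule right_bialgebroid.is_coring)

lemma src_tgt_simps [simp]:
  "sL (x + y) = sL x + sL y" "sL (x * y) = sL x * sL y" "sL 1 = 1"
  "tL (x + y) = tL x + tL y" "tL (x * y) = tL y * tL x" "tL 1 = 1"
  "sR (r + s) = sR r + sR s" "sR (r * s) = sR r * sR s" "sR 1 = 1"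
  "tR (r + s) = tR r + tR s" "tR (r * s) = tR s * tR r" "tR 1 = 1"
  using left_bialgebroid.src_map[OF left_bialgebroid] left_bialgebroid.tgt_map[OF left_bialgebroid]
    right_bialgebroid.src_map[OF right_bialgebroid] right_bialgebroid.tgt_map[OF right_bialgebroid]
  unfolding algebra_map_def anti_algebra_map_def k_linear_def by simp_all

lemma src_tgt_scale:
  "sL (scL c l) = scH c (sL l)" "tL (scL c l) = scH c (tL l)" "sR (scR c r) = scH c (sR r)"
  using left_bialgebroid.src_map[OF left_bialgebroid] left_bialgebroid.tgt_map[OF left_bialgebroid]
    right_bialgebroid.src_map[OF right_bialgebroid]
  unfolding algebra_map_def anti_algebra_map_def k_linear_def by simp_all

lemma sL_tL_commute: "sL l * tL l' = tL l' * sL l"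
  using left_bialgebroid by (rule left_bialgebroid.src_tgt_commute)

lemma sR_tR_commute: "sR r * tR r' = tR r' * sR r"
  using right_bialgebroid by (rule right_bialgebroid.src_tgt_commute)

lemma piL_add [simp]: "piL (x + y) = piL x + piL y"
  using coring_L by (rule coring.counit_add)

lemma piR_add [simp]: "piR (x + y) = piR x + piR y"
  using coring_R by (rule coring.counit_add)

lemma piL_one [simp]: "piL 1 = 1"
  using left_bialgebroid by (rule left_bialgebroid.counit_one)

lemma piR_one [simp]: "piR 1 = 1"
  using right_bialgebroid by (rule right_bialgebroid.counit_one)

lemma piL_sL_left [simp]: "piL (sL l * h) = l * piL h"
  using coring.counit_lact[OF coring_L] by (simp add: lactL_def)

lemma piL_tL_left [simp]: "piL (tL l * h) = piL h * l"
  using coring.counit_ract[OF coring_L] by (simp add: ractL_def)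

lemma piR_tR_right [simp]: "piR (h * tR r) = r * piR h"
  using coring.counit_lact[OF coring_R] by (simp add: lactR_def)

lemma piR_sR_right [simp]: "piR (h * sR r) = piR h * r"
  using coring.counit_ract[OF coring_R] by (simp add: ractR_def)

lemma piL_src_tgt [simp]: "piL (sL l) = l" "piL (tL l) = l"
  using piL_sL_left[of l 1] piL_tL_left[of l 1] by simp_all

lemma piR_src_tgt [simp]: "piR (sR r) = r" "piR (tR r) = r"
  using piR_sR_right[of 1 r] piR_tR_right[of 1 r] by simp_all

lemma piL_tL_right: "piL (h * tL l) = piL (h * sL l)"
  using left_bialgebroid.counit_mult_src[OF left_bialgebroid, of h "tL l"]
    left_bialgebroid.counit_mult_tgt[OF left_bialgebroid, of h "sL l"] by simp

lemma piR_sR_left: "piR (sR r * h) = piR (tR r * h)"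
  using right_bialgebroid.counit_src_mult[OF right_bialgebroid, of "tR r" h] by simp

lemmas base_maps [simp] =
  srcL_counitL_tgtR tgtL_counitL_srcR srcR_counitR_tgtL tgtR_counitR_srcL

lemma DL_add: "balL F \<Longrightarrow> DL (h + h') F = DL h F + DL h' F"
  using coring_L by (rule coring.swd_comult_add)

lemma DR_add: "balR F \<Longrightarrow> DR (h + h') F = DR h F + DR h' F"
  using coring_R by (rule coring.swd_comult_add)

lemma DL_mult:
  assumes "balL F"
  shows "DL (h * h') F = DL h (\<lambda>x y. DL h' (\<lambda>x' y'. F (x * x') (y * y')))"
  unfolding left_bialgebroid.comult_mult[OF left_bialgebroid]
  by (subst swd_tcls[OF _ assms]) (auto simp: swd_def split_def sum_list_bind comp_def)

lemma DR_mult: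
  assumes "balR F"
  shows "DR (h * h') F = DR h (\<lambda>x y. DR h' (\<lambda>x' y'. F (x * x') (y * y')))"
  unfolding right_bialgebroid.comult_mult[OF right_bialgebroid]
  by (subst swd_tcls[OF _ assms]) (auto simp: swd_def split_def sum_list_bind comp_def)

lemma DL_one: "balL F \<Longrightarrow> DL 1 F = F 1 1"
  unfolding left_bialgebroid.comult_one[OF left_bialgebroid] by (subst swd_tcls) auto

lemma DR_one: "balR F \<Longrightarrow> DR 1 F = F 1 1"
  unfolding right_bialgebroid.comult_one[OF right_bialgebroid] by (subst swd_tcls) auto

lemma DL_takeuchi: "balL F \<Longrightarrow> DL h (\<lambda>x y. F (x * tL l) y) = DL h (\<lambda>x y. F x (y * sL l))"
  using tcls_eqD[OF left_bialgebroid.takeuchi[OF left_bialgebroid, where h = h and l = l], where F = F]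
  by (simp add: swd_def split_def sum_list_bind comp_def)

lemma DR_takeuchi: "balR F \<Longrightarrow> DR h (\<lambda>x y. F (sR r * x) y) = DR h (\<lambda>x y. F x (tR r * y))"
  using tcls_eqD[OF right_bialgebroid.takeuchi[OF right_bialgebroid, where h = h and r = r], where F = F]
  by (simp add: swd_def split_def sum_list_bind comp_def)

lemma DL_sL_left: "balL F \<Longrightarrow> DL (sL l * h) F = DL h (\<lambda>x y. F (sL l * x) y)"
  using coring.swd_comult_lact[OF coring_L, of F l h] by (simp add: lactL_def)

lemma DL_tL_left: "balL F \<Longrightarrow> DL (tL l * h) F = DL h (\<lambda>x y. F x (tL l * y))"
  using coring.swd_comult_ract[OF coring_L, of F h l] by (simp add: ractL_def)

lemma DR_tR_right: "balR F \<Longrightarrow> DR (h * tR r) F = DR h (\<lambda>x y. F (x * tR r) y)"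
  using coring.swd_comult_lact[OF coring_R, of F r h] by (simp add: lactR_def)

lemma DR_sR_right: "balR F \<Longrightarrow> DR (h * sR r) F = DR h (\<lambda>x y. F x (y * sR r))"
  using coring.swd_comult_ract[OF coring_R, of F h r] by (simp add: ractR_def)

lemma balL_mult_right:
  assumes "balL F"
  shows "balL (\<lambda>x y. F (x * a) (y * b))"
  by (rule balLI) (simp_all add: distrib_right balL_D[OF assms] mult.assoc)

lemma balR_mult_left:
  assumes "balR F"
  shows "balR (\<lambda>x y. F (a * x) (b * y))"
  by (rule balRI) (simp_all add: distrib_left balR_D[OF assms] flip: mult.assoc)

text \<open>
  Left multiplication by a coproduct does not preserve balancedness termwise, but does so after
  summation, by the Takeuchi property.
\<close>

lemma balL_comult_left:
  assumes F: "balL F"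
  shows "balL (\<lambda>x' y'. DL h (\<lambda>x y. F (x * x') (y * y')))"
proof (rule balLI)
  fix m l n
  have "balL (\<lambda>x y. F (x * m) (y * n))" using F by (rule balL_mult_right)
  from DL_takeuchi[OF this, where h = h and l = l]
  show "DL h (\<lambda>x y. F (x * (tL l * m)) (y * n)) = DL h (\<lambda>x y. F (x * m) (y * (sL l * n)))"
    by (simp add: mult.assoc)
qed (simp_all add: distrib_left balL_D[OF F] swd_add)

lemma balR_comult_right:
  assumes F: "balR F"
  shows "balR (\<lambda>x y. DR h (\<lambda>x' y'. F (x * x') (y * y')))"
proof (rule balRI)
  fix m r n
  have "balR (\<lambda>x y. F (m * x) (n * y))" using F by (rule balR_mult_left)
  from DR_takeuchi[OF this, where h = h and r = r]
  show "DR h (\<lambda>x' y'. F (m * sR r * x') (n * y')) = DR h (\<lambda>x' y'. F (m * x') (n * tR r * y'))"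
    by (simp add: mult.assoc)
qed (simp_all add: distrib_right balR_D[OF F] swd_add)

lemma balL_base_left:
  assumes F: "balL F"
  shows "balL (\<lambda>x y. F (sL l * x) (tL l' * y))"
proof (rule balLI)
  fix m k n
  have "sL l * (tL k * m) = tL k * (sL l * m)" "tL l' * (sL k * n) = sL k * (tL l' * n)"
    by (simp_all add: sL_tL_commute flip: mult.assoc)
  then show "F (sL l * (tL k * m)) (tL l' * n) = F (sL l * m) (tL l' * (sL k * n))"
    using balL_D(3)[OF F] by simp
qed (simp_all add: distrib_left balL_D[OF F])

lemma balR_base_right:
  assumes F: "balR F"
  shows "balR (\<lambda>x y. F (x * tR r) (y * sR r'))"
proof (rule balRI)
  fix m k n
  have "m * sR k * tR r = m * tR r * sR k" "n * tR k * sR r' = n * sR r' * tR k"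
    by (simp_all add: sR_tR_commute mult.assoc)
  then show "F (m * sR k * tR r) (n * sR r') = F (m * tR r) (n * tR k * sR r')"
    using balR_D(3)[OF F] by simp
qed (simp_all add: distrib_right balR_D[OF F])

section \<open>Coproducts of products with elements of the base algebras\<close>

text \<open>Bimodule linearity covers only left multiplication. Here the coproduct of
  \<open>sL l\<close> is computed from linearity at 1 and multiplied onto that of h; the map
  \<open>?G\<close>, which performs this multiplication, is balanced by the Takeuchi property. The
  two lemmas after this one are the mirror argument in the right bialgebroid.\<close>

lemma DL_sL_right:
  assumes F: "balL F"
  shows "DL (h * sL l) F = DL h (\<lambda>x y. F (x * sL l) y)"
proof -
  let ?G = "\<lambda>x' y'. DL h (\<lambda>x y. F (x * x') (y * y'))"
  have G: "balL ?G" using F by (rule balL_comult_left)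
  have G': "balL (\<lambda>x y. ?G (sL l * x) y)"
    using balL_base_left[OF G, of l 1] by simp
  have "DL (h * sL l) F = DL (sL l * 1) ?G"
    unfolding DL_mult[OF F] by (subst swd_swap) simp
  also have "\<dots> = ?G (sL l) 1"
    unfolding DL_sL_left[OF G] using DL_one[OF G'] by simp
  finally show ?thesis by simp
qed

lemma DR_sR_left:
  assumes F: "balR F"
  shows "DR (sR r * h) F = DR h (\<lambda>x y. F x (sR r * y))"
proof -
  let ?G = "\<lambda>x y. DR h (\<lambda>x' y'. F (x * x') (y * y'))"
  have G: "balR ?G" using F by (rule balR_comult_right)
  have G': "balR (\<lambda>x y. ?G x (y * sR r))"
    using balR_base_right[OF G, of 1 r] by simp
  have "DR (sR r * h) F = DR (1 * sR r) ?G"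
    unfolding DR_mult[OF F] by simp
  also have "\<dots> = ?G 1 (sR r)"
    unfolding DR_sR_right[OF G] using DR_one[OF G'] by simp
  finally show ?thesis by simp
qed

lemma DR_tR_left:
  assumes F: "balR F"
  shows "DR (tR r * h) F = DR h (\<lambda>x y. F (tR r * x) y)"
proof -
  let ?G = "\<lambda>x y. DR h (\<lambda>x' y'. F (x * x') (y * y'))"
  have G: "balR ?G" using F by (rule balR_comult_right)
  have G': "balR (\<lambda>x y. ?G (x * tR r) y)"
    using balR_base_right[OF G, of r 1] by simp
  have "DR (tR r * h) F = DR (1 * tR r) ?G"
    unfolding DR_mult[OF F] by simp
  also have "\<dots> = ?G (tR r) 1"
    unfolding DR_tR_right[OF G] using DR_one[OF G'] by simp
  finally show ?thesis by simp
qed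

text \<open>The images of the base algebras agree crosswise: \<open>tL l\<close> is
  \<open>sR (piR (tL l))\<close>, so rules for \<open>sR\<close> are rules for \<open>tL\<close>.
  The next two lemmas exchange \<open>sL\<close> with \<open>tR\<close> and \<open>sR\<close> with
  \<open>tL\<close> in the same way.\<close>

lemma DR_tL_left: "balR F \<Longrightarrow> DR (tL l * h) F = DR h (\<lambda>x y. F x (tL l * y))"
  using DR_sR_left[of F "piR (tL l)" h] by simp

lemma DR_sL_left: "balR F \<Longrightarrow> DR (sL l * h) F = DR h (\<lambda>x y. F (sL l * x) y)"
  using DR_tR_left[of F "piR (sL l)" h] by simp

lemma DL_sR_left: "balL F \<Longrightarrow> DL (sR r * h) F = DL h (\<lambda>x y. F x (sR r * y))"
  using DL_tL_left[of F "piL (sR r)" h] by simp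

lemma DL_counit_left: "(\<And>x y. f (x + y) = f x + f y) \<Longrightarrow> DL h (\<lambda>x y. f (sL (piL x) * y)) = f h"
  for f :: "'h \<Rightarrow> 'g::ab_group_add"
  using coring.swd_counit_left[OF coring_L, of f h] by (simp add: lactL_def)

lemma DL_counit_right: "(\<And>x y. f (x + y) = f x + f y) \<Longrightarrow> DL h (\<lambda>x y. f (tL (piL y) * x)) = f h"
  for f :: "'h \<Rightarrow> 'g::ab_group_add"
  using coring.swd_counit_right[OF coring_L, of f h] by (simp add: ractL_def)

lemma DR_counit_left: "(\<And>x y. f (x + y) = f x + f y) \<Longrightarrow> DR h (\<lambda>x y. f (y * tR (piR x))) = f h"
  for f :: "'h \<Rightarrow> 'g::ab_group_add"
  using coring.swd_counit_left[OF coring_R, of f h] by (simp add: lactR_def)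

lemma DR_coassoc:
  assumes "\<And>p. balR (\<lambda>m n. F m n p)" "\<And>m. balR (F m)"
  shows "DR h (\<lambda>x y. DR x (\<lambda>x1 x2. F x1 x2 y)) = DR h (\<lambda>x y. DR y (F x))"
  using coring_R assms by (rule coring.swd_coassoc)

lemma D_coassoc_LR:
  assumes "\<And>p. balL (\<lambda>m n. F m n p)" "\<And>m. balR (F m)"
  shows "DR h (\<lambda>x y. DL x (\<lambda>x1 x2. F x1 x2 y)) = DL h (\<lambda>x y. DR y (F x))"
  using coassoc_LR assms by (rule sweedler3_eq)

lemma D_coassoc_RL:
  assumes "\<And>p. balR (\<lambda>m n. F m n p)" "\<And>m. balL (F m)"
  shows "DL h (\<lambda>x y. DR x (\<lambda>x1 x2. F x1 x2 y)) = DR h (\<lambda>x y. DL y (F x))"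
  using coassoc_RL assms by (rule sweedler3_eq)

lemma S_add: "S (x + y) = S x + S y"
  using antipode_linear unfolding k_linear_def by blast

lemma DR_antipode: "DR h (\<lambda>x y. x * S y) = sL (piL h)"
  unfolding swd_def by (rule antipode_right)

lemma S_tR_right: "S (h * tR r) = sR r * S h"
  using antipode_tgtL_tgtR[of 1 h r] by simp

lemma S_one: "S 1 = 1"
proof -
  have "balR (\<lambda>x y. x * S y)"
    by (rule balRI) (simp_all add: distrib_left distrib_right S_add S_tR_right mult.assoc)
  then show ?thesis using DR_one[of "\<lambda>x y. x * S y"] DR_antipode[of 1] by simp
qed

end

section \<open>Sweedler calculus for comodule algebras\<close>

context hopf_comodule_algebra
begin

abbreviation "etaRL l \<equiv> \<eta>R (piR (tL l))"
abbreviation "CR a F \<equiv> swd (\<rho>R a) F"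
abbreviation "CL a F \<equiv> swd (\<rho>L a) F"
abbreviation "balAR F \<equiv> balanced_map UNIV (algR \<eta>R) (lactR HR) F"
abbreviation "balAL F \<equiv> balanced_map UNIV (algL HL HR \<eta>R) (lactL HL) F"

lemma piR_mult_simps [simp]:
  "piR (x * (y * tR r)) = r * piR (x * y)" "piR (x * (y * sR r)) = piR (x * y) * r"
  "piR (x * tL l) = piR x * piR (tL l)"
  using piR_tR_right[of "x * y" r] piR_sR_right[of "x * y" r] piR_sR_right[of x "piR (tL l)"]
  by (simp_all add: mult.assoc)

lemma balAR_iff: "balAR F \<longleftrightarrow> (\<forall>m m' n. F (m + m') n = F m n + F m' n) \<and>
    (\<forall>m n n'. F m (n + n') = F m n + F m n') \<and> (\<forall>m r n. F (m * \<eta>R r) n = F m (n * tR r))"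
  unfolding balanced_map_def algR_def lactR_def by simp

lemma balAL_iff: "balAL F \<longleftrightarrow> (\<forall>m m' n. F (m + m') n = F m n + F m' n) \<and>
    (\<forall>m n n'. F m (n + n') = F m n + F m n') \<and> (\<forall>m l n. F (etaRL l * m) n = F m (sL l * n))"
  unfolding balanced_map_def algL_def lactL_def by simp

lemma balARI:
  "(\<And>m m' n. F (m + m') n = F m n + F m' n) \<Longrightarrow> (\<And>m n n'. F m (n + n') = F m n + F m n') \<Longrightarrow>
    (\<And>m r n. F (m * \<eta>R r) n = F m (n * tR r)) \<Longrightarrow> balAR F"
  unfolding balAR_iff by blast

lemma balALI:
  "(\<And>m m' n. F (m + m') n = F m n + F m' n) \<Longrightarrow> (\<And>m n n'. F m (n + n') = F m n + F m n') \<Longrightarrow>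
    (\<And>m l n. F (etaRL l * m) n = F m (sL l * n)) \<Longrightarrow> balAL F"
  unfolding balAL_iff by blast

lemma balAR_D:
  assumes "balAR F"
  shows "F (m + m') n = F m n + F m' n" "F m (n + n') = F m n + F m n'"
    "F (m * \<eta>R r) n = F m (n * tR r)"
  using assms unfolding balAR_iff by blast+

lemma balAL_D:
  assumes "balAL F"
  shows "F (m + m') n = F m n + F m' n" "F m (n + n') = F m n + F m n'"
    "F (etaRL l * m) n = F m (sL l * n)"
  using assms unfolding balAL_iff by blast+

lemma etaR_simps [simp]:
  "\<eta>R (r + s) = \<eta>R r + \<eta>R s" "\<eta>R (r * s) = \<eta>R r * \<eta>R s" "\<eta>R 1 = 1"
  using unit_map_R unfolding algebra_map_def k_linear_def by simp_all

lemma comodule_AR: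
  "coring_comodule (lactR HR) (ractR HR) (comult HR) (counit HR) (algR \<eta>R) \<rho>R"
  using comodule by (rule hopf_comodule.comodule_R)

lemma comodule_AL:
  "coring_comodule (lactL HL) (ractL HL) (comult HL) (counit HL) (algL HL HR \<eta>R) \<rho>L"
  using comodule by (rule hopf_comodule.comodule_L)

lemma rep_coactR: "tcls UNIV (algR \<eta>R) (lactR HR) (rep (\<rho>R a)) = \<rho>R a"
  using rep_tensor(2)[OF coring_comodule.coact_in[OF comodule_AR]] .

lemma CR_add: "balAR F \<Longrightarrow> CR (a + a') F = CR a F + CR a' F"
  using comodule_AR by (rule coring_comodule.swd_coact_add)

lemma CL_add: "balAL F \<Longrightarrow> CL (a + a') F = CL a F + CL a' F"
  using comodule_AL by (rule coring_comodule.swd_coact_add)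

lemma CR_mult:
  assumes "balAR F"
  shows "CR (a * a') F = CR a (\<lambda>x y. CR a' (\<lambda>x' y'. F (x * x') (y * y')))"
  unfolding coactR_mult
  by (subst swd_tcls[OF _ assms]) (auto simp: swd_def split_def sum_list_bind comp_def)

lemma CL_mult:
  assumes "balAL F"
  shows "CL (a * a') F = CL a (\<lambda>x y. CL a' (\<lambda>x' y'. F (x * x') (y * y')))"
  unfolding coactL_mult
  by (subst swd_tcls[OF _ assms]) (auto simp: swd_def split_def sum_list_bind comp_def)

lemma CR_one: "balAR F \<Longrightarrow> CR 1 F = F 1 1"
  unfolding coactR_one by (subst swd_tcls) auto

lemma CR_etaR_right: "balAR F \<Longrightarrow> CR (a * \<eta>R r) F = CR a (\<lambda>x y. F x (y * sR r))"
  using coring_comodule.swd_coact_linear[OF comodule_AR, of F a r] by (simp add: algR_def ractR_def)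

lemma CR_etaRL_left:
  assumes "balAR F"
  shows "CR (etaRL l * a) F = CR a (\<lambda>x y. F x (tL l * y))"
proof -
  have "CR (algL HL HR \<eta>R a l) F = CR a (\<lambda>x y. F x (ractL HL y l))"
    unfolding hopf_comodule.coactR_L_linear[OF comodule]
    by (subst swd_tcls[OF _ assms]) (auto simp: swd_def split_def sum_list_bind comp_def)
  then show ?thesis by (simp add: algL_def ractL_def)
qed

lemma CL_etaR_right:
  assumes "balAL F"
  shows "CL (a * \<eta>R r) F = CL a (\<lambda>x y. F x (y * sR r))"
proof -
  have "CL (algR \<eta>R a r) F = CL a (\<lambda>x y. F x (ractR HR y r))"
    unfolding hopf_comodule.coactL_R_linear[OF comodule]
    by (subst swd_tcls[OF _ assms]) (auto simp: swd_def split_def sum_list_bind comp_def)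
  then show ?thesis by (simp add: algR_def ractR_def)
qed

lemma CR_coassoc:
  assumes "\<And>p. balAR (\<lambda>m n. F m n p)" "\<And>m. balR (F m)"
  shows "CR a (\<lambda>x y. CR x (\<lambda>x1 x2. F x1 x2 y)) = CR a (\<lambda>x y. DR y (F x))"
  using comodule_AR assms by (rule coring_comodule.swd_coact_coassoc)

lemma CL_coassoc:
  assumes "\<And>p. balAL (\<lambda>m n. F m n p)" "\<And>m. balL (F m)"
  shows "CL a (\<lambda>x y. CL x (\<lambda>x1 x2. F x1 x2 y)) = CL a (\<lambda>x y. DL y (F x))"
  using comodule_AL assms by (rule coring_comodule.swd_coact_coassoc)

lemma C_compat_RL:
  assumes "\<And>p. balAR (\<lambda>m n. F m n p)" "\<And>m. balL (F m)"
  shows "CL a (\<lambda>x y. CR x (\<lambda>x1 x2. F x1 x2 y)) = CR a (\<lambda>x y. DL y (F x))"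
  using hopf_comodule.compatible_RL[OF comodule, symmetric] assms by (rule sweedler3_eq)

lemma C_compat_LR:
  assumes "\<And>p. balAL (\<lambda>m n. F m n p)" "\<And>m. balR (F m)"
  shows "CR a (\<lambda>x y. CL x (\<lambda>x1 x2. F x1 x2 y)) = CL a (\<lambda>x y. DR y (F x))"
  using hopf_comodule.compatible_LR[OF comodule, symmetric] assms by (rule sweedler3_eq)

lemma CR_counit: "(\<And>x y. f (x + y) = f x + f y) \<Longrightarrow> CR a (\<lambda>x y. f (x * \<eta>R (piR y))) = f a"
  for f :: "'a \<Rightarrow> 'g::ab_group_add"
  using coring_comodule.swd_coact_counit[OF comodule_AR, of f a] by (simp add: algR_def)

lemma CL_counit: "(\<And>x y. f (x + y) = f x + f y) \<Longrightarrow> CL a (\<lambda>x y. f (etaRL (piL y) * x)) = f a"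
  for f :: "'a \<Rightarrow> 'g::ab_group_add"
  using coring_comodule.swd_coact_counit[OF comodule_AL, of f a] by (simp add: algL_def)

lemma etaR_mult: "\<eta>R r * a = CR a (\<lambda>x y. x * \<eta>R (piR (sR r * y)))"
  unfolding swd_def by (simp add: left_action_R[of r a] algR_def)

lemma balAR_mult_left: "balAR F \<Longrightarrow> balAR (\<lambda>x y. F (a * x) (h * y))"
  by (rule balARI) (simp_all add: distrib_left balAR_D flip: mult.assoc)

lemma balAL_mult_right: "balAL F \<Longrightarrow> balAL (\<lambda>x y. F (x * a) (y * h))"
  by (rule balALI) (simp_all add: distrib_right balAL_D mult.assoc)

section \<open>The Takeuchi property of the coactions\<close>

text \<open>The left R-action on A is expressed by the coaction in \<open>etaR_mult\<close>.
  Substituting this into the first leg and using coassociativity moves r into the coproduct of the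
  second leg, where \<open>piR_sR_left\<close> turns \<open>sR r\<close> into \<open>tR r\<close>
  and the left counit law finishes.\<close>

lemma CR_takeuchi:
  assumes F: "balAR F"
  shows "CR a (\<lambda>x y. F (\<eta>R r * x) y) = CR a (\<lambda>x y. F x (tR r * y))"
proof -
  let ?G = "\<lambda>u v y. F u (y * tR (piR (sR r * v)))"
  have G1: "balAR (\<lambda>u v. ?G u v p)" for p
    by (rule balARI) (simp_all add: distrib_left balAR_D[OF F] mult.assoc)
  have G2: "balR (?G u)" for u
    by (rule balRI) (simp_all add: distrib_left distrib_right balAR_D[OF F] mult.assoc)
  have hom: "F (\<eta>R r * x) y = CR x (\<lambda>u v. ?G u v y)" for x y
    unfolding etaR_mult[of r x] swd_hom[of "\<lambda>z. F z y", OF balAR_D(1)[OF F]]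
    by (simp add: balAR_D[OF F])
  have "CR a (\<lambda>x y. F (\<eta>R r * x) y) = CR a (\<lambda>x y. DR y (?G x))"
    unfolding hom using G1 G2 by (rule CR_coassoc)
  moreover have "DR y (?G x) = F x (tR r * y)" for x y
  proof -
    have "balR (\<lambda>u v. F x (v * tR (piR u)))"
      by (rule balRI) (simp_all add: distrib_left distrib_right balAR_D[OF F] mult.assoc)
    then have "DR y (\<lambda>u v. F x (v * tR (piR (tR r * u)))) = DR (tR r * y) (\<lambda>u v. F x (v * tR (piR u)))"
      by (simp add: DR_tR_left)
    also have "\<dots> = F x (tR r * y)"
      by (rule DR_counit_left) (simp add: balAR_D[OF F])
    finally show ?thesis by (simp add: piR_sR_left)
  qed
  ultimately show ?thesis by simp
qed

text \<open>As for \<open>\<rho>R\<close>, except that the formula for \<open>x * etaRL l\<close> in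
  terms of the coaction comes from the counit law and the right R-linearity of
  \<open>\<rho>L\<close>, with \<open>sR (piR (tL l))\<close> equal to \<open>tL l\<close>.\<close>

lemma CL_takeuchi:
  assumes F: "balAL F"
  shows "CL a (\<lambda>x y. F (x * etaRL l) y) = CL a (\<lambda>x y. F x (y * sL l))"
proof -
  let ?G = "\<lambda>u v y. F u (sL (piL (v * tL l)) * y)"
  have G1: "balAL (\<lambda>u v. ?G u v p)" for p
    by (rule balALI) (simp_all add: distrib_right balAL_D[OF F] mult.assoc)
  have G2: "balL (?G u)" for u
    by (rule balLI) (simp_all add: distrib_left distrib_right balAL_D[OF F] mult.assoc)
  have hom: "F (x * etaRL l) y = CL x (\<lambda>u v. ?G u v y)" for x y
  proof -
    have "balAL (\<lambda>u v. F (etaRL (piL v) * u) y)"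
      by (rule balALI) (simp_all add: distrib_left distrib_right balAL_D[OF F] mult.assoc)
    then have "CL (x * etaRL l) (\<lambda>u v. F (etaRL (piL v) * u) y) = CL x (\<lambda>u v. F (etaRL (piL (v * tL l)) * u) y)"
      by (simp add: CL_etaR_right)
    then show ?thesis
      using CL_counit[of "\<lambda>z. F z y" "x * etaRL l"] by (simp add: balAL_D[OF F])
  qed
  have "CL a (\<lambda>x y. F (x * etaRL l) y) = CL a (\<lambda>x y. DL y (?G x))"
    unfolding hom using G1 G2 by (rule CL_coassoc)
  moreover have "DL y (?G x) = F x (y * sL l)" for x y
  proof -
    have "balL (\<lambda>u v. F x (sL (piL u) * v))"
      by (rule balLI) (simp_all add: distrib_left distrib_right balAL_D[OF F] mult.assoc)
    then have "DL y (\<lambda>u v. F x (sL (piL (u * sL l)) * v)) = DL (y * sL l) (\<lambda>u v. F x (sL (piL u) * v))"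
      by (simp add: DL_sL_right)
    also have "\<dots> = F x (y * sL l)"
      by (rule DL_counit_left) (simp add: balAL_D[OF F])
    finally show ?thesis by (simp add: piL_tL_right)
  qed
  ultimately show ?thesis by simp
qed

lemma balAR_coact_right:
  assumes F: "balAR F"
  shows "balAR (\<lambda>x y. CR a (\<lambda>x' y'. F (x * x') (y * y')))"
proof (rule balARI)
  fix m r n
  from CR_takeuchi[OF balAR_mult_left[OF F, of m n], where a = a and r = r]
  show "CR a (\<lambda>x' y'. F (m * \<eta>R r * x') (n * y')) = CR a (\<lambda>x' y'. F (m * x') (n * tR r * y'))"
    by (simp add: mult.assoc)
qed (simp_all add: distrib_right balAR_D[OF F] swd_add)

lemma balAL_coact_left:
  assumes F: "balAL F"
  shows "balAL (\<lambda>x' y'. CL a (\<lambda>x y. F (x * x') (y * y')))"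
proof (rule balALI)
  fix m l n
  from CL_takeuchi[OF balAL_mult_right[OF F, of m n], where a = a and l = l]
  show "CL a (\<lambda>x y. F (x * (etaRL l * m)) (y * n)) = CL a (\<lambda>x y. F (x * m) (y * (sL l * n)))"
    by (simp add: mult.assoc)
qed (simp_all add: distrib_left balAL_D[OF F] swd_add)

lemma CR_etaR_left:
  assumes F: "balAR F"
  shows "CR (\<eta>R r * a) F = CR a (\<lambda>x y. F x (sR r * y))"
proof -
  let ?G = "\<lambda>x y. CR a (\<lambda>x' y'. F (x * x') (y * y'))"
  have G: "balAR ?G" using F by (rule balAR_coact_right)
  have G': "balAR (\<lambda>x y. ?G x (y * sR r))"
  proof (rule balARI)
    fix m s n
    have "n * sR r * tR s = n * tR s * sR r" by (simp add: sR_tR_commute mult.assoc)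
    then show "?G (m * \<eta>R s) (n * sR r) = ?G m (n * tR s * sR r)"
      using balAR_D(3)[OF G, of m s "n * sR r"] by simp
  qed (use balAR_D(1,2)[OF G] in \<open>simp_all add: distrib_right\<close>)
  have "CR (\<eta>R r * a) F = CR (1 * \<eta>R r) ?G"
    unfolding CR_mult[OF F] by simp
  also have "\<dots> = ?G 1 (sR r)"
    unfolding CR_etaR_right[OF G] using CR_one[OF G'] by simp
  finally show ?thesis by simp
qed

section \<open>Coinvariants of both coactions\<close>

lemma coinvariants_CR:
  "b \<in> coinvariants HR \<eta>R \<rho>R \<Longrightarrow> balAR F \<Longrightarrow> CR b F = F b 1"
  unfolding coinvariants_def by (simp add: swd_tcls)

lemma coinvariantsI:
  assumes "\<And>F :: 'a \<Rightarrow> 'h \<Rightarrow> rat_mod_int. balAR F \<Longrightarrow> CR b F = F b 1"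
  shows "b \<in> coinvariants HR \<eta>R \<rho>R"
proof -
  have "tcls UNIV (algR \<eta>R) (lactR HR) (rep (\<rho>R b)) = tcls UNIV (algR \<eta>R) (lactR HR) [(b, 1)]"
    using assms by (intro tcls_eqI) (auto simp: swd_def)
  then show ?thesis unfolding coinvariants_def rep_coactR by simp
qed

text \<open>The left R-action is read off the coaction, which on b is trivial. This is what lets
  scalars from R pass through B in later balancedness checks.\<close>

lemma coinvariants_etaR_commute:
  assumes b: "b \<in> coinvariants HR \<eta>R \<rho>R"
  shows "\<eta>R r * b = b * \<eta>R r"
proof -
  have "balAR (\<lambda>x y. x * \<eta>R (piR (sR r * y)))"
    by (rule balARI) (simp_all add: distrib_left distrib_right mult.assoc)
  from coinvariants_CR[OF b this] show ?thesis by (simp add: etaR_mult[of r b])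
qed

lemma CR_coinvariant_left:
  assumes b: "b \<in> coinvariants HR \<eta>R \<rho>R" and F: "balAR F"
  shows "CR (b * a) F = CR a (\<lambda>x y. F (b * x) y)"
  unfolding CR_mult[OF F] using coinvariants_CR[OF b balAR_coact_right[OF F]] by simp

lemma CR_coinvariant_right:
  assumes b: "b \<in> coinvariants HR \<eta>R \<rho>R" and F: "balAR F"
  shows "CR (a * b) F = CR a (\<lambda>x y. F (x * b) y)"
  unfolding CR_mult[OF F] using coinvariants_CR[OF b balAR_mult_left[OF F]] by simp

text \<open>
  \<open>b\<^bsub>[0]\<^esub> \<otimes> b\<^bsub>[1]\<^esub>\<^sup>(\<^sup>1\<^sup>) S(b\<^bsub>[1]\<^esub>\<^sup>(\<^sup>2\<^sup>))\<close> equals \<open>b\<^bsub>[0]\<^esub> \<otimes> s\<^sub>L\<pi>\<^sub>L(b\<^bsub>[1]\<^esub>) = b \<otimes> 1\<close> by the antipode axiom and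
  \<open>\<rho>\<^sub>L(b)\<close> by compatibility of the coactions.
\<close>

lemma coinvariants_CL:
  assumes b: "b \<in> coinvariants HR \<eta>R \<rho>R" and F: "balAL F"
  shows "CL b F = F b 1"
proof -
  have bal: "balAL (\<lambda>x y. F x (y * z))" for z
    using balAL_mult_right[OF F, of 1 z] by simp
  have "CR b (\<lambda>x z. CL x (\<lambda>x1 x2. F x1 (x2 * S z))) = CL b (\<lambda>x y. DR y (\<lambda>y z. F x (y * S z)))"
  proof (rule C_compat_LR)
    show "balR (\<lambda>y z. F x (y * S z))" for x
      by (rule balRI) (simp_all add: distrib_left distrib_right S_add S_tR_right mult.assoc balAL_D[OF F])
  qed (rule bal)
  moreover have "DR y (\<lambda>y z. F x (y * S z)) = F (etaRL (piL y) * x) 1" for x y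
    using swd_hom[of "F x" "comult HR y" "\<lambda>y z. y * S z", symmetric]
    by (simp add: balAL_D[OF F] DR_antipode)
  moreover have "CL b (\<lambda>x y. F (etaRL (piL y) * x) 1) = F b 1"
    by (rule CL_counit) (simp add: distrib_left balAL_D(1)[OF F])
  \<comment> \<open>The same sum read through the trivial \<open>\<rho>R\<close>-coaction of b, with
    S(1) = 1.\<close>
  moreover have "CR b (\<lambda>x z. CL x (\<lambda>x1 x2. F x1 (x2 * S z))) = CL b (\<lambda>x1 x2. F x1 (x2 * S 1))"
  proof (rule coinvariants_CR[OF b])
    show "balAR (\<lambda>x z. CL x (\<lambda>x1 x2. F x1 (x2 * S z)))"
    proof (rule balARI)
      fix m r n
      show "CL (m * \<eta>R r) (\<lambda>x1 x2. F x1 (x2 * S n)) = CL m (\<lambda>x1 x2. F x1 (x2 * S (n * tR r)))"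
        by (simp add: CL_etaR_right[OF bal] S_tR_right mult.assoc)
    qed (simp_all add: CL_add[OF bal] distrib_left S_add swd_add balAL_D[OF F])
  qed
  ultimately show ?thesis by (simp add: S_one)
qed

lemma CL_coinvariant_left:
  assumes b: "b \<in> coinvariants HR \<eta>R \<rho>R" and F: "balAL F"
  shows "CL (b * a) F = CL a (\<lambda>x y. F (b * x) y)"
  unfolding CL_mult[OF F] swd_swap[of "\<rho>L b"] using coinvariants_CL[OF b balAL_mult_right[OF F]] by simp

lemma CL_coinvariant_right:
  assumes b: "b \<in> coinvariants HR \<eta>R \<rho>R" and F: "balAL F"
  shows "CL (a * b) F = CL a (\<lambda>x y. F (x * b) y)"
  unfolding CL_mult[OF F] swd_swap[of "\<rho>L a"] using coinvariants_CL[OF b balAL_coact_left[OF F]] by simp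

lemma coinvariants_closed:
  "1 \<in> coinvariants HR \<eta>R \<rho>R" "0 \<in> coinvariants HR \<eta>R \<rho>R"
  "b \<in> coinvariants HR \<eta>R \<rho>R \<Longrightarrow> b' \<in> coinvariants HR \<eta>R \<rho>R \<Longrightarrow> b + b' \<in> coinvariants HR \<eta>R \<rho>R"
  "b \<in> coinvariants HR \<eta>R \<rho>R \<Longrightarrow> b' \<in> coinvariants HR \<eta>R \<rho>R \<Longrightarrow> b * b' \<in> coinvariants HR \<eta>R \<rho>R"
  "b \<in> coinvariants HR \<eta>R \<rho>R \<Longrightarrow> - b \<in> coinvariants HR \<eta>R \<rho>R"
proof -
  show "1 \<in> coinvariants HR \<eta>R \<rho>R" by (rule coinvariantsI) (rule CR_one)
  have zero: "CR 0 F = 0 \<and> F 0 1 = 0" if "balAR F" for F :: "'a \<Rightarrow> 'h \<Rightarrow> rat_mod_int"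
    using CR_add[OF that, of 0 0] balAR_D(1)[OF that, of 0 0 1] by simp
  then show "0 \<in> coinvariants HR \<eta>R \<rho>R" by (intro coinvariantsI) simp
  assume b: "b \<in> coinvariants HR \<eta>R \<rho>R"
  show "- b \<in> coinvariants HR \<eta>R \<rho>R"
  proof (rule coinvariantsI)
    fix F :: "'a \<Rightarrow> 'h \<Rightarrow> rat_mod_int" assume F: "balAR F"
    have "CR b F + CR (- b) F = 0" "F b 1 + F (- b) 1 = 0"
      using CR_add[OF F, of b "- b"] balAR_D(1)[OF F, of b "- b" 1] zero[OF F] by simp_all
    then show "CR (- b) F = F (- b) 1"
      using coinvariants_CR[OF b F] by (metis add_left_cancel)
  qed
  assume b': "b' \<in> coinvariants HR \<eta>R \<rho>R"
  show "b + b' \<in> coinvariants HR \<eta>R \<rho>R"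
    by (rule coinvariantsI) (simp add: CR_add coinvariants_CR[OF b] coinvariants_CR[OF b'] balAR_D)
  show "b * b' \<in> coinvariants HR \<eta>R \<rho>R"
  proof (rule coinvariantsI)
    fix F :: "'a \<Rightarrow> 'h \<Rightarrow> rat_mod_int" assume F: "balAR F"
    show "CR (b * b') F = F (b * b') 1"
      using coinvariants_CR[OF b' balAR_mult_left[OF F, of b 1]] by (simp add: CR_coinvariant_left[OF b F])
  qed
qed

end

section \<open>Cleaving maps\<close>

locale cleaving = cleft_extension scH scL scR HL HR S scA \<eta>R \<rho>R \<rho>L B \<eta>L
  for scH :: "'k::{comm_ring,comm_monoid_mult} \<Rightarrow> 'h::{ring,monoid_mult} \<Rightarrow> 'h"
    and scL :: "'k \<Rightarrow> 'l::{ring,monoid_mult} \<Rightarrow> 'l"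
    and scR :: "'k \<Rightarrow> 'r::{ring,monoid_mult} \<Rightarrow> 'r"
    and HL :: "('l, 'h) bialgebroid_data"
    and HR :: "('r, 'h) bialgebroid_data"
    and S :: "'h \<Rightarrow> 'h"
    and scA :: "'k \<Rightarrow> 'a::{ring,monoid_mult} \<Rightarrow> 'a"
    and \<eta>R :: "'r \<Rightarrow> 'a"
    and \<rho>R \<rho>L :: "'a \<Rightarrow> ('a \<times> 'h) list set"
    and B :: "'a set"
    and \<eta>L :: "'l \<Rightarrow> 'a" +
  fixes j jc :: "'h \<Rightarrow> 'a"
  assumes cleaving_map_j: "cleaving_map scH HL HR scA \<eta>R \<rho>R \<rho>L \<eta>L j"
    and jc_linear: "k_linear scH scA jc"
    and jc_base: "jc (tgt HL l * h * tgt HR r) = \<eta>R r * jc h * \<eta>L l"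
    and j_conv_jc: "swd (comult HR h) (\<lambda>x y. j x * jc y) = \<eta>L (counit HL h)"
    and jc_conv_j: "swd (comult HL h) (\<lambda>x y. jc x * j y) = \<eta>R (counit HR h)"
begin

lemma etaL_simps [simp]:
  "\<eta>L (l + l') = \<eta>L l + \<eta>L l'" "\<eta>L (l * l') = \<eta>L l * \<eta>L l'" "\<eta>L 1 = 1"
  using unit_map_L unfolding algebra_map_def k_linear_def by simp_all

lemma etaL_in_B [simp]: "\<eta>L l \<in> B"
  using unit_map_L_in by blast

lemma B_closed [simp]:
  "1 \<in> B" "0 \<in> B" "b \<in> B \<Longrightarrow> b' \<in> B \<Longrightarrow> b + b' \<in> B" "b \<in> B \<Longrightarrow> b' \<in> B \<Longrightarrow> b * b' \<in> B"
  "b \<in> B \<Longrightarrow> - b \<in> B"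
  unfolding B_coinvariants by (simp_all add: coinvariants_closed)

lemma B_etaR_commute: "b \<in> B \<Longrightarrow> \<eta>R r * b = b * \<eta>R r"
  unfolding B_coinvariants by (rule coinvariants_etaR_commute)

lemma B_etaR_commute': "b \<in> B \<Longrightarrow> \<eta>R r * (b * a) = b * (\<eta>R r * a)"
  by (simp add: B_etaR_commute flip: mult.assoc)

lemmas CR_B = coinvariants_CR[folded B_coinvariants]
lemmas CR_B_left = CR_coinvariant_left[folded B_coinvariants]
lemmas CR_B_right = CR_coinvariant_right[folded B_coinvariants]
lemmas CL_B_left = CL_coinvariant_left[folded B_coinvariants]
lemmas CL_B_right = CL_coinvariant_right[folded B_coinvariants]
lemmas in_BI = coinvariantsI[folded B_coinvariants]

text \<open>Scalars act through the image of L, so compatibility with them follows from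
  L-linearity.\<close>

lemma scA_eq: "scA c a = \<eta>L (scL c 1) * a"
proof -
  have "\<eta>L (scL c 1) = scA c (\<eta>L 1)"
    using unit_map_L unfolding algebra_map_def k_linear_def by blast
  then show ?thesis using k_algebra.scale_mult_left[OF algebra_A, of c 1 a] by simp
qed

lemma scA_mult_right: "x * scA c y = scA c (x * y)"
  using k_algebra.scale_mult_right[OF algebra_A, of c x y] by simp

lemma scH_eq: "scH c h = sL (scL c 1) * h" "scH c h = tL (scL c 1) * h"
  using k_algebra.scale_mult_left[OF left_bialgebroid.algebra_H[OF left_bialgebroid], of c 1 h]
  by (simp_all add: src_tgt_scale)

lemma j_add [simp]: "j (x + y) = j x + j y"
  using cleaving_map.j_linear[OF cleaving_map_j] unfolding k_linear_def by blast

lemma jc_add [simp]: "jc (x + y) = jc x + jc y"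
  using jc_linear unfolding k_linear_def by blast

lemma j_sL_left [simp]: "j (sL l * h) = \<eta>L l * j h"
  using cleaving_map_j by (rule cleaving_map.j_left_L_linear)

lemma j_tL_left [simp]: "j (tL l * h) = etaRL l * j h"
  using cleaving_map.j_right_L_linear[OF cleaving_map_j] by (simp add: ractL_def algL_def)

lemma j_sR_right [simp]: "j (h * sR r) = j h * \<eta>R r"
  using cleaving_map.j_right_R_linear[OF cleaving_map_j] by (simp add: ractR_def algR_def)

lemma j_sR_left [simp]: "j (sR r * h) = \<eta>R r * j h"
  using j_tL_left[of "piL (sR r)" h] by simp

lemma j_sR_right_assoc [simp]: "j (x * (h * sR r)) = j (x * h) * \<eta>R r"
  using j_sR_right[of "x * h"] by (simp add: mult.assoc)

lemma jc_tL_left [simp]: "jc (tL l * h) = jc h * \<eta>L l"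
  using jc_base[of l h 1] by simp

lemma jc_tR_right [simp]: "jc (h * tR r) = \<eta>R r * jc h"
  using jc_base[of 1 h r] by simp

lemma jc_tR_right_assoc [simp]: "jc (x * (h * tR r)) = \<eta>R r * jc (x * h)"
  using jc_tR_right[of "x * h"] by (simp add: mult.assoc)

lemma CR_j:
  assumes F: "balAR F"
  shows "CR (j h) F = DR h (\<lambda>x y. F (j x) y)"
  unfolding cleaving_map.j_colinear_R[OF cleaving_map_j]
  by (subst swd_tcls[OF _ F]) (auto simp: swd_def split_def sum_list_bind comp_def)

lemma CL_j:
  assumes F: "balAL F"
  shows "CL (j h) F = DL h (\<lambda>x y. F (j x) y)"
  unfolding cleaving_map.j_colinear_L[OF cleaving_map_j]
  by (subst swd_tcls[OF _ F]) (auto simp: swd_def split_def sum_list_bind comp_def)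

lemma balR_j: "balAR F \<Longrightarrow> balR (\<lambda>x y. F (j x) y)"
  by (rule balRI) (simp_all add: balAR_D)

lemma jc_counit: "DL h (\<lambda>x y. jc x * \<eta>L (piL y)) = jc h"
  using DL_counit_right[of jc h] by simp

lemma etaR_jc_counit: "DR h (\<lambda>x y. \<eta>R (piR x) * jc y) = jc h"
  using DR_counit_left[of jc h] by simp

text \<open>The axioms for \<open>jc\<close> only cover \<open>tL\<close> on the left and
  \<open>tR\<close> on the right. As in the uniqueness proof for inverses, \<open>jc\<close> is
  written as the convolution of \<open>jc\<close>, \<open>j\<close> and \<open>jc\<close>; the
  factor \<open>\<eta>R r\<close> enters next to \<open>j\<close>, and after regrouping it has to
  pass only \<open>\<eta>L (piL y)\<close>, which lies in B. This linearity is what later makes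
  \<open>jconv k\<close> right R-linear.\<close>

lemma jc_tR_left [simp]: "jc (tR r * h) = jc h * \<eta>R r"
proof -
  have bal: "balL (\<lambda>x y. jc x * j y)"
    by (rule balLI) (simp_all add: distrib_left distrib_right mult.assoc)
  have bal': "balR (\<lambda>x y. \<eta>R (piR x) * jc y)"
    by (rule balRI) (simp_all add: distrib_left distrib_right mult.assoc)
  have piR: "\<eta>R (piR (tR r * x)) = DL x (\<lambda>x1 x2. jc x1 * (\<eta>R r * j x2))" for x
    using jc_conv_j[of "sR r * x"] DL_sR_left[OF bal, of r x] by (simp add: piR_sR_left)
  have "jc (tR r * h) = DR h (\<lambda>x y. \<eta>R (piR (tR r * x)) * jc y)"
    using etaR_jc_counit[of "tR r * h"] DR_tR_left[OF bal', of r h] by simp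
  also have "\<dots> = DR h (\<lambda>x y. DL x (\<lambda>x1 x2. jc x1 * (\<eta>R r * (j x2 * jc y))))"
    unfolding piR swd_mult_right[symmetric] by (simp add: mult.assoc)
  also have "\<dots> = DL h (\<lambda>x y. DR y (\<lambda>p q. jc x * (\<eta>R r * (j p * jc q))))"
  proof (rule D_coassoc_LR)
    show "balL (\<lambda>m n. jc m * (\<eta>R r * (j n * jc p)))" for p
      by (rule balLI) (simp_all add: distrib_left distrib_right mult.assoc B_etaR_commute')
    show "balR (\<lambda>p q. jc m * (\<eta>R r * (j p * jc q)))" for m
      by (rule balRI) (simp_all add: distrib_left distrib_right mult.assoc)
  qed
  also have "\<dots> = DL h (\<lambda>x y. jc x * \<eta>L (piL y) * \<eta>R r)"
    unfolding swd_mult_left j_conv_jc by (simp add: B_etaR_commute mult.assoc)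
  also have "\<dots> = jc h * \<eta>R r"
    unfolding swd_mult_right jc_counit ..
  finally show ?thesis .
qed

text \<open>
  In Sweedler notation, \<open>h\<^sup>(\<^sup>1\<^sup>) \<rho>\<^sub>R(jc(h\<^sup>(\<^sup>2\<^sup>))) = jc(h) \<otimes> 1\<close>.  It follows by applying \<open>\<rho>\<^sub>R\<close> to the
  convolution identities, without reference to the antipode.
\<close>

lemma CR_jc:
  assumes F: "balAR F"
  shows "DR h (\<lambda>x y. CR (jc y) (\<lambda>u v. F u (x * v))) = F (jc h) 1"
proof -
  have F1: "balAR (\<lambda>u v. F (a * u) (g * v))" for a g
    using F by (rule balAR_mult_left)
  have F2: "balAR (\<lambda>u v. CR (jc q) (\<lambda>u' v'. F (a * (u * u')) (v * v')))" for a q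
    using balAR_coact_right[OF F1[of a 1]] by simp
  have F3: "balR (\<lambda>g q. CR (jc q) (\<lambda>u v. F (a * u) (g * v)))" for a
  proof (rule balRI)
    fix m r n
    show "CR (jc n) (\<lambda>u v. F (a * u) (m * sR r * v)) = CR (jc (n * tR r)) (\<lambda>u v. F (a * u) (m * v))"
      by (simp add: CR_etaR_left[OF F1] mult.assoc)
  qed (simp_all add: distrib_right balAR_D[OF F] CR_add[OF F1] swd_add)
  have F4: "balR (\<lambda>p g. CR c (\<lambda>u v. F (a * (j p * u)) (g * v)))" for a c
  proof (rule balRI)
    fix m r n
    show "CR c (\<lambda>u v. F (a * (j (m * sR r) * u)) (n * v)) = CR c (\<lambda>u v. F (a * (j m * u)) (n * tR r * v))"
      using CR_takeuchi[OF F1[of "a * j m" n], where a = c and r = r] by (simp add: mult.assoc)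
  qed (simp_all add: distrib_left distrib_right balAR_D[OF F] swd_add)
  have F5: "CR c (\<lambda>u v. F (a * (\<eta>R r * u)) (g * v)) = CR c (\<lambda>u v. F (a * u) (g * (tR r * v)))" for a c r g
    using CR_takeuchi[OF F1] .
  let ?G = "\<lambda>a g q. CR (jc q) (\<lambda>u v. F (a * u) (g * v))"
  \<comment> \<open>\<open>\<eta>L (piL y)\<close> is coinvariant and is also the convolution of
    \<open>j\<close> with \<open>jc\<close>; expanding the coaction of the second form brings in
    those of \<open>j\<close> and \<open>jc\<close>.\<close>
  have step: "F (jc x * \<eta>L (piL y)) 1 = DR y (\<lambda>p q. DR q (\<lambda>q1 q2. ?G (jc x * j p) q1 q2))" for x y
  proof -
    have "F (jc x * \<eta>L (piL y)) 1 = CR (\<eta>L (piL y)) (\<lambda>u v. F (jc x * u) v)"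
      using CR_B[OF etaL_in_B F1[of "jc x" 1], of "piL y"] by simp
    also have "\<dots> = DR y (\<lambda>p q. CR (j p * jc q) (\<lambda>u v. F (jc x * u) v))"
      unfolding j_conv_jc[symmetric]
      by (rule swd_hom) (use CR_add[OF F1[of "jc x" 1]] in simp)
    also have "\<dots> = DR y (\<lambda>p q. DR p (\<lambda>p1 p2. CR (jc q) (\<lambda>u v. F (jc x * (j p1 * u)) (p2 * v))))"
      using CR_mult[OF F1[of "jc x" 1]] by (simp add: CR_j[OF F2])
    also have "\<dots> = DR y (\<lambda>p q. DR q (\<lambda>q1 q2. CR (jc q2) (\<lambda>u v. F (jc x * (j p * u)) (q1 * v))))"
      using F4 F3[of "jc x * j _"] by (intro DR_coassoc) (simp_all add: mult.assoc)
    finally show ?thesis by (simp add: mult.assoc)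
  qed
  have "F (jc h) 1 = DL h (\<lambda>x y. F (jc x * \<eta>L (piL y)) 1)"
    using swd_hom[of "\<lambda>z. F z 1" "comult HL h" "\<lambda>x y. jc x * \<eta>L (piL y)"]
    by (simp add: jc_counit balAR_D[OF F])
  also have "\<dots> = DL h (\<lambda>x y. DR y (\<lambda>p q. DR q (\<lambda>q1 q2. ?G (jc x * j p) q1 q2)))"
    unfolding step ..
  \<comment> \<open>Mixed coassociativity puts \<open>jc x1\<close> next to \<open>j x2\<close>, and
    the pair collapses to \<open>\<eta>R (piR x)\<close>.\<close>
  also have "\<dots> = DR h (\<lambda>x y. DL x (\<lambda>x1 x2. DR y (\<lambda>q1 q2. ?G (jc x1 * j x2) q1 q2)))"
  proof (rule D_coassoc_LR[symmetric])
    show "balL (\<lambda>m n. DR p (\<lambda>q1 q2. ?G (jc m * j n) q1 q2))" for p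
      by (rule balLI) (simp_all add: distrib_left distrib_right balAR_D[OF F] swd_add mult.assoc)
    show "balR (\<lambda>n p. DR p (\<lambda>q1 q2. ?G (jc m * j n) q1 q2))" for m
    proof (rule balRI)
      fix n r p
      show "DR p (\<lambda>q1 q2. ?G (jc m * j (n * sR r)) q1 q2) = DR (p * tR r) (\<lambda>q1 q2. ?G (jc m * j n) q1 q2)"
        using F5[of _ "jc m * j n" r] DR_tR_right[OF F3[of "jc m * j n"], of p r]
        by (simp add: mult.assoc)
    qed (simp_all add: distrib_left distrib_right balAR_D[OF F] swd_add DR_add[OF F3])
  qed
  also have "\<dots> = DR h (\<lambda>x y. DR y (\<lambda>q1 q2. ?G (\<eta>R (piR x)) q1 q2))"
  proof (rule swd_cong)
    fix x y
    show "DL x (\<lambda>x1 x2. DR y (\<lambda>q1 q2. ?G (jc x1 * j x2) q1 q2)) = DR y (\<lambda>q1 q2. ?G (\<eta>R (piR x)) q1 q2)"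
      unfolding jc_conv_j[symmetric]
      by (rule swd_hom[symmetric]) (simp add: distrib_right balAR_D[OF F] swd_add)
  qed
  \<comment> \<open>The scalar crosses the coaction by \<open>F5\<close> to the other leg, where the
    left counit law absorbs it.\<close>
  also have "\<dots> = DR h (\<lambda>x y. DR y (\<lambda>q1 q2. ?G 1 (q1 * tR (piR x)) q2))"
    using F5[of _ 1] by (simp add: mult.assoc)
  also have "\<dots> = DR h (\<lambda>x y. DR x (\<lambda>x1 x2. ?G 1 (x2 * tR (piR x1)) y))"
  proof (rule DR_coassoc[symmetric])
    show "balR (\<lambda>m n. ?G 1 (n * tR (piR m)) p)" for p
      by (rule balRI) (simp_all add: distrib_left distrib_right balAR_D[OF F] swd_add mult.assoc)
    show "balR (\<lambda>n p. ?G 1 (n * tR (piR m)) p)" for m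
      using balR_base_right[OF F3[of 1], where r = "piR m" and r' = 1] by simp
  qed
  also have "\<dots> = DR h (\<lambda>x y. ?G 1 x y)"
  proof (rule swd_cong)
    fix x y
    show "DR x (\<lambda>x1 x2. ?G 1 (x2 * tR (piR x1)) y) = ?G 1 x y"
      by (rule DR_counit_left) (simp add: distrib_right balAR_D[OF F] swd_add)
  qed
  finally show ?thesis by simp
qed

lemma coactR_eqI:
  assumes "\<And>F :: 'a \<Rightarrow> 'h \<Rightarrow> rat_mod_int. balAR F \<Longrightarrow> CR a F = (\<Sum>(x, y)\<leftarrow>xs. F x y)"
  shows "\<rho>R a = tcls UNIV (algR \<eta>R) (lactR HR) xs"
proof -
  have "tcls UNIV (algR \<eta>R) (lactR HR) (rep (\<rho>R a)) = tcls UNIV (algR \<eta>R) (lactR HR) xs"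
    using assms by (intro tcls_eqI) (auto simp: swd_def)
  then show ?thesis
    by (simp add: rep_tensor(2)[OF coring_comodule.coact_in[OF comodule_AR]])
qed

lemma coactL_eqI:
  assumes "\<And>F :: 'a \<Rightarrow> 'h \<Rightarrow> rat_mod_int. balAL F \<Longrightarrow> CL a F = (\<Sum>(x, y)\<leftarrow>xs. F x y)"
  shows "\<rho>L a = tcls UNIV (algL HL HR \<eta>R) (lactL HL) xs"
proof -
  have "tcls UNIV (algL HL HR \<eta>R) (lactL HL) (rep (\<rho>L a)) = tcls UNIV (algL HL HR \<eta>R) (lactL HL) xs"
    using assms by (intro tcls_eqI) (auto simp: swd_def)
  then show ?thesis
    by (simp add: rep_tensor(2)[OF coring_comodule.coact_in[OF comodule_AL]])
qed

text \<open>
  Multiplying \<open>j\<close> from the right by the inverse \<open>jc(1)\<close> of \<open>j(1)\<close> preserves left \<open>L\<close>-linearity, which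
  multiplication from the left would not.
\<close>

lemma normalised:
  "\<exists>j' jc'. cleaving scH scL scR HL HR S scA \<eta>R \<rho>R \<rho>L B \<eta>L j' jc' \<and> j' 1 = 1"
proof (intro exI conjI)
  have balj: "balR (\<lambda>x y. j x * jc y)"
    by (rule balRI) (simp_all add: distrib_left distrib_right mult.assoc)
  have baljc: "balL (\<lambda>x y. jc x * j y)"
    by (rule balLI) (simp_all add: distrib_left distrib_right mult.assoc)
  have inv: "j 1 * jc 1 = 1" "jc 1 * j 1 = 1"
    using j_conv_jc[of 1] DR_one[OF balj] jc_conv_j[of 1] DL_one[OF baljc] by simp_all
  have j1: "j 1 \<in> B"
    by (rule in_BI) (simp add: CR_j DR_one balR_j)
  have jc1: "jc 1 \<in> B"
  proof (rule in_BI)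
    fix F :: "'a \<Rightarrow> 'h \<Rightarrow> rat_mod_int" assume F: "balAR F"
    have F': "balAR (\<lambda>x y. F (jc 1 * x) y)" using balAR_mult_left[OF F, of "jc 1" 1] by simp
    \<comment> \<open>Putting the coinvariant \<open>j 1\<close> in front is undone by the
      \<open>jc 1\<close> inside F, and leaves the coaction of 1.\<close>
    have "CR (jc 1) F = CR (j 1 * jc 1) (\<lambda>x y. F (jc 1 * x) y)"
      unfolding CR_B_left[OF j1 F'] by (simp add: inv flip: mult.assoc)
    also have "\<dots> = F (jc 1) 1" unfolding inv CR_one[OF F'] by simp
    finally show "CR (jc 1) F = F (jc 1) 1" .
  qed
  let ?j = "\<lambda>h. j h * jc 1" and ?jc = "\<lambda>h. j 1 * jc h"
  have lin: "k_linear scH scA ?j" "k_linear scH scA ?jc"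
    using cleaving_map.j_linear[OF cleaving_map_j] jc_linear
    unfolding k_linear_def
    by (simp_all add: distrib_left distrib_right scA_mult_right k_algebra.scale_mult_left[OF algebra_A])
  have base: "?jc (tL l * h * tR r) = \<eta>R r * ?jc h * \<eta>L l" for l h r
    by (simp add: jc_base B_etaR_commute'[OF j1] mult.assoc)
  have conv: "DR h (\<lambda>x y. ?j x * ?jc y) = \<eta>L (piL h)" "DL h (\<lambda>x y. ?jc x * ?j y) = \<eta>R (piR h)" for h
  proof -
    have "?j x * ?jc y = j x * jc y" for x y
      using inv(2) by (metis mult.assoc mult_1)
    then show "DR h (\<lambda>x y. ?j x * ?jc y) = \<eta>L (piL h)" by (simp add: j_conv_jc)
    \<comment> \<open>The outer factors conjugate \<open>\<eta>R (piR h)\<close> by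
      \<open>j 1\<close>, which commutes with it because \<open>j 1\<close> lies in B.\<close>
    have "DL h (\<lambda>x y. ?jc x * ?j y) = j 1 * DL h (\<lambda>x y. jc x * j y) * jc 1"
      by (simp add: mult.assoc flip: swd_mult_left swd_mult_right)
    then show "DL h (\<lambda>x y. ?jc x * ?j y) = \<eta>R (piR h)"
      using B_etaR_commute[OF j1, symmetric] by (simp add: jc_conv_j mult.assoc inv)
  qed
  have "cleaving_map scH HL HR scA \<eta>R \<rho>R \<rho>L \<eta>L ?j"
  proof
    show "k_linear scH scA ?j" by (rule lin)
    show "?j (sL l * h) = \<eta>L l * ?j h" for l h by (simp add: mult.assoc)
    show "?j (ractR HR h r) = algR \<eta>R (?j h) r" for h r
      by (simp add: ractR_def algR_def mult.assoc B_etaR_commute[OF jc1])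
    show "?j (ractL HL h l) = algL HL HR \<eta>R (?j h) l" for h l
      by (simp add: ractL_def algL_def mult.assoc)
    show "\<rho>R (?j h) = tcls UNIV (algR \<eta>R) (lactR HR) [(?j x, y). (x, y) \<leftarrow> rep (comult HR h)]" for h
    proof (rule coactR_eqI)
      fix F :: "'a \<Rightarrow> 'h \<Rightarrow> rat_mod_int" assume F: "balAR F"
      have "balAR (\<lambda>x y. F (x * jc 1) y)"
        by (rule balARI)
          (simp_all add: distrib_left distrib_right balAR_D[OF F] mult.assoc B_etaR_commute[OF jc1],
            simp_all add: balAR_D[OF F] flip: mult.assoc)
      from CR_j[OF this] show "CR (?j h) F = (\<Sum>(x, y)\<leftarrow>[(?j x, y). (x, y) \<leftarrow> rep (comult HR h)]. F x y)"
        unfolding CR_B_right[OF jc1 F] by (simp add: swd_def split_def comp_def sum_list_bind)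
    qed
    show "\<rho>L (?j h) = tcls UNIV (algL HL HR \<eta>R) (lactL HL) [(?j x, y). (x, y) \<leftarrow> rep (comult HL h)]" for h
    proof (rule coactL_eqI)
      fix F :: "'a \<Rightarrow> 'h \<Rightarrow> rat_mod_int" assume F: "balAL F"
      have "balAL (\<lambda>x y. F (x * jc 1) y)"
        using balAL_mult_right[OF F, of "jc 1" 1] by simp
      from CL_j[OF this] show "CL (?j h) F = (\<Sum>(x, y)\<leftarrow>[(?j x, y). (x, y) \<leftarrow> rep (comult HL h)]. F x y)"
        unfolding CL_B_right[OF jc1 F] by (simp add: swd_def split_def comp_def sum_list_bind)
    qed
    show "\<exists>jc. k_linear scH scA jc \<and>
        (\<forall>l h r. jc (tL l * h * tR r) = \<eta>R r * jc h * \<eta>L l) \<and>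
        (\<forall>h. (\<Sum>(x, y)\<leftarrow>rep (comult HR h). ?j x * jc y) = \<eta>L (piL h)) \<and>
        (\<forall>h. (\<Sum>(x, y)\<leftarrow>rep (comult HL h). jc x * ?j y) = \<eta>R (piR h))"
      using lin(2) base conv unfolding swd_def by (intro exI[of _ ?jc]) simp
  qed
  then show "cleaving scH scL scR HL HR S scA \<eta>R \<rho>R \<rho>L B \<eta>L ?j ?jc"
    using lin(2) base conv
    by (intro cleaving.intro cleft_extension_axioms cleaving_axioms.intro)
  show "?j 1 = 1" by (rule inv)
qed

end

section \<open>The crossed product structure of a cleft extension\<close>

locale normalised_cleaving = cleaving scH scL scR HL HR S scA \<eta>R \<rho>R \<rho>L B \<eta>L j jc
  for scH :: "'k::{comm_ring,comm_monoid_mult} \<Rightarrow> 'h::{ring,monoid_mult} \<Rightarrow> 'h"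
    and scL :: "'k \<Rightarrow> 'l::{ring,monoid_mult} \<Rightarrow> 'l"
    and scR :: "'k \<Rightarrow> 'r::{ring,monoid_mult} \<Rightarrow> 'r"
    and HL :: "('l, 'h) bialgebroid_data"
    and HR :: "('r, 'h) bialgebroid_data"
    and S :: "'h \<Rightarrow> 'h"
    and scA :: "'k \<Rightarrow> 'a::{ring,monoid_mult} \<Rightarrow> 'a"
    and \<eta>R :: "'r \<Rightarrow> 'a"
    and \<rho>R \<rho>L :: "'a \<Rightarrow> ('a \<times> 'h) list set"
    and B :: "'a set"
    and \<eta>L :: "'l \<Rightarrow> 'a"
    and j jc :: "'h \<Rightarrow> 'a" +
  assumes j_one [simp]: "j 1 = 1"
begin

section \<open>The projection onto the coinvariants\<close>

lemma balL_jc_j: "balL (\<lambda>x y. jc x * j y)"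
  by (rule balLI) (simp_all add: distrib_left distrib_right mult.assoc)

lemma balR_j_jc: "balR (\<lambda>x y. j x * jc y)"
  by (rule balRI) (simp_all add: distrib_left distrib_right mult.assoc)

lemma jc_one [simp]: "jc 1 = 1"
  using jc_conv_j[of 1] DL_one[OF balL_jc_j] by simp

lemma j_sR [simp]: "j (sR r) = \<eta>R r"
  using j_sR_left[of r 1] by simp

text \<open>The \<open>B\<close>-valued projection \<open>a \<mapsto> a\<^bsup>[0]\<^esup> j\<^sup>c(a\<^bsup>[1]\<^esup>)\<close>; in \<open>B #\<^sub>\<sigma> H\<close> it is \<open>B \<otimes> \<pi>\<^sub>L\<close>.\<close>

definition E :: "'a \<Rightarrow> 'a"
  where "E a = CR a (\<lambda>x y. x * jc y)"

lemma balAR_E: "balAR (\<lambda>x y. x * jc y)"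
  by (rule balARI) (simp_all add: distrib_left distrib_right mult.assoc)

lemma E_add [simp]: "E (a + a') = E a + E a'"
  unfolding E_def by (rule CR_add[OF balAR_E])

text \<open>Coassociativity splits the second leg of the coaction of a; one half meets the coaction
  of \<open>jc\<close> applied to the other half, and \<open>CR_jc\<close> leaves 1 in the right
  leg.\<close>

lemma E_in_B [simp]: "E a \<in> B"
proof (rule in_BI)
  fix F :: "'a \<Rightarrow> 'h \<Rightarrow> rat_mod_int" assume F: "balAR F"
  let ?G = "\<lambda>u v y. CR (jc y) (\<lambda>u' v'. F (u * u') (v * v'))"
  have F1: "balAR (\<lambda>u v. F (a * u) (g * v))" for a g
    using F by (rule balAR_mult_left)
  have "CR (E a) F = CR a (\<lambda>x y. CR (x * jc y) F)"
    unfolding E_def by (rule swd_hom) (rule CR_add[OF F])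
  also have "\<dots> = CR a (\<lambda>x y. CR x (\<lambda>u v. ?G u v y))"
    unfolding CR_mult[OF F] ..
  also have "\<dots> = CR a (\<lambda>x y. DR y (?G x))"
  proof (rule CR_coassoc)
    show "balAR (\<lambda>u v. ?G u v y)" for y
      using F by (rule balAR_coact_right)
    show "balR (?G u)" for u
    proof (rule balRI)
      fix m r n
      show "?G u (m * sR r) n = ?G u m (n * tR r)"
        by (simp add: CR_etaR_left[OF F1] mult.assoc)
    qed (simp_all add: distrib_right balAR_D[OF F] CR_add[OF F1] swd_add)
  qed
  also have "\<dots> = CR a (\<lambda>x y. F (x * jc y) 1)"
    using CR_jc[OF balAR_mult_left[OF F, of _ 1]] by simp
  also have "\<dots> = F (E a) 1"
    unfolding E_def by (rule swd_hom[symmetric]) (rule balAR_D[OF F])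
  finally show "CR (E a) F = F (E a) 1" .
qed

lemma E_B_left [simp]: "b \<in> B \<Longrightarrow> E (b * a) = b * E a"
  unfolding E_def by (simp add: CR_B_left[OF _ balAR_E] swd_mult_left mult.assoc)

text \<open>\<open>E\<close> turns the right L-action of the comodule A into right multiplication by
  \<open>\<eta>L\<close>, so that applying \<open>E\<close> to the first leg of
  \<open>\<rho>L\<close> gives a well-defined element of B \<otimes> H over L.\<close>

lemma E_etaRL_left [simp]: "E (etaRL l * a) = E a * \<eta>L l"
  unfolding E_def by (simp add: CR_etaRL_left[OF balAR_E] flip: swd_mult_right mult.assoc)

lemma E_one [simp]: "E 1 = 1"
  unfolding E_def by (simp add: CR_one[OF balAR_E])

lemma E_B [simp]: "b \<in> B \<Longrightarrow> E b = b"
  using E_B_left[of b 1] by simp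

lemma E_scale: "E (scA c a) = scA c (E a)"
  by (simp add: scA_eq[of c])

lemma E_j: "E (j h) = \<eta>L (piL h)"
  unfolding E_def CR_j[OF balAR_E] j_conv_jc ..

lemma balAL_E_j: "balAL (\<lambda>x y. E x * j y)"
  by (rule balALI) (simp_all add: distrib_left distrib_right mult.assoc)

text \<open>Compatibility replaces \<open>\<rho>L\<close> followed by \<open>\<rho>R\<close> by
  \<open>\<rho>R\<close> followed by the left coproduct. Then \<open>jc\<close> and \<open>j\<close>
  stand on its two legs and convolve to \<open>\<eta>R\<close> of the counit.\<close>

lemma E_decomposition: "CL a (\<lambda>x y. E x * j y) = a"
proof -
  have "CL a (\<lambda>x y. E x * j y) = CL a (\<lambda>x y. CR x (\<lambda>u v. u * jc v * j y))"
    unfolding E_def swd_mult_right ..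
  also have "\<dots> = CR a (\<lambda>x y. DL y (\<lambda>p q. x * jc p * j q))"
  proof (rule C_compat_RL)
    show "balAR (\<lambda>u v. u * jc v * j y)" for y
      by (rule balARI) (simp_all add: distrib_left distrib_right mult.assoc)
    show "balL (\<lambda>p q. u * jc p * j q)" for u
      by (rule balLI) (simp_all add: distrib_left distrib_right mult.assoc)
  qed
  also have "\<dots> = CR a (\<lambda>x y. x * \<eta>R (piR y))"
    unfolding mult.assoc swd_mult_left jc_conv_j ..
  also have "\<dots> = a"
    using CR_counit[of "\<lambda>z. z" a] by simp
  finally show ?thesis .
qed

lemma E_decomposition_hom:
  "(\<And>x y. f (x + y) = f x + f y) \<Longrightarrow> f a = CL a (\<lambda>x y. f (E x * j y))"
  for f :: "'a \<Rightarrow> 'x::ab_group_add"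
  using swd_hom[of f "\<rho>L a" "\<lambda>x y. E x * j y"] by (simp add: E_decomposition)

section \<open>Measuring, cocycle and twisted module\<close>

definition act :: "'h \<Rightarrow> 'a \<Rightarrow> 'a"
  where "act h b = E (j h * b)"

text \<open>Defining \<open>act\<close> and \<open>cocyc\<close> through \<open>E\<close> puts their
  values in B at once. The classical convolution formulas, with \<open>act\<close> as a conjugation
  by \<open>j\<close>, are recovered in \<open>act_eq\<close> and \<open>cocyc_eq\<close>.\<close>

definition cocyc :: "'h \<Rightarrow> 'h \<Rightarrow> 'a"
  where "cocyc h k = E (j h * j k)"

text \<open>\<open>E\<close> outside makes the values lie in B by construction;
  \<open>cocyc_inv_eq\<close> expands it.\<close>

definition cocyc_inv :: "'h \<Rightarrow> 'h \<Rightarrow> 'a"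
  where "cocyc_inv h k = E (DR k (\<lambda>p q. j (h * p) * jc q))"

lemma act_in_B [simp]: "act h b \<in> B"
  by (simp add: act_def)

lemma cocyc_in_B [simp]: "cocyc h k \<in> B"
  by (simp add: cocyc_def)

lemma CL_j_B:
  assumes b: "b \<in> B" and F: "balAL F"
  shows "CL (j h * b) F = DL h (\<lambda>x y. F (j x * b) y)"
  using CL_B_right[OF b F] CL_j[OF balAL_mult_right[OF F, of b 1]] by simp

lemma CL_j_j:
  assumes F: "balAL F"
  shows "CL (j h * j k) F = DL h (\<lambda>x y. DL k (\<lambda>x' y'. F (j x * j x') (y * y')))"
proof -
  have "CL (j h * j k) F = CL (j k) (\<lambda>x' y'. CL (j h) (\<lambda>x y. F (x * x') (y * y')))"
    unfolding CL_mult[OF F] by (rule swd_swap)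
  also have "\<dots> = DL k (\<lambda>x' y'. CL (j h) (\<lambda>x y. F (x * j x') (y * y')))"
    by (rule CL_j[OF balAL_coact_left[OF F]])
  also have "\<dots> = DL k (\<lambda>x' y'. DL h (\<lambda>x y. F (j x * j x') (y * y')))"
    unfolding CL_j[OF balAL_mult_right[OF F]] ..
  finally show ?thesis by (simp only: swd_swap[of "comult HL k"])
qed

text \<open>This and \<open>j_j\<close> are the multiplication of the crossed product read inside A:
  one moves \<open>j h\<close> past B, the other merges two values of \<open>j\<close>.\<close>

lemma j_B: "b \<in> B \<Longrightarrow> DL h (\<lambda>x y. act x b * j y) = j h * b"
  using E_decomposition[of "j h * b"] by (simp add: CL_j_B[OF _ balAL_E_j] act_def)

lemma j_j: "DL h (\<lambda>x y. DL k (\<lambda>x' y'. cocyc x x' * j (y * y'))) = j h * j k"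
  using E_decomposition[of "j h * j k"] by (simp add: CL_j_j[OF balAL_E_j] cocyc_def)

text \<open>The left factor is decomposed here. Decomposing the right factor by
  \<open>E_decomposition_hom\<close> gives the other bracketing.\<close>

lemma E_mult_j: "E (a * j m) = CL a (\<lambda>u v. E u * cocyc v m)"
  using E_decomposition_hom[of "\<lambda>z. E (z * j m)" a]
  by (simp add: distrib_right cocyc_def mult.assoc)

lemma E_mult_B: "E (a * b) = CL a (\<lambda>u v. E u * act v b)"
  using E_decomposition_hom[of "\<lambda>z. E (z * b)" a]
  by (simp add: distrib_right act_def mult.assoc)

lemma cocyc_sL_left [simp]: "cocyc (sL l * h) k = \<eta>L l * cocyc h k"
  by (simp add: cocyc_def mult.assoc)

lemma cocyc_tL_left [simp]: "cocyc (tL l * h) k = cocyc h k * \<eta>L l"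
  by (simp add: cocyc_def mult.assoc)

lemma cocyc_balanced: "cocyc (h * tL l) k = cocyc h (tL l * k)"
  using j_sR_right[of h "piR (tL l)"] by (simp add: cocyc_def mult.assoc)

lemma cocyc_add [simp]:
  "cocyc (h + h') k = cocyc h k + cocyc h' k" "cocyc h (k + k') = cocyc h k + cocyc h k'"
  by (simp_all add: cocyc_def distrib_left distrib_right)

lemma act_sL_left [simp]: "act (sL l * h) b = \<eta>L l * act h b"
  by (simp add: act_def mult.assoc)

lemma act_tL_left [simp]: "act (tL l * h) b = act h b * \<eta>L l"
  by (simp add: act_def mult.assoc)

lemma act_add [simp]: "act (h + h') b = act h b + act h' b" "act h (b + b') = act h b + act h b'"
  by (simp_all add: act_def distrib_left distrib_right)

lemma j_scale: "j (scH c h) = scA c (j h)"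
  using cleaving_map.j_linear[OF cleaving_map_j] unfolding k_linear_def by blast

lemma balAL_E_cocyc: "balAL (\<lambda>u v. E u * cocyc v k)"
  by (rule balALI) (simp_all add: distrib_left distrib_right mult.assoc)

lemma balAL_E_act: "balAL (\<lambda>u v. E u * act v b)"
  by (rule balALI) (simp_all add: distrib_left distrib_right mult.assoc)

lemma E_j_B_j: "b \<in> B \<Longrightarrow> E (j h * (b * j k)) = DL h (\<lambda>x y. act x b * cocyc y k)"
  using E_mult_j[of "j h * b" k] by (simp add: CL_j_B[OF _ balAL_E_cocyc] act_def mult.assoc)

lemma balAL_E_left: "balAL (\<lambda>x y. E (a * (E x * j y)))"
  by (rule balALI) (simp_all add: distrib_left distrib_right mult.assoc)

lemma measuring_act: "measuring scH scA HL B \<eta>L act"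
proof
  show "k_bilinear scH scA scA B B act"
    unfolding k_bilinear_def
    by (simp add: act_def j_scale scA_mult_right distrib_left distrib_right E_scale
        flip: k_algebra.scale_mult_left[OF algebra_A])
  show "act h 1 = \<eta>L (piL h)" for h
    by (simp add: act_def E_j)
  show "act h (b * b') = (\<Sum>(h1, h2)\<leftarrow>rep (comult HL h). act h1 b * act h2 b')"
    if "b \<in> B" "b' \<in> B" for h b b'
    using E_mult_B[of "j h * b" b'] CL_j_B[OF that(1) balAL_E_act, of h b']
    by (simp add: act_def swd_def mult.assoc)
qed simp_all

lemma cocyc_cocycle: "two_cocycle scH scA HL B \<eta>L act cocyc"
proof
  show "k_bilinear scH scH scA UNIV B cocyc"
    unfolding k_bilinear_def
    by (simp add: cocyc_def j_scale scA_mult_right distrib_left distrib_right E_scale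
        flip: k_algebra.scale_mult_left[OF algebra_A])
  show "cocyc (h * tL l) k = cocyc h (tL l * k)" for h l k
    by (rule cocyc_balanced)
  \<comment> \<open>The middle factor \<open>\<eta>L l\<close> merges with its right neighbour, as
    \<open>\<eta>L l * j k\<close> is \<open>j (sL l * k)\<close>.\<close>
  show "(\<Sum>(h1, h2)\<leftarrow>rep (comult HL h). act h1 (\<eta>L l) * cocyc h2 k) = cocyc h (sL l * k)" for h l k
    using E_j_B_j[of "\<eta>L l" h k] by (simp add: cocyc_def swd_def)
  show "cocyc 1 h = \<eta>L (piL h)" "cocyc h 1 = \<eta>L (piL h)" for h
    by (simp_all add: cocyc_def E_j)
  show "(\<Sum>(h1, h2)\<leftarrow>rep (comult HL h). \<Sum>(k1, k2)\<leftarrow>rep (comult HL k). \<Sum>(m1, m2)\<leftarrow>rep (comult HL m).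
          act h1 (cocyc k1 m1) * cocyc h2 (k2 * m2)) =
       (\<Sum>(h1, h2)\<leftarrow>rep (comult HL h). \<Sum>(k1, k2)\<leftarrow>rep (comult HL k).
          cocyc h1 k1 * cocyc (h2 * k2) m)" for h k m
  proof -
    \<comment> \<open>First bracketing: \<open>j k * j m\<close> is decomposed, then
      \<open>E_j_B_j\<close> moves \<open>j h\<close> past the resulting B-factor.\<close>
    have "E (j h * (j k * j m)) = CL (j k * j m) (\<lambda>x y. E (j h * (E x * j y)))"
      by (rule E_decomposition_hom) (simp add: distrib_left)
    also have "\<dots> = DL k (\<lambda>k1 k2. DL m (\<lambda>m1 m2. E (j h * (cocyc k1 m1 * j (k2 * m2)))))"
      by (simp add: CL_j_j[OF balAL_E_left] cocyc_def)
    also have "\<dots> = DL k (\<lambda>k1 k2. DL m (\<lambda>m1 m2. DL h (\<lambda>h1 h2. act h1 (cocyc k1 m1) * cocyc h2 (k2 * m2))))"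
      by (simp add: E_j_B_j)
    also have "\<dots> = DL h (\<lambda>h1 h2. DL k (\<lambda>k1 k2. DL m (\<lambda>m1 m2. act h1 (cocyc k1 m1) * cocyc h2 (k2 * m2))))"
      by (simp only: swd_swap[of "comult HL m" "comult HL h"] swd_swap[of "comult HL k" "comult HL h"])
    finally have lhs: "E (j h * (j k * j m)) = \<dots>" .
    have "E (j h * (j k * j m)) = DL h (\<lambda>h1 h2. DL k (\<lambda>k1 k2. cocyc h1 k1 * cocyc (h2 * k2) m))"
      using E_mult_j[of "j h * j k" m] by (simp add: CL_j_j[OF balAL_E_cocyc] mult.assoc flip: cocyc_def)
    with lhs show ?thesis by (simp add: swd_def)
  qed
qed simp_all

lemma twisted_act: "twisted_module scH scA HL B \<eta>L act cocyc"
proof (intro twisted_module.intro measuring_act cocyc_cocycle twisted_module_axioms.intro)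
  show "act 1 b = b" if "b \<in> B" for b
    using that by (simp add: act_def)
  show "(\<Sum>(h1, h2)\<leftarrow>rep (comult HL h). \<Sum>(k1, k2)\<leftarrow>rep (comult HL k). act h1 (act k1 b) * cocyc h2 k2) =
      (\<Sum>(h1, h2)\<leftarrow>rep (comult HL h). \<Sum>(k1, k2)\<leftarrow>rep (comult HL k). cocyc h1 k1 * act (h2 * k2) b)"
    if b: "b \<in> B" for b h k
  proof -
    have "E (j h * (j k * b)) = CL (j k * b) (\<lambda>x y. E (j h * (E x * j y)))"
      by (rule E_decomposition_hom) (simp add: distrib_left)
    also have "\<dots> = DL k (\<lambda>k1 k2. E (j h * (act k1 b * j k2)))"
      by (simp add: CL_j_B[OF b balAL_E_left] act_def)
    also have "\<dots> = DL k (\<lambda>k1 k2. DL h (\<lambda>h1 h2. act h1 (act k1 b) * cocyc h2 k2))"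
      by (simp add: E_j_B_j)
    also have "\<dots> = DL h (\<lambda>h1 h2. DL k (\<lambda>k1 k2. act h1 (act k1 b) * cocyc h2 k2))"
      by (rule swd_swap)
    finally have lhs: "E (j h * (j k * b)) = \<dots>" .
    have "E (j h * (j k * b)) = DL h (\<lambda>h1 h2. DL k (\<lambda>k1 k2. cocyc h1 k1 * act (h2 * k2) b))"
      using E_mult_B[of "j h * j k" b] by (simp add: CL_j_j[OF balAL_E_act] mult.assoc flip: cocyc_def)
    with lhs show ?thesis by (simp add: swd_def)
  qed
qed

section \<open>The convolution inverse of the cocycle\<close>

lemma balR_j_mult_jc: "balR (\<lambda>p q. j (h * p) * jc q)"
  by (rule balRI) (simp_all add: distrib_left distrib_right mult.assoc)

text \<open>The argument k comes first because \<open>jconv k\<close> is treated as a variant of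
  \<open>j\<close> in the variable h: it shares several linearity properties of \<open>j\<close> and
  its behaviour under \<open>\<rho>R\<close>, and \<open>jconv 1\<close> is
  \<open>j\<close>.\<close>

definition jconv :: "'h \<Rightarrow> 'h \<Rightarrow> 'a"
  where "jconv k h = DR k (\<lambda>p q. j (h * p) * jc q)"

lemma cocyc_inv_jconv: "cocyc_inv h k = E (jconv k h)"
  by (simp add: cocyc_inv_def jconv_def)

lemma jconv_add [simp]:
  "jconv k (h + h') = jconv k h + jconv k h'" "jconv (k + k') h = jconv k h + jconv k' h"
  using DR_add[OF balR_j_mult_jc] by (simp_all add: jconv_def distrib_right swd_add)

text \<open>The Takeuchi property carries \<open>sR r\<close> from the argument of \<open>j\<close>
  to \<open>tR r\<close> in that of \<open>jc\<close>, where \<open>jc_tR_left\<close> releases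
  it.\<close>

lemma jconv_sR_right [simp]: "jconv k (h * sR r) = jconv k h * \<eta>R r"
  using DR_takeuchi[OF balR_j_mult_jc[of h], where h = k and r = r]
  by (simp add: jconv_def mult.assoc flip: swd_mult_right)

lemma jconv_sL_left [simp]: "jconv k (sL l * h) = \<eta>L l * jconv k h"
  by (simp add: jconv_def mult.assoc flip: swd_mult_left)

lemma jconv_tL_left [simp]: "jconv k (tL l * h) = etaRL l * jconv k h"
  by (simp add: jconv_def mult.assoc flip: swd_mult_left)

lemma jconv_sL_left_arg: "jconv (sL l * k) h = jconv k (h * sL l)"
  by (simp add: jconv_def DR_sL_left[OF balR_j_mult_jc] mult.assoc)

lemma jconv_tL_left_arg: "jconv (tL l * k) h = jconv k h * \<eta>L l"
  by (simp add: jconv_def DR_tL_left[OF balR_j_mult_jc] flip: swd_mult_right mult.assoc)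

text \<open>In the coaction of \<open>j (h * p) * jc q\<close> the second leg of p cancels against
  the coaction of \<open>jc\<close> by \<open>CR_jc\<close>; only the second leg of h
  survives.\<close>

lemma CR_jconv:
  assumes F: "balAR F"
  shows "CR (jconv k h) F = DR h (\<lambda>x y. F (jconv k x) y)"
proof -
  have F1: "balAR (\<lambda>u v. F (a * u) (g * v))" for a g
    using F by (rule balAR_mult_left)
  have F2: "balAR (\<lambda>u v. CR c (\<lambda>u' v'. F (u * u') (v * v')))" for c
    using F by (rule balAR_coact_right)
  let ?G = "\<lambda>x y p g q. CR (jc q) (\<lambda>u v. F (j (x * p) * u) (y * g * v))"
  have "CR (jconv k h) F = DR k (\<lambda>p q. CR (j (h * p) * jc q) F)"
    unfolding jconv_def by (rule swd_hom) (rule CR_add[OF F])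
  also have "\<dots> = DR k (\<lambda>p q. DR h (\<lambda>x y. DR p (\<lambda>p1 p2. ?G x y p1 p2 q)))"
    unfolding CR_mult[OF F] CR_j[OF F2] DR_mult[OF balR_j[OF F2]] ..
  also have "\<dots> = DR h (\<lambda>x y. DR k (\<lambda>p q. DR p (\<lambda>p1 p2. ?G x y p1 p2 q)))"
    by (rule swd_swap)
  also have "\<dots> = DR h (\<lambda>x y. F (jconv k x) y)"
  proof (rule swd_cong)
    fix x y
    have "DR k (\<lambda>p q. DR p (\<lambda>p1 p2. ?G x y p1 p2 q)) = DR k (\<lambda>p q. DR q (?G x y p))"
    proof (rule DR_coassoc)
      show "balR (\<lambda>p g. ?G x y p g q)" for q
      proof (rule balRI)
        fix m r n
        show "?G x y (m * sR r) n q = ?G x y m (n * tR r) q"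
          using CR_takeuchi[OF F1[of "j (x * m)" "y * n"], where a = "jc q" and r = r]
          by (simp add: mult.assoc)
      qed (simp_all add: distrib_left distrib_right balAR_D[OF F] swd_add)
      show "balR (?G x y p)" for p
      proof (rule balRI)
        fix m r n
        show "?G x y p (m * sR r) n = ?G x y p m (n * tR r)"
          using CR_etaR_left[OF F1[of "j (x * p)" "y * m"], of r "jc n"] by (simp add: mult.assoc)
      qed (simp_all add: distrib_left distrib_right balAR_D[OF F] swd_add CR_add[OF F1])
    qed
    also have "\<dots> = DR k (\<lambda>p q. F (j (x * p) * jc q) y)"
      using CR_jc[OF F1[of "j (x * _)" y]] by (simp add: mult.assoc)
    also have "\<dots> = F (jconv k x) y"
      unfolding jconv_def by (rule swd_hom[symmetric]) (rule balAR_D[OF F])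
    finally show "DR k (\<lambda>p q. DR p (\<lambda>p1 p2. ?G x y p1 p2 q)) = F (jconv k x) y" .
  qed
  finally show ?thesis .
qed

lemma cocyc_inv_eq: "cocyc_inv h k = DR h (\<lambda>x y. jconv k x * jc y)"
  unfolding cocyc_inv_jconv E_def CR_jconv[OF balAR_E] ..

lemma act_eq: "b \<in> B \<Longrightarrow> act h b = DR h (\<lambda>p q. j p * b * jc q)"
  unfolding act_def E_def using CR_B_right[OF _ balAR_E, of b "j h"]
    CR_j[of "\<lambda>x y. x * b * jc y" h] by (auto simp: balAR_iff distrib_left distrib_right mult.assoc B_etaR_commute')

lemma cocyc_eq: "cocyc h k = DR h (\<lambda>x y. DR k (\<lambda>p q. j x * j p * jc (y * q)))"
proof -
  have F: "balAR (\<lambda>x y. x * jc y)" by (rule balAR_E)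
  have "cocyc h k = DR h (\<lambda>x y. CR (j k) (\<lambda>p q. j x * p * jc (y * q)))"
    unfolding cocyc_def E_def CR_mult[OF F] CR_j[OF balAR_coact_right[OF F]] by simp
  then show ?thesis
    by (simp add: CR_j[OF balAR_mult_left[OF F]])
qed

text \<open>Since \<open>act\<close> is conjugation by \<open>j\<close>, the leading
  \<open>jc\<close> cancels its left half. The remaining scalar from R commutes with b and is
  absorbed by the counit.\<close>

lemma jc_act:
  assumes b: "b \<in> B"
  shows "DL h (\<lambda>x y. jc x * act y b) = b * jc h"
proof -
  have "DL h (\<lambda>x y. jc x * act y b) = DL h (\<lambda>x y. DR y (\<lambda>p q. jc x * (j p * (b * jc q))))"
    by (simp add: act_eq[OF b] mult.assoc flip: swd_mult_left)
  also have "\<dots> = DR h (\<lambda>x y. DL x (\<lambda>x1 x2. jc x1 * (j x2 * (b * jc y))))"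
  proof (rule D_coassoc_LR[symmetric])
    show "balL (\<lambda>m n. jc m * (j n * (b * jc p)))" for p
      by (rule balLI) (simp_all add: distrib_left distrib_right mult.assoc)
    show "balR (\<lambda>p q. jc m * (j p * (b * jc q)))" for m
      by (rule balRI) (simp_all add: distrib_left distrib_right mult.assoc B_etaR_commute'[OF b])
  qed
  also have "\<dots> = DR h (\<lambda>x y. b * (\<eta>R (piR x) * jc y))"
    by (simp add: swd_mult_right jc_conv_j B_etaR_commute'[OF b] flip: mult.assoc)
      (simp add: mult.assoc B_etaR_commute'[OF b])
  also have "\<dots> = b * jc h"
    unfolding swd_mult_left etaR_jc_counit ..
  finally show ?thesis .
qed

text \<open>In \<open>cocyc_eq\<close> the factor \<open>j\<close> belonging to h cancels against
  \<open>jc\<close>. The scalar left over is carried across the coproduct of k into the argument of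
  the last \<open>jc\<close>, where the counit law for h absorbs it.\<close>

lemma jc_cocyc: "DL h (\<lambda>x y. jc x * cocyc y k) = DR k (\<lambda>p q. j p * jc (h * q))"
proof -
  let ?W = "\<lambda>a y. DR k (\<lambda>p q. a * (j p * jc (y * q)))"
  have "DL h (\<lambda>x y. jc x * cocyc y k) = DL h (\<lambda>x y. DR y (\<lambda>y1 y2. ?W (jc x * j y1) y2))"
    by (simp add: cocyc_eq mult.assoc flip: swd_mult_left)
  also have "\<dots> = DR h (\<lambda>x y. DL x (\<lambda>x1 x2. ?W (jc x1 * j x2) y))"
  proof (rule D_coassoc_LR[symmetric])
    show "balL (\<lambda>m n. ?W (jc m * j n) y)" for y
      by (rule balLI) (simp_all add: distrib_left distrib_right swd_add mult.assoc)
    show "balR (\<lambda>n y. ?W (jc m * j n) y)" for m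
    proof (rule balRI)
      fix n r y
      have "balR (\<lambda>p q. jc m * j n * (j p * jc (y * q)))"
        by (rule balRI) (simp_all add: distrib_left distrib_right mult.assoc)
      from DR_takeuchi[OF this, where h = k and r = r]
      show "?W (jc m * j (n * sR r)) y = ?W (jc m * j n) (y * tR r)"
        by (simp add: mult.assoc)
    qed (simp_all add: distrib_left distrib_right swd_add)
  qed
  also have "\<dots> = DR h (\<lambda>x y. ?W (\<eta>R (piR x)) y)"
    by (simp add: swd_swap[of _ "comult HR k"] swd_mult_right jc_conv_j)
  also have "\<dots> = DR h (\<lambda>x y. DR k (\<lambda>p q. j p * jc (y * tR (piR x) * q)))"
  proof (rule swd_cong)
    fix x y
    have "balR (\<lambda>p q. j p * jc (y * q))"
      by (rule balRI) (simp_all add: distrib_left distrib_right mult.assoc)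
    from DR_takeuchi[OF this, where h = k and r = "piR x"]
    show "?W (\<eta>R (piR x)) y = DR k (\<lambda>p q. j p * jc (y * tR (piR x) * q))"
      by (simp add: mult.assoc)
  qed
  also have "\<dots> = DR k (\<lambda>p q. j p * jc (h * q))"
    by (rule DR_counit_left) (simp add: distrib_left distrib_right swd_add)
  finally show ?thesis .
qed

text \<open>Does for k what \<open>jc_cocyc\<close> does for h.\<close>

lemma jc_j_jc: "DL k (\<lambda>x y. jc x * DR y (\<lambda>p q. j p * jc (h * q))) = jc (h * k)"
proof -
  have "DL k (\<lambda>x y. jc x * DR y (\<lambda>p q. j p * jc (h * q)))
      = DL k (\<lambda>x y. DR y (\<lambda>p q. jc x * j p * jc (h * q)))"
    by (simp add: mult.assoc flip: swd_mult_left)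
  also have "\<dots> = DR k (\<lambda>x y. DL x (\<lambda>x1 x2. jc x1 * j x2 * jc (h * y)))"
  proof (rule D_coassoc_LR[symmetric])
    show "balL (\<lambda>m n. jc m * j n * jc (h * y))" for y
      by (rule balLI) (simp_all add: distrib_left distrib_right mult.assoc)
    show "balR (\<lambda>n y. jc m * j n * jc (h * y))" for m
      by (rule balRI) (simp_all add: distrib_left distrib_right mult.assoc)
  qed
  also have "\<dots> = DR k (\<lambda>x y. jc (h * (y * tR (piR x))))"
    by (simp add: swd_mult_right jc_conv_j)
  also have "\<dots> = jc (h * k)"
    by (rule DR_counit_left) (simp add: distrib_left)
  finally show ?thesis .
qed

text \<open>The product telescopes in A. By \<open>j_j\<close> the cocycle times the value of
  \<open>j\<close> inside the inverse becomes a product of two values of \<open>j\<close>; the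
  factor for k cancels against its \<open>jc\<close> to \<open>\<eta>L (piL k)\<close>, and what
  remains is \<open>act_eq\<close> for this element.\<close>

lemma cocyc_right_inverse:
  "DL h (\<lambda>h1 h2. DL k (\<lambda>k1 k2. cocyc h1 k1 * cocyc_inv h2 k2)) = act h (act k 1)"
proof -
  let ?G = "\<lambda>h1 x y. DL k (\<lambda>k1 k2. cocyc h1 k1 * jconv k2 x * jc y)"
  have "DL h (\<lambda>h1 h2. DL k (\<lambda>k1 k2. cocyc h1 k1 * cocyc_inv h2 k2))
      = DL h (\<lambda>h1 h2. DR h2 (?G h1))"
    by (simp add: cocyc_inv_eq swd_swap[of _ "comult HL k"] mult.assoc flip: swd_mult_left)
  also have "\<dots> = DR h (\<lambda>h' y. DL h' (\<lambda>h1 x. ?G h1 x y))"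
  proof (rule D_coassoc_LR[symmetric])
    show "balL (\<lambda>h1 x. ?G h1 x y)" for y
      by (rule balLI) (simp_all add: distrib_left distrib_right swd_add mult.assoc)
    show "balR (?G h1)" for h1
      by (rule balRI) (simp_all add: distrib_left distrib_right swd_add mult.assoc)
  qed
  also have "\<dots> = DR h (\<lambda>h' y. j h' * \<eta>L (piL k) * jc y)"
  proof (rule swd_cong)
    fix h' y
    let ?H = "\<lambda>k1 p q. DL h' (\<lambda>h1 x. cocyc h1 k1 * j (x * p)) * jc q"
    have "DL h' (\<lambda>h1 x. ?G h1 x y) = DL k (\<lambda>k1 k2. DR k2 (?H k1)) * jc y"
      by (simp add: jconv_def swd_swap[of "comult HL h'"] mult.assoc
          flip: swd_mult_left swd_mult_right)
    also have "DL k (\<lambda>k1 k2. DR k2 (?H k1)) = DR k (\<lambda>k' q. DL k' (\<lambda>k1 p. ?H k1 p q))"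
    proof (rule D_coassoc_LR[symmetric])
      show "balL (\<lambda>k1 p. ?H k1 p q)" for q
      proof (rule balLI)
        fix m l n
        \<comment> \<open>Balancedness in the legs of k holds only after summation over the legs of
          h', through the Takeuchi property.\<close>
        have "balL (\<lambda>h1 x. cocyc h1 m * j (x * n))"
          by (rule balLI) (simp_all add: distrib_left distrib_right mult.assoc)
        from DL_takeuchi[OF this, where h = h' and l = l]
        show "?H (tL l * m) n q = ?H m (sL l * n) q"
          by (simp add: cocyc_balanced mult.assoc)
      qed (simp_all add: distrib_left distrib_right swd_add)
      show "balR (?H k1)" for k1
        by (rule balRI) (simp_all add: distrib_left distrib_right swd_add mult.assoc flip: swd_mult_right)
    qed
    also have "\<dots> = DR k (\<lambda>k' q. j h' * j k' * jc q)"
      by (simp add: swd_mult_right swd_swap[of _ "comult HL h'"] j_j)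
    also have "\<dots> = j h' * \<eta>L (piL k)"
      unfolding mult.assoc swd_mult_left j_conv_jc ..
    finally show "DL h' (\<lambda>h1 x. ?G h1 x y) = j h' * \<eta>L (piL k) * jc y" .
  qed
  also have "\<dots> = act h (\<eta>L (piL k))"
    by (simp add: act_eq)
  finally show ?thesis by (simp add: act_def E_j)
qed

text \<open>Here \<open>jc_cocyc\<close> and then \<open>jc_j_jc\<close> absorb the cocycle into the
  two values of \<open>jc\<close>, merging them into one at a product. Multiplicativity of the right
  coproduct turns the rest into the convolution of \<open>j\<close> with \<open>jc\<close> at
  \<open>h * k\<close>.\<close>

lemma cocyc_left_inverse:
  "DL h (\<lambda>h1 h2. DL k (\<lambda>k1 k2. cocyc_inv h1 k1 * cocyc h2 k2)) = act (h * k) 1"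
proof -
  let ?V = "\<lambda>y k. DR k (\<lambda>p q. j p * jc (y * q))"
  let ?G = "\<lambda>x y h2. DL k (\<lambda>k1 k2. jconv k1 x * (jc y * cocyc h2 k2))"
  have "DL h (\<lambda>h1 h2. DL k (\<lambda>k1 k2. cocyc_inv h1 k1 * cocyc h2 k2))
      = DL h (\<lambda>h1 h2. DR h1 (\<lambda>x y. ?G x y h2))"
    by (simp add: cocyc_inv_eq swd_swap[of _ "comult HL k"] mult.assoc flip: swd_mult_right)
  also have "\<dots> = DR h (\<lambda>x h'. DL h' (?G x))"
  proof (rule D_coassoc_RL)
    show "balR (\<lambda>x y. ?G x y h2)" for h2
      by (rule balRI) (simp_all add: distrib_left distrib_right swd_add mult.assoc)
    show "balL (?G x)" for x
      by (rule balLI) (simp_all add: distrib_left distrib_right swd_add mult.assoc)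
  qed
  also have "\<dots> = DR h (\<lambda>x h'. DR k (\<lambda>p k'. j (x * p) * jc (h' * k')))"
  proof (rule swd_cong)
    fix x h'
    let ?H = "\<lambda>p q k2. j (x * p) * (jc q * ?V h' k2)"
    have "DL h' (?G x) = DL k (\<lambda>k1 k2. jconv k1 x * ?V h' k2)"
      by (simp add: swd_swap[of "comult HL h'"] swd_mult_left jc_cocyc)
    also have "\<dots> = DL k (\<lambda>k1 k2. DR k1 (\<lambda>p q. ?H p q k2))"
      by (simp add: jconv_def mult.assoc flip: swd_mult_right[where T = "comult HR _" and c = "?V h' _"])
    also have "\<dots> = DR k (\<lambda>p k'. DL k' (?H p))"
    proof (rule D_coassoc_RL)
      have bal: "balR (\<lambda>p q. j p * jc (h' * q))"
        by (rule balRI) (simp_all add: distrib_left distrib_right mult.assoc)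
      show "balR (\<lambda>p q. ?H p q k2)" for k2
        by (rule balRI) (simp_all add: distrib_left distrib_right mult.assoc)
      show "balL (?H p)" for p
        by (rule balLI)
          (simp_all add: distrib_left distrib_right mult.assoc DR_add[OF bal] DR_sL_left[OF bal] swd_mult_left)
    qed
    also have "\<dots> = DR k (\<lambda>p k'. j (x * p) * jc (h' * k'))"
      by (simp add: swd_mult_left jc_j_jc)
    finally show "DL h' (?G x) = DR k (\<lambda>p k'. j (x * p) * jc (h' * k'))" .
  qed
  also have "\<dots> = DR (h * k) (\<lambda>x y. j x * jc y)"
    unfolding DR_mult[OF balR_j_jc] ..
  also have "\<dots> = act (h * k) 1"
    by (simp add: j_conv_jc act_def E_j)
  finally show ?thesis .
qed

lemma cocyc_inverse: "cocycle_inverse scH scA HL B \<eta>L act cocyc cocyc_inv"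
proof
  have scale: "cocyc_inv (scH c h) k = scA c (cocyc_inv h k)" "cocyc_inv h (scH c k) = scA c (cocyc_inv h k)"
    for c h k
  proof -
    show "cocyc_inv (scH c h) k = scA c (cocyc_inv h k)"
      by (simp add: cocyc_inv_jconv scH_eq(1) scA_eq[of c])
    \<comment> \<open>A scalar on k enters through \<open>tL\<close> and leaves as the right factor
      \<open>\<eta>L (scL c 1)\<close>, which is c times 1.\<close>
    have "jconv (scH c k) h = jconv k h * \<eta>L (scL c 1)"
      by (simp add: scH_eq(2) jconv_tL_left_arg)
    also have "\<dots> = scA c (jconv k h)"
      using scA_mult_right[of "jconv k h" c 1] scA_eq[of c 1] by simp
    finally show "cocyc_inv h (scH c k) = scA c (cocyc_inv h k)"
      by (simp add: cocyc_inv_jconv E_scale)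
  qed
  show "k_bilinear scH scH scA UNIV B cocyc_inv"
    unfolding k_bilinear_def by (simp add: scale) (simp add: cocyc_inv_jconv)
  show "cocyc_inv (h * sL l) k = cocyc_inv h (sL l * k)" for h l k
    by (simp add: cocyc_inv_jconv jconv_sL_left_arg)
  show "cocyc_inv (sL l * h) k = \<eta>L l * cocyc_inv h k" for l h k
    by (simp add: cocyc_inv_jconv)
  show "cocyc_inv (tL l * h) k = cocyc_inv h k * \<eta>L l" for l h k
    by (simp add: cocyc_inv_jconv)
  show "(\<Sum>(h1, h2)\<leftarrow>rep (comult HL h). cocyc_inv h1 k * act h2 (\<eta>L l)) = cocyc_inv h (tL l * k)" for h k l
  proof -
    \<comment> \<open>By \<open>jc_act\<close> the factor \<open>\<eta>L l\<close> moves to the left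
      of \<open>jc\<close>; attached to \<open>jconv\<close> it becomes \<open>tL l\<close> acting
      on k.\<close>
    have "DL h (\<lambda>h1 h2. cocyc_inv h1 k * act h2 (\<eta>L l))
        = DL h (\<lambda>h1 h2. DR h1 (\<lambda>x y. jconv k x * (jc y * act h2 (\<eta>L l))))"
      by (simp add: cocyc_inv_eq mult.assoc flip: swd_mult_right)
    also have "\<dots> = DR h (\<lambda>x h'. DL h' (\<lambda>y h2. jconv k x * (jc y * act h2 (\<eta>L l))))"
    proof (rule D_coassoc_RL)
      show "balR (\<lambda>x y. jconv k x * (jc y * act h2 (\<eta>L l)))" for h2
        by (rule balRI) (simp_all add: distrib_left distrib_right mult.assoc)
      show "balL (\<lambda>y h2. jconv k x * (jc y * act h2 (\<eta>L l)))" for x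
        by (rule balLI) (simp_all add: distrib_left distrib_right mult.assoc)
    qed
    also have "\<dots> = cocyc_inv h (tL l * k)"
      by (simp add: swd_mult_left jc_act cocyc_inv_eq jconv_tL_left_arg mult.assoc)
    finally show ?thesis by (simp add: swd_def)
  qed
  show "(\<Sum>(h1, h2)\<leftarrow>rep (comult HL h). \<Sum>(k1, k2)\<leftarrow>rep (comult HL k). cocyc h1 k1 * cocyc_inv h2 k2) =
      act h (act k 1)" for h k
    using cocyc_right_inverse[of h k] by (simp add: swd_def)
  show "(\<Sum>(h1, h2)\<leftarrow>rep (comult HL h). \<Sum>(k1, k2)\<leftarrow>rep (comult HL k). cocyc_inv h1 k1 * cocyc h2 k2) =
      act (h * k) 1" for h k
    using cocyc_left_inverse[of h k] by (simp add: swd_def)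
qed

section \<open>The isomorphism with the crossed product\<close>

abbreviation "ractB \<equiv> \<lambda>b l. b * \<eta>L l"
abbreviation "balB F \<equiv> balanced_map B ractB (lactL HL) F"

definition iso :: "'a \<Rightarrow> ('a \<times> 'h) list set"
  where "iso a = csum B \<eta>L HL [(E x, y). (x, y) \<leftarrow> rep (\<rho>L a)]"

lemma tensor_carrier_B: "tensor_carrier B ractB"
  unfolding tensor_carrier_def by simp

lemma iso_list: "[(E x, y). (x, y) \<leftarrow> rep (\<rho>L a)] \<in> lists (B \<times> UNIV)"
  by auto

lemma balB_iff: "balB F \<longleftrightarrow> (\<forall>m\<in>B. \<forall>m'\<in>B. \<forall>n. F (m + m') n = F m n + F m' n) \<and>
    (\<forall>m\<in>B. \<forall>n n'. F m (n + n') = F m n + F m n') \<and> (\<forall>m\<in>B. \<forall>l n. F (m * \<eta>L l) n = F m (sL l * n))"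
  unfolding balanced_map_def lactL_def ..

lemma balB_D:
  assumes "balB F"
  shows "m \<in> B \<Longrightarrow> m' \<in> B \<Longrightarrow> F (m + m') n = F m n + F m' n"
    "m \<in> B \<Longrightarrow> F m (n + n') = F m n + F m n'" "m \<in> B \<Longrightarrow> F (m * \<eta>L l) n = F m (sL l * n)"
  using assms unfolding balB_iff by blast+

lemma balAL_E: "balB F \<Longrightarrow> balAL (\<lambda>x y. F (E x) y)"
  by (rule balALI) (simp_all add: balB_D)

lemma swd_iso: "balB F \<Longrightarrow> swd (iso a) F = CL a (\<lambda>x y. F (E x) y)"
  unfolding iso_def csum_def swd_tcls[OF iso_list]
  by (simp add: swd_def split_def sum_list_bind comp_def)

lemma rep_iso: "rep (iso a) \<in> lists (B \<times> UNIV)"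
  unfolding iso_def csum_def by (rule rep_tensor(1)[OF tcls_in_tensor[OF iso_list]])

lemma rep_iso_in_B: "(b, h) \<in> set (rep (iso a)) \<Longrightarrow> b \<in> B"
  using rep_iso[of a] by auto

lemma iso_inverse: "swd (iso a) (\<lambda>b h. b * j h) = a"
proof -
  have "balB (\<lambda>b h. b * j h)"
    unfolding balB_iff by (simp add: distrib_left distrib_right mult.assoc)
  then show ?thesis by (simp add: swd_iso E_decomposition)
qed

text \<open>On a product b j(h) the map \<open>iso\<close> gives b \<eta>L(piL(h1)) # h2 = b # h,
  because \<open>E\<close> is left B-linear and \<open>E_j\<close> holds. Values of
  \<open>iso\<close> can thus be identified by a computation in A.\<close>

lemma iso_eqI:
  assumes xs: "xs \<in> lists (B \<times> UNIV)" and a: "(\<Sum>(b, h)\<leftarrow>xs. b * j h) = a"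
  shows "iso a = csum B \<eta>L HL xs"
  unfolding iso_def csum_def
proof (rule tcls_eqI[OF tensor_carrier_B iso_list xs])
  fix F :: "'a \<Rightarrow> 'h \<Rightarrow> rat_mod_int" assume F: "balB F"
  let ?G = "\<lambda>x y. F (E x) y"
  have G: "balAL ?G" using F by (rule balAL_E)
  have elem: "CL (b * j h) ?G = F b h" if b: "b \<in> B" for b h
  proof -
    have bal: "balAL (\<lambda>x y. F (b * E x) y)"
      by (rule balALI) (simp_all add: distrib_left balB_D[OF F] b flip: mult.assoc)
    have "CL (b * j h) ?G = CL (j h) (\<lambda>x y. F (b * E x) y)"
      using CL_B_left[OF _ G, of b "j h"] b by (simp add: B_coinvariants)
    also have "\<dots> = DL h (\<lambda>x y. F b (sL (piL x) * y))"
      unfolding CL_j[OF bal] by (rule swd_cong) (simp add: E_j balB_D[OF F] b)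
    also have "\<dots> = F b h"
      by (rule DL_counit_left) (simp add: balB_D[OF F] b)
    finally show ?thesis .
  qed
  have "CL a ?G = (\<Sum>(b, h)\<leftarrow>xs. CL (b * j h) ?G)"
    unfolding a[symmetric]
    using hom_sum_list[of "\<lambda>a. CL a ?G" "\<lambda>(b, h). b * j h" xs] CL_add[OF G] by (simp add: split_def)
  also have "\<dots> = (\<Sum>(b, h)\<leftarrow>xs. F b h)"
    using xs elem by (intro arg_cong[where f = sum_list] map_cong) auto
  finally show "(\<Sum>(x, y)\<leftarrow>[(E x, y). (x, y) \<leftarrow> rep (\<rho>L a)]. F x y) = (\<Sum>(b, h)\<leftarrow>xs. F b h)"
    by (simp add: swd_def split_def sum_list_bind comp_def)
qed

lemma iso_inverse_list: "(\<Sum>(b, h)\<leftarrow>rep (iso a). b * j h) = a"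
  using iso_inverse unfolding swd_def .

lemma map_rep_iso:
  assumes "\<And>b h. b \<in> B \<Longrightarrow> f b h \<in> B"
  shows "[(f b h, g b h). (b, h) \<leftarrow> rep (iso a)] \<in> lists (B \<times> UNIV)"
  using assms[OF rep_iso_in_B] by auto

text \<open>Replacing # by multiplication with \<open>j\<close> in the crossed product formula,
  \<open>j_j\<close> recombines the cocycle with the last factor and \<open>j_B\<close> the action
  with b', which leaves \<open>b * j h * (b' * j h')\<close>.\<close>

lemma iso_crossed_mult: "iso (a * a') = crossed_mult B \<eta>L HL act cocyc (iso a) (iso a')"
  unfolding crossed_mult_def
proof (rule iso_eqI)
  let ?xs = "[(b * act h1 b' * cocyc h2 h1', h3 * h2').
       (b, h) \<leftarrow> rep (iso a), (b', h') \<leftarrow> rep (iso a'),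
       (h1, h23) \<leftarrow> rep (comult HL h), (h2, h3) \<leftarrow> rep (comult HL h23),
       (h1', h2') \<leftarrow> rep (comult HL h')]"
  show "?xs \<in> lists (B \<times> UNIV)" by (auto intro!: B_closed(4) intro: rep_iso_in_B)
  have inner: "DL h (\<lambda>h1 h23. DL h23 (\<lambda>h2 h3. DL h' (\<lambda>h1' h2'. b * act h1 b' * cocyc h2 h1' * j (h3 * h2'))))
      = b * (DL h (\<lambda>h1 h23. act h1 b' * j h23) * j h')" for b b' h h'
    by (simp add: mult.assoc swd_mult_left j_j flip: swd_mult_right)
  have "(\<Sum>(b, h)\<leftarrow>?xs. b * j h) =
      (\<Sum>(b, h)\<leftarrow>rep (iso a). \<Sum>(b', h')\<leftarrow>rep (iso a').
        DL h (\<lambda>h1 h23. DL h23 (\<lambda>h2 h3. DL h' (\<lambda>h1' h2'. b * act h1 b' * cocyc h2 h1' * j (h3 * h2')))))"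
    by (simp add: swd_def split_def sum_list_bind comp_def)
  also have "\<dots> = swd (iso a) (\<lambda>b h. swd (iso a') (\<lambda>b' h'. b * (DL h (\<lambda>h1 h23. act h1 b' * j h23) * j h')))"
    unfolding inner swd_def[of "iso _"] ..
  also have "\<dots> = swd (iso a) (\<lambda>b h. swd (iso a') (\<lambda>b' h'. b * j h * (b' * j h')))"
    by (intro swd_cong swd_cong_set[OF rep_iso]) (simp add: j_B mult.assoc)
  also have "\<dots> = a * a'"
    unfolding swd_mult_left iso_inverse swd_mult_right ..
  finally show "(\<Sum>(b, h)\<leftarrow>?xs. b * j h) = a * a'" .
qed

lemma crossed_product_iso_iso:
  "crossed_product_iso HL HR scA \<eta>R \<rho>R \<rho>L B \<eta>L act cocyc iso"
proof
  have sum_map: "(\<Sum>(b, h)\<leftarrow>[(f b h, g b h). (b, h) \<leftarrow> rep T]. b * j h) = swd T (\<lambda>b h. f b h * j (g b h))"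
    for f :: "'a \<Rightarrow> 'h \<Rightarrow> 'a" and g T
    by (simp add: swd_def split_def comp_def sum_list_bind)
  show "bij_betw iso UNIV (crossed_carrier B \<eta>L HL)"
  proof (rule bij_betw_byWitness[where f' = "\<lambda>T. swd T (\<lambda>b h. b * j h)"])
    show "iso ` UNIV \<subseteq> crossed_carrier B \<eta>L HL"
      unfolding iso_def crossed_carrier_def csum_def using tcls_in_tensor[OF iso_list] by blast
  next
    show "\<forall>T\<in>crossed_carrier B \<eta>L HL. iso (swd T (\<lambda>b h. b * j h)) = T"
    proof
    fix T assume T: "T \<in> crossed_carrier B \<eta>L HL"
    have "iso (swd T (\<lambda>b h. b * j h)) = csum B \<eta>L HL (rep T)"
      using rep_tensor(1)[OF T[unfolded crossed_carrier_def]] by (rule iso_eqI) (simp add: swd_def)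
    then show "iso (swd T (\<lambda>b h. b * j h)) = T"
      using rep_tensor(2)[OF T[unfolded crossed_carrier_def]] by (simp add: csum_def)
    qed
  qed (simp_all add: iso_inverse)
  show "iso (a + a') = csum B \<eta>L HL (rep (iso a) @ rep (iso a'))" for a a'
    by (rule iso_eqI) (use rep_iso in \<open>simp_all add: iso_inverse_list\<close>)
  show "iso (scA c a) = csum B \<eta>L HL [(scA c b, h). (b, h) \<leftarrow> rep (iso a)]" for c a
    unfolding scA_eq[of c]
    by (intro iso_eqI map_rep_iso; (subst sum_map)?) (simp_all add: mult.assoc swd_mult_left iso_inverse)
  show "iso (a * a') = crossed_mult B \<eta>L HL act cocyc (iso a) (iso a')" for a a'
    by (rule iso_crossed_mult)
  show "iso 1 = csum B \<eta>L HL [(1, 1)]"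
    by (rule iso_eqI) simp_all
  show "iso (\<eta>R r) = csum B \<eta>L HL [(1, sR r)]" for r
    by (rule iso_eqI) simp_all
  show "iso (b * a) = csum B \<eta>L HL [(b * b', h). (b', h) \<leftarrow> rep (iso a)]" if "b \<in> B" for b a
    using that by (intro iso_eqI map_rep_iso; (subst sum_map)?) (simp_all add: mult.assoc swd_mult_left iso_inverse)
  show "iso (algR \<eta>R a r) = csum B \<eta>L HL [(b, ractR HR h r). (b, h) \<leftarrow> rep (iso a)]" for a r
    by (intro iso_eqI map_rep_iso; (subst sum_map)?)
      (simp_all add: algR_def ractR_def swd_mult_right iso_inverse flip: mult.assoc)
  show "iso (algL HL HR \<eta>R a l) = csum B \<eta>L HL [(b, ractL HL h l). (b, h) \<leftarrow> rep (iso a)]" for a l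
  proof (intro iso_eqI map_rep_iso)
    \<comment> \<open>\<open>etaRL l\<close> comes from R and therefore passes b.\<close>
    have "swd (iso a) (\<lambda>b h. b * j (ractL HL h l)) = swd (iso a) (\<lambda>b h. etaRL l * (b * j h))"
      by (intro swd_cong_set[OF rep_iso]) (simp add: ractL_def B_etaR_commute')
    then show "(\<Sum>(b, h)\<leftarrow>[(b, ractL HL h l). (b, h) \<leftarrow> rep (iso a)]. b * j h) = algL HL HR \<eta>R a l"
      unfolding sum_map by (simp add: algL_def swd_mult_left iso_inverse)
  qed
  show "tcls3 B ractB (lactL HL) (ractR HR) (lactR HR)
         [(b, x, y). (a', y) \<leftarrow> rep (\<rho>R a), (b, x) \<leftarrow> rep (iso a')] =
       tcls3 B ractB (lactL HL) (ractR HR) (lactR HR)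
         [(b, x, y). (b, h) \<leftarrow> rep (iso a), (x, y) \<leftarrow> rep (comult HR h)]" for a
  proof (rule tcls3_eqI[OF tensor_carrier_B])
    fix F :: "'a \<Rightarrow> 'h \<Rightarrow> 'h \<Rightarrow> rat_mod_int"
    assume "balanced_map3 B ractB (lactL HL) (ractR HR) (lactR HR) F"
    then have F: "balB (\<lambda>b x. F b x y)" and F': "b \<in> B \<Longrightarrow> balR (F b)" for b y
      unfolding balanced_map3_def by auto
    \<comment> \<open>Stated as equalities of functions, so that they also rewrite the unapplied
      \<open>F b\<close> inside a coproduct.\<close>
    have F_left: "m \<in> B \<Longrightarrow> m' \<in> B \<Longrightarrow> F (m + m') = (\<lambda>x y. F m x y + F m' x y)"
      "m \<in> B \<Longrightarrow> F (m * \<eta>L l) = (\<lambda>x. F m (sL l * x))" for m m' l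
      by (intro ext, simp add: balB_D[OF F])+
    have bal: "balB (\<lambda>b h. DR h (F b))"
      unfolding balB_iff
      by (simp add: F_left swd_add DR_add[OF F'] DR_sL_left[OF F'])
    \<comment> \<open>After expanding \<open>iso\<close>, colinearity is the compatibility of
      \<open>\<rho>L\<close> with \<open>\<rho>R\<close>, seen through \<open>E\<close> on the first
      leg. For \<open>\<rho>L\<close> below it is coassociativity.\<close>
    have "CR a (\<lambda>a' y. swd (iso a') (\<lambda>b x. F b x y)) = CR a (\<lambda>a' y. CL a' (\<lambda>u v. F (E u) v y))"
      unfolding swd_iso[OF F] ..
    also have "\<dots> = CL a (\<lambda>u v. DR v (F (E u)))"
      using balAL_E[OF F] F'[OF E_in_B] by (rule C_compat_LR)
    also have "\<dots> = swd (iso a) (\<lambda>b h. DR h (F b))"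
      unfolding swd_iso[OF bal] ..
    finally show "(\<Sum>(b, x, y)\<leftarrow>[(b, x, y). (a', y) \<leftarrow> rep (\<rho>R a), (b, x) \<leftarrow> rep (iso a')]. F b x y) =
        (\<Sum>(b, x, y)\<leftarrow>[(b, x, y). (b, h) \<leftarrow> rep (iso a), (x, y) \<leftarrow> rep (comult HR h)]. F b x y)"
      by (simp add: swd_def split_def sum_list_bind comp_def)
  qed (auto intro: rep_iso_in_B)
  show "tcls3 B ractB (lactL HL) (ractL HL) (lactL HL)
         [(b, x, y). (a', y) \<leftarrow> rep (\<rho>L a), (b, x) \<leftarrow> rep (iso a')] =
       tcls3 B ractB (lactL HL) (ractL HL) (lactL HL)
         [(b, x, y). (b, h) \<leftarrow> rep (iso a), (x, y) \<leftarrow> rep (comult HL h)]" for a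
  proof (rule tcls3_eqI[OF tensor_carrier_B])
    fix F :: "'a \<Rightarrow> 'h \<Rightarrow> 'h \<Rightarrow> rat_mod_int"
    assume "balanced_map3 B ractB (lactL HL) (ractL HL) (lactL HL) F"
    then have F: "balB (\<lambda>b x. F b x y)" and F': "b \<in> B \<Longrightarrow> balL (F b)" for b y
      unfolding balanced_map3_def by auto
    have F_left: "m \<in> B \<Longrightarrow> m' \<in> B \<Longrightarrow> F (m + m') = (\<lambda>x y. F m x y + F m' x y)"
      "m \<in> B \<Longrightarrow> F (m * \<eta>L l) = (\<lambda>x. F m (sL l * x))" for m m' l
      by (intro ext, simp add: balB_D[OF F])+
    have bal: "balB (\<lambda>b h. DL h (F b))"
      unfolding balB_iff
      by (simp add: F_left swd_add DL_add[OF F'] DL_sL_left[OF F'])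
    have "CL a (\<lambda>a' y. swd (iso a') (\<lambda>b x. F b x y)) = CL a (\<lambda>a' y. CL a' (\<lambda>u v. F (E u) v y))"
      unfolding swd_iso[OF F] ..
    also have "\<dots> = CL a (\<lambda>u v. DL v (F (E u)))"
      using balAL_E[OF F] F'[OF E_in_B] by (rule CL_coassoc)
    also have "\<dots> = swd (iso a) (\<lambda>b h. DL h (F b))"
      unfolding swd_iso[OF bal] ..
    finally show "(\<Sum>(b, x, y)\<leftarrow>[(b, x, y). (a', y) \<leftarrow> rep (\<rho>L a), (b, x) \<leftarrow> rep (iso a')]. F b x y) =
        (\<Sum>(b, x, y)\<leftarrow>[(b, x, y). (b, h) \<leftarrow> rep (iso a), (x, y) \<leftarrow> rep (comult HL h)]. F b x y)"
      by (simp add: swd_def split_def sum_list_bind comp_def)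
  qed (auto intro: rep_iso_in_B)
qed

end

theorem theorem4p12:
  fixes scH :: "'k::{comm_ring,comm_monoid_mult} \<Rightarrow> 'h::{ring,monoid_mult} \<Rightarrow> 'h"
    and scL :: "'k \<Rightarrow> 'l::{ring,monoid_mult} \<Rightarrow> 'l"
    and scR :: "'k \<Rightarrow> 'r::{ring,monoid_mult} \<Rightarrow> 'r"
    and HL :: "('l, 'h) bialgebroid_data"
    and HR :: "('r, 'h) bialgebroid_data"
    and S :: "'h \<Rightarrow> 'h"
    and scA :: "'k \<Rightarrow> 'a::{ring,monoid_mult} \<Rightarrow> 'a"
    and \<eta>R :: "'r \<Rightarrow> 'a"
    and \<rho>R \<rho>L :: "'a \<Rightarrow> ('a \<times> 'h) list set"
    and B :: "'a set"
    and \<eta>L :: "'l \<Rightarrow> 'a"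
  assumes "hopf_algebroid scH scL scR HL HR S"
    and "cleft_extension scH scL scR HL HR S scA \<eta>R \<rho>R \<rho>L B \<eta>L"
  shows "\<exists>act \<sigma> \<phi>.
    measuring scH scA HL B \<eta>L act \<and>
    two_cocycle scH scA HL B \<eta>L act \<sigma> \<and>
    cocycle_invertible scH scA HL B \<eta>L act \<sigma> \<and>
    twisted_module scH scA HL B \<eta>L act \<sigma> \<and>
    crossed_product_iso HL HR scA \<eta>R \<rho>R \<rho>L B \<eta>L act \<sigma> \<phi>"
proof -
  obtain j where j: "cleaving_map scH HL HR scA \<eta>R \<rho>R \<rho>L \<eta>L j"
    using cleft_extension.cleft[OF assms(2)] by blast
  from cleaving_map.convolution_invertible[OF j] obtain jc where
    "k_linear scH scA jc" "\<And>l h r. jc (tgt HL l * h * tgt HR r) = \<eta>R r * jc h * \<eta>L l"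
    "\<And>h. swd (comult HR h) (\<lambda>x y. j x * jc y) = \<eta>L (counit HL h)"
    "\<And>h. swd (comult HL h) (\<lambda>x y. jc x * j y) = \<eta>R (counit HR h)"
    unfolding swd_def by blast
  with assms(2) j have "cleaving scH scL scR HL HR S scA \<eta>R \<rho>R \<rho>L B \<eta>L j jc"
    by (intro cleaving.intro cleaving_axioms.intro)
  then obtain j' jc' where
    "cleaving scH scL scR HL HR S scA \<eta>R \<rho>R \<rho>L B \<eta>L j' jc'" "j' 1 = 1"
    using cleaving.normalised by blast
  then interpret normalised_cleaving scH scL scR HL HR S scA \<eta>R \<rho>R \<rho>L B \<eta>L j' jc'
    by (intro normalised_cleaving.intro normalised_cleaving_axioms.intro)
  show ?thesis
    using measuring_act cocyc_cocycle cocyc_inverse twisted_act crossed_product_iso_iso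
    unfolding cocycle_invertible_def by blast
qed

end
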